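(* Let $P(z)=\sum_{k\ge 1}p_kz^k$ and $Q(z)=\sum_{k\ge 0}q_kz^k$ be probability-generating functions, both analytic at $z=1$, with $0<p_1<1$ and $q_0\neq 0$, and let $E=P'(1)$. Let $\widetilde\theta^*$, $p_{\rm imm}$, $A_n$, $K$, $L$ and $\vartheta_{nm}$ be the critical angle, the density, and the functions and coefficients attached to $(P,Q)$ as defined in the context. If $\widetilde\theta^*>\pi$ and $\log_E(p_1q_0)<-1$, then $$p_{\rm imm}(x)=\sum_{n=0}^{+\infty}A_n\,x^{-\log_E(p_1^{n+1}q_0)-1}\,B_n(-\log_E x),\qquad x>0,$$ where the one-periodic functions $B_n$ are defined by $$B_n(z)=\sum_{m=-\infty}^{+\infty}\frac{\vartheta_{nm}\,e^{2\pi \mathbf{i} m z}}{\Gamma\left(-\frac{\ln(p_1^{n+1}q_0)+2\pi \mathbf{i} m}{\ln E}\right)}.$$ Moreover, the double series obtained by substituting the second formula into the first converges super-exponentially fast in $n$ and exponentially fast in $m$, namely there are constants $\alpha,\beta,C>0$ such that for all integers $n\ge 0$ and $m\in\mathbb{Z}$ $$\left|\frac{A_n\vartheta_{nm}}{\Gamma\left(-\frac{\ln(p_1^{n+1}q_0)+2\pi \mathbf{i} m}{\ln E}\right)}\right|\le C e^{-\alpha n\ln(n+|m|)-\beta|m|},$$ where $n\ln(n+|m|)$ is read as $0$ when $n=m=0$.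
   Context: **Process.** The Galton-Watson process with immigration is $X_0=1$, $X_{t+1}=\sum_{j=1}^{X_t}\xi_{j,t}+Y_t$ for $t=0,1,2,\dots$, where the $\xi_{j,t}$ are independent and identically distributed, positive-integer valued, with probability-generating function $P(z)=\mathbb{E}z^{\xi}=p_1z+p_2z^2+\cdots$, and the $Y_t$ are identically distributed, nonnegative-integer valued, independent of each other and of all $\xi_{j,t}$, with probability-generating function $Q(z)=\mathbb{E}z^{Y}=q_0+q_1z+q_2z^2+\cdots$. Here $p_0=0$, $0<p_1<1$, $q_0\ne0$, and $P$, $Q$ are analytic at $z=1$. Put $E=P'(1)$ (so $1<E<\infty$) and $\log_E x=\ln x/\ln E$. Write $P_t=\underbrace{P\circ\cdots\circ P}_{t}$ and $P_0(z)=z$. **Critical angle.** The (open) filled Julia set of $P$ is the open set $\mathscr{J}_P$ of points $z$ whose iterates satisfy $P_t(z)\to0$ as $t\to+\infty$; it contains the open unit disc. The critical angle $\widetilde\theta^*$ is the maximal (full opening) angle of a sector with vertex $1$ and arbitrarily small radius lying entirely in the filled Julia set. That is, it is the supremum of the $\theta>0$ such that for some $r_0>0$ all points $1-re^{\mathbf{i}\varphi}$ with $0<r<r_0$, $|\varphi|<\theta/2$ lie in $\mathscr{J}_P$. **Functions.** - $\Pi(z)=\lim_{t\to+\infty}P_t(1-z/E^t)$. It satisfies $P(\Pi(z))=\Pi(Ez)$, $\Pi(0)=1$, $\Pi'(0)=-1$. - $\Phi(z)=\lim_{t\to+\infty}p_1^{-t}P_t(z)$. It is analytic in $\mathscr{J}_P$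 and satisfies $\Phi(P(z))=p_1\Phi(z)$, $\Phi(z)\sim z$ as $z\to0$. $\Phi^{-1}$ denotes its local inverse near $0$ with $\Phi^{-1}(0)=0$. - $R(z)=\prod_{t=1}^{+\infty}Q(\Pi(z/E^t))$. It satisfies $R(Ez)=R(z)Q(\Pi(z))$, $R(0)=1$. - $\Psi(z)=\prod_{t=0}^{+\infty}q_0^{-1}Q(P_t(z))$. It satisfies $Q(z)\Psi(P(z))=q_0\Psi(z)$, $\Psi(0)=1$. - $\Pi_{\rm imm}(z)=\Pi(z)R(z)$. **Density.** The density $p_{\rm imm}$ of the martingale limit $\lim_{t\to+\infty}E^{-t}X_t$ is given by $$p_{\rm imm}(x)=\frac1{2\pi}\int_{-\infty}^{+\infty}\Pi_{\rm imm}(\mathbf{i}y)e^{\mathbf{i}yx}\,dy.$$ **Periodic functions and coefficients.** The functions $$K(z)=p_1^{-z}\Phi(\Pi(E^z)),\qquad L(z)=q_0^{-z}R(E^z)\Psi(\Pi(E^z))$$ are defined for real $z$ (where $\Pi(E^z)\in(0,1)$), are one-periodic, and extend analytically to a strip around the real axis. The numbers $\vartheta_{nm}$ are the Fourier coefficients of the one-periodic functions $K^{n+1}L$ (pointwise power and product): $$K(z)^{n+1}L(z)=\sum_{m=-\infty}^{+\infty}\vartheta_{nm}e^{2\pi \mathbf{i} m z},\qquad n\ge0.$$ The numbers $A_n$ are the Taylor coefficients at $0$ of $$A(z)=\frac{\Phi^{-1}(z)}{z\,\Psi(\Phi^{-1}(z))}=\sum_{n=0}^{+\infty}A_nz^n,$$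 which is analytic near $z=0$ (removable singularity at $0$, $A_0=1$). *)

theory Defs
  imports "HOL-Probability.Probability" "HOL-Complex_Analysis.Complex_Analysis"
begin

text \<open>
  The offspring and immigration laws are \<open>p, q :: nat pmf\<close>, so \<open>p\<^sub>1 = pmf p 1\<close> and
  \<open>q\<^sub>0 = pmf q 0\<close>.

  Outside the closed disc of convergence the series diverges and \<^const>\<open>suminf\<close> is one fixed
  constant.  Hence \<open>pgf p analytic_on {1}\<close> is the same as analyticity at 1 in the usual sense:
  by Pringsheim's theorem both mean that the radius of convergence exceeds 1.
\<close>

definition pgf :: "nat pmf \<Rightarrow> complex \<Rightarrow> complex" where
  "pgf p z = (\<Sum>k. of_real (pmf p k) * z ^ k)"

definition gw_E :: "nat pmf \<Rightarrow> real" where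
  "gw_E p = Re (deriv (pgf p) 1)"


text \<open>
  The filled Julia set depends on the domain \<open>D\<close> on which \<open>P\<close> is regarded as an analytic function
  (the disc of convergence, the plane minus the poles of a rational \<open>P\<close>, ...).  All iterates are
  required to stay in \<open>D\<close>, since outside it the values of \<open>P\<close> carry no meaning.
\<close>

definition filled_julia :: "complex set \<Rightarrow> (complex \<Rightarrow> complex) \<Rightarrow> complex set" where
  "filled_julia D P = {z. (\<forall>t. (P ^^ t) z \<in> D) \<and> (\<lambda>t. (P ^^ t) z) \<longlonglongrightarrow> 0}"

text \<open>Valued in \<^typ>\<open>ereal\<close> so that the supremum needs no separate boundedness argument.\<close>

definition critical_angle :: "complex set \<Rightarrow> (complex \<Rightarrow> complex) \<Rightarrow> ereal" where
  "critical_angle D P = Sup (ereal ` {\<theta>. \<theta> > 0 \<and>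
     (\<exists>r0>0. \<forall>r \<phi>. 0 < r \<and> r < r0 \<and> \<bar>\<phi>\<bar> < \<theta> / 2 \<longrightarrow>
        1 - of_real r * exp (\<i> * of_real \<phi>) \<in> filled_julia D P)})"


definition gw_Pi :: "nat pmf \<Rightarrow> complex \<Rightarrow> complex" where
  "gw_Pi p z = lim (\<lambda>t. (pgf p ^^ t) (1 - z / of_real (gw_E p) ^ t))"

definition gw_Phi :: "nat pmf \<Rightarrow> complex \<Rightarrow> complex" where
  "gw_Phi p z = lim (\<lambda>t. (pgf p ^^ t) z / of_real (pmf p 1) ^ t)"

text \<open>The product starts at \<open>t = 1\<close>, whence the index shift.\<close>

definition gw_R :: "nat pmf \<Rightarrow> nat pmf \<Rightarrow> complex \<Rightarrow> complex" where
  "gw_R p q z = (\<Prod>t. pgf q (gw_Pi p (z / of_real (gw_E p) ^ Suc t)))"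

definition gw_Psi :: "nat pmf \<Rightarrow> nat pmf \<Rightarrow> complex \<Rightarrow> complex" where
  "gw_Psi p q z = (\<Prod>t. pgf q ((pgf p ^^ t) z) / of_real (pmf q 0))"

definition gw_Pi_imm :: "nat pmf \<Rightarrow> nat pmf \<Rightarrow> complex \<Rightarrow> complex" where
  "gw_Pi_imm p q z = gw_Pi p z * gw_R p q z"

definition gw_p_imm :: "nat pmf \<Rightarrow> nat pmf \<Rightarrow> real \<Rightarrow> complex" where
  "gw_p_imm p q x = 1 / (2 * of_real pi) *
     (LINT y|lborel. gw_Pi_imm p q (\<i> * of_real y) * exp (\<i> * of_real y * of_real x))"


definition gw_K :: "nat pmf \<Rightarrow> real \<Rightarrow> complex" where
  "gw_K p z = of_real (pmf p 1 powr (- z)) * gw_Phi p (gw_Pi p (of_real (gw_E p powr z)))"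

definition gw_L :: "nat pmf \<Rightarrow> nat pmf \<Rightarrow> real \<Rightarrow> complex" where
  "gw_L p q z = of_real (pmf q 0 powr (- z)) * gw_R p q (of_real (gw_E p powr z)) *
     gw_Psi p q (gw_Pi p (of_real (gw_E p powr z)))"

definition gw_theta :: "nat pmf \<Rightarrow> nat pmf \<Rightarrow> nat \<Rightarrow> int \<Rightarrow> complex" where
  "gw_theta p q n m = integral {0..1}
     (\<lambda>z. gw_K p z ^ (n + 1) * gw_L p q z * exp (- (2 * of_real pi * \<i> * of_int m * of_real z)))"


definition is_local_inverse_0 :: "(complex \<Rightarrow> complex) \<Rightarrow> (complex \<Rightarrow> complex) \<Rightarrow> bool" where
  "is_local_inverse_0 f g \<longleftrightarrow> g analytic_on {0} \<and> g 0 = 0 \<and>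
     (\<forall>\<^sub>F z in nhds 0. f (g z) = z) \<and> (\<forall>\<^sub>F z in nhds 0. g (f z) = z)"

text \<open>
  Only the germ of the local inverse at 0 is determined; the Taylor coefficients below depend on
  nothing else.
\<close>

definition gw_Phi_inv :: "nat pmf \<Rightarrow> complex \<Rightarrow> complex" where
  "gw_Phi_inv p = (SOME g. is_local_inverse_0 (gw_Phi p) g)"

text \<open>The value at 0 fills in the removable singularity.\<close>

definition gw_A_fun :: "nat pmf \<Rightarrow> nat pmf \<Rightarrow> complex \<Rightarrow> complex" where
  "gw_A_fun p q z = (if z = 0 then 1
     else gw_Phi_inv p z / (z * gw_Psi p q (gw_Phi_inv p z)))"

definition gw_A :: "nat pmf \<Rightarrow> nat pmf \<Rightarrow> nat \<Rightarrow> complex" where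
  "gw_A p q n = (deriv ^^ n) (gw_A_fun p q) 0 / fact n"


definition gw_Gamma :: "nat pmf \<Rightarrow> nat pmf \<Rightarrow> nat \<Rightarrow> int \<Rightarrow> complex" where
  "gw_Gamma p q n m = Gamma (- ((of_real (ln (pmf p 1 ^ (n + 1) * pmf q 0))
      + 2 * of_real pi * \<i> * of_int m) / of_real (ln (gw_E p))))"

definition gw_B :: "nat pmf \<Rightarrow> nat pmf \<Rightarrow> nat \<Rightarrow> real \<Rightarrow> complex" where
  "gw_B p q n z = (\<Sum>\<^sub>\<infinity>m::int.
     gw_theta p q n m * exp (2 * of_real pi * \<i> * of_int m * of_real z) / gw_Gamma p q n m)"

end

theory Submission
  imports Defs
begin

text \<open>
  Write \<open>w = \<Phi> \<circ> \<Pi>\<close> and \<open>l(z) = R(z) \<Psi>(\<Pi>(z))\<close>.  The functional equations give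
  \<open>w(E z) = p\<^sub>1 w(z)\<close> and \<open>l(E z) = q\<^sub>0 l(z)\<close>.  As \<open>z\<close> tends to infinity in the right half-plane,
  \<open>\<Pi>(z)\<close> tends to 0, so the local inverse of \<open>\<Phi>\<close> recovers \<open>\<Pi>(z)\<close> from \<open>w(z)\<close>, and
  \<open>\<Pi>(z) R(z) = w A(w) l(z) = \<Sum>\<^sub>n A\<^sub>n w(z)\<^bsup>n+1\<^esup> l(z)\<close>  (\<open>Pi_imm_eq\<close>).  By the functional equations
  \<open>w\<^bsup>n+1\<^esup> l\<close> is a power of \<open>z\<close> times the one-periodic function \<open>K\<^bsup>n+1\<^esup> L\<close> of \<open>log\<^sub>E z\<close>, so its
  Fourier series is a series of pure powers \<open>\<vartheta>\<^sub>n\<^sub>m z\<^bsup>-s\<^esup>\<close> with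
  \<open>s = -(ln(p\<^sub>1\<^bsup>n+1\<^esup> q\<^sub>0) + 2\<pi>im)/ln E\<close>  (\<open>Wf_Lf_expansion\<close>).  The inverse Laplace transform of
  \<open>z\<^bsup>-s\<^esup>\<close> is \<open>x\<^bsup>s-1\<^esup>/\<Gamma>(s)\<close>  (\<open>inverse_laplace_powr\<close>), which is the general term of the theorem.

  The integral defining the density runs along the imaginary axis, where the series in \<open>n\<close> need not
  converge.  It is moved to a line \<open>Re z = T\<close> far to the right  (\<open>p_imm_shifted_line\<close>); there
  \<open>|w|\<close> is at most half of a radius within which \<open>A\<close> is holomorphic, and both sums may be
  exchanged with the integral  (\<open>W_line_integral\<close>, \<open>p_imm_series\<close>).  The condition
  \<open>log\<^sub>E (p\<^sub>1 q\<^sub>0) < -1\<close> makes \<open>\<Pi> R\<close> integrable along vertical lines and gives every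
  exponent \<open>s\<close> a real part above 1.

  Two facts make the sums converge.  First, \<open>\<Pi>\<close> is analytic on a sector of half-opening
  \<open>\<pi>/2 + \<epsilon>\<close> and maps the part of it away from 0 into the open unit disc  (\<open>gw_sector_exists\<close>):
  on the closed right half-plane this holds because \<open>|\<Pi>(z)| = 1\<close> would force \<open>\<Pi>(z/E)\<close> to be a
  root of unity, and by compactness of an annulus it persists on a slightly larger sector, from
  which the functional equation spreads it.  Hence \<open>K\<close> and \<open>L\<close> extend to a strip of half-width
  greater than \<open>\<pi>/(2 ln E)\<close>, and the decay of \<open>\<vartheta>\<^sub>n\<^sub>m\<close> in \<open>m\<close> beats the growth
  \<open>exp(\<pi>|Im s|/2)\<close> of \<open>1/\<Gamma>(s)\<close> by an exponential factor.  Second, \<open>1/\<Gamma>(\<sigma>) \<le> exp(2\<sigma> - \<sigma> ln \<sigma>)\<close> with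
  \<open>\<sigma> = Re s\<close> growing linearly in \<open>n\<close> gives the super-exponential decay, and
  \<open>n ln(n + |m|) \<le> n ln(n + 1) + |m|\<close> reduces the mixed bound of the theorem to these two.
\<close>

section \<open>Fourier and Laplace inversion\<close>

lemma fourier_transform_gaussian:
  fixes k u :: real assumes "k > 0"
  shows "(LINT y|lborel. of_real (std_normal_density (y / k)) * exp (\<i> * of_real y * of_real u)) 
          = of_real (k * exp (- (k*u)\<^sup>2 / 2))"
proof -
  have "char std_normal_distribution (k*u) = of_real (exp (- (k*u)\<^sup>2 / 2))"
    by (simp add: char_std_normal_distribution)
  hence 1: "(LINT v|lborel. of_real (std_normal_density v) * exp (\<i> * of_real (v * (k*u)))) = of_real (exp (- (k*u)\<^sup>2 / 2))"
    unfolding char_def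
    by (subst (asm) integral_density) (auto simp: scaleR_conv_of_real mult_ac)
  have "(LINT y|lborel. of_real (std_normal_density (y / k)) * exp (\<i> * of_real y * of_real u)) 
       = \<bar>k\<bar> *\<^sub>R (LINT v|lborel. of_real (std_normal_density ((0 + k * v) / k)) * exp (\<i> * of_real (0 + k * v) * of_real u))"
    using assms by (intro lborel_integral_real_affine) auto
  also have "(\<lambda>v. complex_of_real (std_normal_density ((0 + k * v) / k)) * exp (\<i> * of_real (0 + k * v) * of_real u))
     = (\<lambda>v. of_real (std_normal_density v) * exp (\<i> * of_real (v * (k*u))))"
    using assms by (auto simp: mult_ac)
  finally show ?thesis unfolding 1 using assms by (simp add: scaleR_conv_of_real)
qed

lemma integrable_std_normal_density_scaled: 
  fixes k :: real assumes "k > 0"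
  shows "integrable lborel (\<lambda>y. std_normal_density (y / k))"
  using lborel_integrable_real_affine[of "std_normal_density" "1/k" 0] assms
  by (simp add: integrable_normal_density)

text \<open>
  The Fourier integral is damped by a Gaussian of width \<open>k\<close>.  By Fubini the damped integral is
  \<open>2\<pi>\<close> times the average of \<open>\<phi>\<close> against a Gaussian of width \<open>1/k\<close> around \<open>x\<close>, which tends to \<open>\<phi> x\<close> by continuity, while
  by dominated convergence it also tends to the undamped integral.
\<close>
theorem fourier_inversion:
  fixes \<phi> :: "real \<Rightarrow> complex"
  assumes int: "integrable lborel \<phi>" and bd: "\<And>t. norm (\<phi> t) \<le> B" and cont: "isCont \<phi> x"
    and inth: "integrable lborel (\<lambda>y. LINT t|lborel. \<phi> t * exp (-(\<i> * of_real y * of_real t)))"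
  shows "(LINT y|lborel. (LINT t|lborel. \<phi> t * exp (-(\<i> * of_real y * of_real t))) * exp (\<i> * of_real y * of_real x))
          = 2 * of_real pi * \<phi> x"
proof -
  define F where "F = (\<lambda>y::real. LINT t|lborel. \<phi> t * exp (-(\<i> * of_real y * of_real t)))"
  define g where "g = (\<lambda>k y. sqrt (2*pi) * std_normal_density (y / real (Suc k)))"
  have gexp: "g k y = exp (- (y / real (Suc k))\<^sup>2 / 2)" for k y
    by (simp add: g_def std_normal_density_def)
  have [measurable]: "\<phi> \<in> borel_measurable lborel" "F \<in> borel_measurable lborel"
    using int inth by (auto simp: F_def)
  have [measurable]: "g k \<in> borel_measurable lborel" for k by (simp add: g_def)
  have lim1: "(\<lambda>k. LINT y|lborel. F y * exp (\<i> * of_real y * of_real x) * of_real (g k y))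
        \<longlonglongrightarrow> (LINT y|lborel. F y * exp (\<i> * of_real y * of_real x))"
  proof (rule integral_dominated_convergence[where w = "\<lambda>y. norm (F y)"])
    show "integrable lborel (\<lambda>y. norm (F y))" using inth by (simp add: F_def)
    show "AE y in lborel. (\<lambda>k. F y * exp (\<i> * of_real y * of_real x) * of_real (g k y)) \<longlonglongrightarrow> F y * exp (\<i> * of_real y * of_real x)"
    proof (rule AE_I2)
      fix y :: real
      have "(\<lambda>k. y * inverse (real (Suc k))) \<longlonglongrightarrow> y * 0"
        by (intro tendsto_mult tendsto_const LIMSEQ_inverse_real_of_nat)
      hence "(\<lambda>k. y / real (Suc k)) \<longlonglongrightarrow> 0" by (simp add: field_simps)
      hence "(\<lambda>k. exp (- (y / real (Suc k))\<^sup>2 / 2)) \<longlonglongrightarrow> exp (- 0\<^sup>2 / 2)" by (intro tendsto_intros) auto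
      hence "(\<lambda>k. complex_of_real (g k y)) \<longlonglongrightarrow> of_real 1" unfolding gexp by (intro tendsto_of_real) auto
      from tendsto_mult[OF tendsto_const this, of "F y * exp (\<i> * of_real y * of_real x)"]
      show "(\<lambda>k. F y * exp (\<i> * of_real y * of_real x) * of_real (g k y)) \<longlonglongrightarrow> F y * exp (\<i> * of_real y * of_real x)" by simp
    qed
    show "AE y in lborel. norm (F y * exp (\<i> * of_real y * of_real x) * of_real (g k y)) \<le> norm (F y)" for k
      by (intro AE_I2) (auto simp: norm_mult gexp intro!: mult_left_le)
  qed (auto simp: )
  have eq: "(LINT y|lborel. F y * exp (\<i> * of_real y * of_real x) * of_real (g k y))
        = 2 * of_real pi * (LINT v|lborel. \<phi> (x + v / real (Suc k)) * of_real (std_normal_density v))" for k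
  proof -
    define K where "K = real (Suc k)"
    have K: "K > 0" by (simp add: K_def)
    have gK: "g k y = sqrt (2*pi) * std_normal_density (y / K)" for y by (simp add: g_def K_def)
    have intg: "integrable lborel (g k)" unfolding g_def
      by (intro integrable_mult_right integrable_std_normal_density_scaled) auto
    have "(LINT y|lborel. F y * exp (\<i> * of_real y * of_real x) * of_real (g k y))
      = (LINT y|lborel. LINT t|lborel. \<phi> t * exp (\<i> * of_real y * of_real (x - t)) * of_real (g k y))"
    proof (rule Bochner_Integration.integral_cong[OF refl])
      fix y :: real
      have "F y * exp (\<i> * of_real y * of_real x) * of_real (g k y)
        = (LINT t|lborel. \<phi> t * exp (-(\<i> * of_real y * of_real t)) * (exp (\<i> * of_real y * of_real x) * of_real (g k y)))"
        unfolding F_def integral_mult_left_zero by (simp only: mult.assoc)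
      also have "\<dots> = (LINT t|lborel. \<phi> t * exp (\<i> * of_real y * of_real (x - t)) * of_real (g k y))"
        by (rule Bochner_Integration.integral_cong) (auto simp: algebra_simps exp_diff exp_minus field_simps)
      finally show "F y * exp (\<i> * of_real y * of_real x) * of_real (g k y) = \<dots>" .
    qed
    also have "\<dots> = (LINT t|lborel. LINT y|lborel. \<phi> t * exp (\<i> * of_real y * of_real (x - t)) * of_real (g k y))"
    proof (rule lborel_pair.Fubini_integral)
      have "integrable (lborel \<Otimes>\<^sub>M lborel) (\<lambda>(t, y). \<phi> t * of_real (g k y) :: complex)"
      proof (rule lborel_pair.Fubini_integrable)
        show "integrable lborel (\<lambda>t. LINT y|lborel. norm (case (t, y) of (t, y) \<Rightarrow> \<phi> t * of_real (g k y)))"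
          using int by (simp add: norm_mult)
        show "AE t in lborel. integrable lborel (\<lambda>y. case (t, y) of (t, y) \<Rightarrow> \<phi> t * of_real (g k y))"
          using intg by (auto intro!: AE_I2)
      qed auto
      thus "integrable (lborel \<Otimes>\<^sub>M lborel) (\<lambda>(t, y). \<phi> t * exp (\<i> * of_real y * of_real (x - t)) * of_real (g k y))"
        by (rule Bochner_Integration.integrable_bound) (auto simp: norm_mult)
    qed
    also have "\<dots> = (LINT t|lborel. \<phi> t * of_real (sqrt (2*pi)) * of_real (K * exp (- (K*(x - t))\<^sup>2 / 2)))"
    proof (rule Bochner_Integration.integral_cong[OF refl])
      fix t :: real
      have "(LINT y|lborel. \<phi> t * exp (\<i> * of_real y * of_real (x - t)) * of_real (g k y))
        = (LINT y|lborel. \<phi> t * of_real (sqrt (2*pi)) * (of_real (std_normal_density (y / K)) * exp (\<i> * of_real y * of_real (x - t))))"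
        by (rule Bochner_Integration.integral_cong) (auto simp: gK mult_ac)
      also have "\<dots> = \<phi> t * of_real (sqrt (2*pi)) * of_real (K * exp (- (K*(x - t))\<^sup>2 / 2))"
        using K by (simp only: integral_mult_right_zero fourier_transform_gaussian)
      finally show "(LINT y|lborel. \<phi> t * exp (\<i> * of_real y * of_real (x - t)) * of_real (g k y)) = \<dots>" .
    qed
    also have "\<dots> = \<bar>inverse K\<bar> *\<^sub>R (LINT v|lborel. \<phi> (x + inverse K * v) * of_real (sqrt (2*pi)) * of_real (K * exp (- (K*(x - (x + inverse K * v)))\<^sup>2 / 2)))"
      using K by (intro lborel_integral_real_affine) auto
    also have "\<dots> = (LINT v|lborel. \<bar>inverse K\<bar> *\<^sub>R (\<phi> (x + inverse K * v) * of_real (sqrt (2*pi)) * of_real (K * exp (- (K*(x - (x + inverse K * v)))\<^sup>2 / 2))))"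
      by simp
    also have "\<dots> = (LINT v|lborel. (2 * of_real pi) * (\<phi> (x + v/K) * of_real (std_normal_density v)))"
    proof (rule Bochner_Integration.integral_cong[OF refl])
      fix v :: real
      have e: "(K*(x - (x + inverse K * v)))\<^sup>2 = v\<^sup>2" using K by (simp add: field_simps)
      have "sqrt (2*pi) * sqrt (2*pi) = 2 * pi" by simp
      hence d: "2 * pi * std_normal_density v = sqrt (2*pi) * exp (- v\<^sup>2/2)"
        by (simp add: std_normal_density_def field_simps)
      have "\<bar>inverse K\<bar> *\<^sub>R (\<phi> (x + inverse K * v) * of_real (sqrt (2*pi)) * of_real (K * exp (- (K*(x - (x + inverse K * v)))\<^sup>2 / 2)))
        = \<phi> (x + v/K) * of_real (sqrt (2*pi) * exp (- v\<^sup>2/2))"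
        using K unfolding e by (simp add: scaleR_conv_of_real field_simps)
      also have "\<dots> = (2 * of_real pi) * (\<phi> (x + v/K) * of_real (std_normal_density v))"
        unfolding d[symmetric] by simp
      finally show "\<bar>inverse K\<bar> *\<^sub>R (\<phi> (x + inverse K * v) * of_real (sqrt (2*pi)) * of_real (K * exp (- (K*(x - (x + inverse K * v)))\<^sup>2 / 2))) = \<dots>" .
    qed
    finally show ?thesis by (simp add: K_def)
  qed
  have "(\<lambda>k. LINT v|lborel. \<phi> (x + v / real (Suc k)) * of_real (std_normal_density v))
        \<longlonglongrightarrow> (LINT v|lborel. \<phi> x * of_real (std_normal_density v))"
  proof (rule integral_dominated_convergence[where w = "\<lambda>v. B * std_normal_density v"])
    show "integrable lborel (\<lambda>v. B * std_normal_density v)" by (simp add: integrable_normal_density)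
    show "AE v in lborel. (\<lambda>k. \<phi> (x + v / real (Suc k)) * of_real (std_normal_density v)) \<longlonglongrightarrow> \<phi> x * of_real (std_normal_density v)"
    proof (rule AE_I2)
      fix v :: real
      have "(\<lambda>k. x + v * inverse (real (Suc k))) \<longlonglongrightarrow> x + v * 0"
        by (intro tendsto_intros LIMSEQ_inverse_real_of_nat)
      hence "(\<lambda>k. x + v / real (Suc k)) \<longlonglongrightarrow> x" by (simp add: field_simps)
      from isCont_tendsto_compose[OF cont this]
      show "(\<lambda>k. \<phi> (x + v / real (Suc k)) * of_real (std_normal_density v)) \<longlonglongrightarrow> \<phi> x * of_real (std_normal_density v)"
        by (intro tendsto_intros)
    qed
    show "AE v in lborel. norm (\<phi> (x + v / real (Suc k)) * of_real (std_normal_density v)) \<le> B * std_normal_density v" for k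
      using bd by (intro AE_I2) (auto simp: norm_mult intro!: mult_right_mono)
  qed auto
  also have "(LINT v|lborel. \<phi> x * of_real (std_normal_density v)) = \<phi> x * of_real (LINT v|lborel. std_normal_density v)"
    by (simp only: integral_mult_right_zero integral_complex_of_real)
  also have "(LINT v|lborel. std_normal_density v) = 1" by (simp add: integral_normal_density)
  finally have "(\<lambda>k. 2 * of_real pi * (LINT v|lborel. \<phi> (x + v / real (Suc k)) * of_real (std_normal_density v)))
        \<longlonglongrightarrow> 2 * of_real pi * (\<phi> x * of_real 1)" by (intro tendsto_intros)
  hence "(\<lambda>k. LINT y|lborel. F y * exp (\<i> * of_real y * of_real x) * of_real (g k y)) \<longlonglongrightarrow> 2 * of_real pi * \<phi> x"
    unfolding eq by simp
  from LIMSEQ_unique[OF lim1 this] show ?thesis unfolding F_def .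
qed

text \<open>
  The integrand \<open>t\<^bsup>s-1\<^esup> e\<^bsup>-wt\<^esup>\<close> of the Laplace transform of a power, extended by 0 to \<open>t \<le> 0\<close>.
\<close>
definition laplace_kernel :: "complex \<Rightarrow> complex \<Rightarrow> real \<Rightarrow> complex" where
  "laplace_kernel s w t = indicator {0<..} t *\<^sub>R exp ((s - 1) * of_real (ln t) - w * of_real t)"

lemma laplace_kernel_measurable [measurable]: "laplace_kernel s w \<in> borel_measurable lborel"
  unfolding laplace_kernel_def[abs_def] by measurable

lemma laplace_kernel_pos: "t > 0 \<Longrightarrow> laplace_kernel s w t = exp ((s - 1) * of_real (ln t) - w * of_real t)"
  by (simp add: laplace_kernel_def)

lemma laplace_kernel_integrable:
  assumes "Re s > 0" "Re w > 0"
  shows "integrable lborel (laplace_kernel s w)"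
proof -
  have "(\<lambda>t. complex_of_real t powr (s - 1) / of_real (exp (Re w * t))) absolutely_integrable_on {0<..}"
    using assms by (intro absolutely_integrable_Gamma_integral)
  hence "integrable lebesgue (\<lambda>t. norm (indicator {0<..} t *\<^sub>R (complex_of_real t powr (s - 1) / of_real (exp (Re w * t)))))"
    unfolding set_integrable_def by (rule integrable_norm)
  also have "(\<lambda>t. norm (indicator {0<..} t *\<^sub>R (complex_of_real t powr (s - 1) / of_real (exp (Re w * t))))) = (\<lambda>t. norm (laplace_kernel s w t))"
    by (auto simp: laplace_kernel_def powr_def Ln_of_real norm_divide exp_diff indicator_def fun_eq_iff)
  finally have "integrable lborel (\<lambda>t. norm (laplace_kernel s w t))"
    by (subst (asm) integrable_completion) auto
  thus ?thesis by (subst (asm) integrable_norm_iff) auto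
qed

lemma laplace_kernel_integral_one:
  assumes "Re s > 0"
  shows "(LINT t|lborel. laplace_kernel s 1 t) = Gamma s"
proof -
  have "((\<lambda>t. complex_of_real t powr (s - 1) / of_real (exp t)) has_integral Gamma s) {0..}"
    using assms by (rule Gamma_integral_complex)
  hence "((\<lambda>t. if t \<in> {0..} then complex_of_real t powr (s - 1) / of_real (exp t) else 0) has_integral Gamma s) UNIV"
    by (subst has_integral_restrict_UNIV)
  hence "(laplace_kernel s 1 has_integral Gamma s) UNIV"
    by (rule has_integral_spike[where S = "{0}", rotated 2])
       (auto simp: laplace_kernel_def powr_def Ln_of_real exp_diff exp_of_real)
  moreover have "(laplace_kernel s 1 has_integral (LINT t|lborel. laplace_kernel s 1 t)) UNIV"
    using assms by (intro has_integral_integral_lborel laplace_kernel_integrable) auto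
  ultimately show ?thesis by (rule has_integral_unique[symmetric])
qed

lemma laplace_kernel_integral_real:
  assumes "Re s > 0" "b > 0"
  shows "(LINT t|lborel. laplace_kernel s (of_real b) t) = Gamma s * exp (- s * of_real (ln b))"
proof -
  have "Gamma s = \<bar>b\<bar> *\<^sub>R (LINT t|lborel. laplace_kernel s 1 (0 + b * t))"
    unfolding laplace_kernel_integral_one[OF assms(1), symmetric] using assms
    by (intro lborel_integral_real_affine) auto
  also have "(\<lambda>t. laplace_kernel s 1 (0 + b * t)) = (\<lambda>t. exp ((s - 1) * of_real (ln b)) * laplace_kernel s (of_real b) t)"
  proof
    fix t :: real
    show "laplace_kernel s 1 (0 + b * t) = exp ((s - 1) * of_real (ln b)) * laplace_kernel s (of_real b) t"
    proof (cases "t > 0")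
      case True
      thus ?thesis using assms by (simp add: laplace_kernel_pos ln_mult exp_add[symmetric] algebra_simps)
    next
      case False
      thus ?thesis using assms by (simp add: laplace_kernel_def zero_less_mult_iff)
    qed
  qed
  also have "\<bar>b\<bar> *\<^sub>R (LINT t|lborel. exp ((s - 1) * of_real (ln b)) * laplace_kernel s (of_real b) t)
     = (of_real b * exp ((s - 1) * of_real (ln b))) * (LINT t|lborel. laplace_kernel s (of_real b) t)"
    using assms by (simp add: scaleR_conv_of_real mult_ac)
  also have "of_real b * exp ((s - 1) * of_real (ln b)) = exp (s * of_real (ln b))"
  proof -
    have "of_real b = exp (complex_of_real (ln b))" using assms by (simp add: exp_of_real)
    hence "of_real b * exp ((s - 1) * of_real (ln b)) = exp (complex_of_real (ln b)) * exp ((s - 1) * of_real (ln b))" by (rule arg_cong)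
    thus ?thesis by (simp add: exp_add[symmetric] algebra_simps)
  qed
  finally show ?thesis by (simp add: exp_minus field_simps)
qed

text \<open>
  For real \<open>w\<close> this is Euler's integral after a change of scale.  A complex \<open>w\<close> with positive real part
  lies in a disc \<open>|w - b| < b\<close> with \<open>b\<close> real; expanding \<open>e\<^bsup>-(w-b)t\<^esup>\<close> and integrating term by term yields the
  binomial series of \<open>(w/b)\<^bsup>-s\<^esup>\<close>.  The partial sums are dominated by the kernel at the point \<open>b - |w - b| > 0\<close>.
\<close>
theorem laplace_kernel_integral:
  assumes s: "Re s > 0" and w: "Re w > 0"
  shows "(LINT t|lborel. laplace_kernel s w t) = Gamma s * w powr (-s)"
proof -
  obtain b where b: "b > 0" "norm (w - of_real b) < b"
  proof -
    \<comment> \<open>\<open>|w - b| < b\<close> means \<open>|w|\<^sup>2 < 2 b Re w\<close>.\<close>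
    define b where "b = ((norm w)\<^sup>2 + 1) / Re w"
    have b0: "b > 0" using w by (auto simp: b_def intro!: divide_pos_pos add_nonneg_pos)
    have bw: "b * Re w = (norm w)\<^sup>2 + 1" using w by (simp add: b_def)
    have "(norm (w - of_real b))\<^sup>2 = (norm w)\<^sup>2 - 2 * (b * Re w) + b\<^sup>2"
      by (simp only: cmod_power2 Re_complex_of_real Im_complex_of_real minus_complex.sel) (simp add: power2_eq_square algebra_simps)
    also have "\<dots> < b\<^sup>2" unfolding bw using zero_le_power2[of "norm w"] by (simp add: algebra_simps add_pos_nonneg)
    finally have "norm (w - of_real b) < b" using b0 by (simp add: power2_less_imp_less)
    with b0 that show ?thesis by blast
  qed
  define d where "d = w - of_real b"
  define c where "c = b - norm d"
  have c: "c > 0" using b by (simp add: c_def d_def)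
  define u where "u = (\<lambda>k t. laplace_kernel s (of_real b) t * ((- d * of_real t) ^ k / fact k))"
  have uk: "u k = (\<lambda>t. ((-d) ^ k / fact k) * laplace_kernel (s + of_nat k) (of_real b) t)" for k
  proof
    fix t :: real
    show "u k t = ((-d) ^ k / fact k) * laplace_kernel (s + of_nat k) (of_real b) t"
    proof (cases "t > 0")
      case True
      have "(complex_of_real t) ^ k = exp (of_nat k * of_real (ln t))"
        using True by (metis exp_of_nat_mult exp_ln exp_of_real)
      thus ?thesis using True unfolding u_def power_mult_distrib
        by (simp add: laplace_kernel_pos exp_add[symmetric] field_simps)
    next
      case False
      thus ?thesis by (simp add: u_def laplace_kernel_def)
    qed
  qed
  have iu: "integrable lborel (u k)" for k
    unfolding uk using s b by (intro integrable_mult_right laplace_kernel_integrable) auto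
  have "(\<lambda>n. LINT t|lborel. (\<Sum>k<n. u k t)) \<longlonglongrightarrow> (LINT t|lborel. laplace_kernel s w t)"
  proof (rule integral_dominated_convergence[where w = "\<lambda>t. norm (laplace_kernel s (of_real c) t)"])
    show "integrable lborel (\<lambda>t. norm (laplace_kernel s (of_real c) t))"
      using s c by (intro integrable_norm laplace_kernel_integrable) auto
    show "(\<lambda>t. \<Sum>k<n. u k t) \<in> borel_measurable lborel" for n
      using iu by (intro borel_measurable_sum) auto
    show "AE t in lborel. (\<lambda>n. \<Sum>k<n. u k t) \<longlonglongrightarrow> laplace_kernel s w t"
    proof (rule AE_I2)
      fix t :: real
      have "(\<lambda>k. (- d * of_real t) ^ k /\<^sub>R fact k) sums exp (- d * of_real t)" by (rule exp_converges)
      hence "(\<lambda>k. (- d * of_real t) ^ k / fact k) sums exp (- d * of_real t)"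
        by (simp add: scaleR_conv_of_real field_simps)
      from sums_mult[OF this, of "laplace_kernel s (of_real b) t"]
      have "(\<lambda>k. u k t) sums (laplace_kernel s (of_real b) t * exp (- d * of_real t))" unfolding u_def .
      also have "laplace_kernel s (of_real b) t * exp (- d * of_real t) = laplace_kernel s w t"
        by (cases "t > 0") (auto simp: laplace_kernel_def d_def exp_add[symmetric] algebra_simps)
      finally show "(\<lambda>n. \<Sum>k<n. u k t) \<longlonglongrightarrow> laplace_kernel s w t" by (simp add: sums_def)
    qed
    show "AE t in lborel. norm (\<Sum>k<n. u k t) \<le> norm (laplace_kernel s (of_real c) t)" for n
    proof (rule AE_I2)
      fix t :: real
      show "norm (\<Sum>k<n. u k t) \<le> norm (laplace_kernel s (of_real c) t)"
      proof (cases "t > 0")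
        case True
        have "norm (\<Sum>k<n. u k t) \<le> (\<Sum>k<n. norm (u k t))" by (rule norm_sum)
        also have "\<dots> = norm (laplace_kernel s (of_real b) t) * (\<Sum>k<n. (norm d * t) ^ k / fact k)"
          using True by (simp add: u_def sum_distrib_left norm_mult norm_power norm_divide)
        also have "(\<Sum>k<n. (norm d * t) ^ k / fact k) \<le> exp (norm d * t)"
          using exp_converges[of "norm d * t"] True
          by (intro sum_le_suminf[THEN order_trans]) (auto simp: sums_iff field_simps)
        also have "norm (laplace_kernel s (of_real b) t) * exp (norm d * t) = norm (laplace_kernel s (of_real c) t)"
          using True by (simp add: laplace_kernel_pos c_def exp_add[symmetric] algebra_simps)
        finally show ?thesis by (simp add: mult_left_mono)
      next
        case False
        thus ?thesis by (simp add: u_def laplace_kernel_def)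
      qed
    qed
  qed auto
  moreover have "(LINT t|lborel. (\<Sum>k<n. u k t)) = (\<Sum>k<n. Gamma s * exp (- s * of_real (ln b)) * (((-s) gchoose k) * (d / of_real b) ^ k))" for n
  proof -
    have "(LINT t|lborel. (\<Sum>k<n. u k t)) = (\<Sum>k<n. LINT t|lborel. u k t)"
      using iu by (intro Bochner_Integration.integral_sum) auto
    also have "\<dots> = (\<Sum>k<n. Gamma s * exp (- s * of_real (ln b)) * (((-s) gchoose k) * (d / of_real b) ^ k))"
    proof (rule sum.cong[OF refl])
      fix k
      have "s \<notin> \<int>\<^sub>\<le>\<^sub>0" using s by (auto elim!: nonpos_Ints_cases)
      hence G: "Gamma (s + of_nat k) = pochhammer s k * Gamma s"
        by (simp add: pochhammer_Gamma Gamma_eq_zero_iff)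
      have E: "exp (- (s + of_nat k) * of_real (ln b)) = exp (- s * of_real (ln b)) / of_real b ^ k"
      proof -
        have "(complex_of_real b) ^ k = exp (of_nat k * of_real (ln b))"
          using b by (metis exp_of_nat_mult exp_ln exp_of_real)
        thus ?thesis by (simp add: exp_diff[symmetric] algebra_simps)
      qed
      have "(LINT t|lborel. u k t) = ((-d) ^ k / fact k) * (Gamma (s + of_nat k) * exp (- (s + of_nat k) * of_real (ln b)))"
        unfolding uk using s b by (simp only: integral_mult_right_zero) (subst laplace_kernel_integral_real, auto)
      also have "\<dots> = Gamma s * exp (- s * of_real (ln b)) * (((-s) gchoose k) * (d / of_real b) ^ k)"
        unfolding G E gbinomial_pochhammer power_minus[of d] by (simp add: field_simps power_divide)
      finally show "(LINT t|lborel. u k t) = \<dots>" .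
    qed
    finally show ?thesis .
  qed
  ultimately have "(\<lambda>k. Gamma s * exp (- s * of_real (ln b)) * (((-s) gchoose k) * (d / of_real b) ^ k)) sums (LINT t|lborel. laplace_kernel s w t)"
    by (simp add: sums_def)
  moreover have "norm (d / of_real b) < 1" using b by (simp add: d_def norm_divide)
  from sums_mult[OF gen_binomial_complex[OF this, of "-s"], of "Gamma s * exp (- s * of_real (ln b))"]
  have "(\<lambda>k. Gamma s * exp (- s * of_real (ln b)) * (((-s) gchoose k) * (d / of_real b) ^ k)) sums (Gamma s * exp (- s * of_real (ln b)) * (1 + d / of_real b) powr (- s))" .
  ultimately have "(LINT t|lborel. laplace_kernel s w t) = Gamma s * (exp (- s * of_real (ln b)) * (1 + d / of_real b) powr (- s))"
    by (simp add: sums_iff mult.assoc)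
  also have "1 + d / of_real b = w / of_real b" using b by (simp add: d_def field_simps)
  also have "exp (- s * of_real (ln b)) * (w / of_real b) powr (- s) = w powr (-s)"
  proof -
    have "w \<noteq> 0" using w by auto
    moreover have "Ln (w / of_real b) = Ln w - of_real (ln b)" using b \<open>w \<noteq> 0\<close> by (simp add: Ln_divide_of_real)
    ultimately show ?thesis using b by (simp add: powr_def exp_add[symmetric]) (simp add: algebra_simps)
  qed
  finally show ?thesis .
qed

lemma integrable_one_plus_abs_powr:
  assumes "\<sigma> > 1"
  shows "integrable lborel (\<lambda>y::real. (1 + \<bar>y\<bar>) powr (-\<sigma>))"
proof -
  let ?h = "\<lambda>y::real. indicator {0..} y * (1 + \<bar>y\<bar>) powr (-\<sigma>)"
  have "((\<lambda>y::real. - ((1 + y) powr (1 - \<sigma>)) / (\<sigma> - 1)) \<longlongrightarrow> - 0 / (\<sigma> - 1)) at_top"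
    using assms by (intro tendsto_intros tendsto_neg_powr filterlim_tendsto_add_at_top[OF tendsto_const] filterlim_ident) auto
  hence lim: "((\<lambda>y::real. - ((1 + y) powr (1 - \<sigma>)) / (\<sigma> - 1)) \<longlongrightarrow> 0) at_top" by simp
  have "(\<integral>\<^sup>+ y. ennreal ((1 + y) powr (-\<sigma>)) * indicator {0..} y \<partial>lborel) = ennreal (0 - (- ((1 + 0) powr (1 - \<sigma>)) / (\<sigma> - 1)))"
  proof (rule nn_integral_FTC_atLeast[OF _ _ _ lim])
    show "((\<lambda>y. - ((1 + y) powr (1 - \<sigma>)) / (\<sigma> - 1)) has_real_derivative (1 + y) powr (-\<sigma>)) (at y)" if "0 \<le> y" for y
    proof -
      have "((\<lambda>y. - ((1 + y) powr (1 - \<sigma>)) / (\<sigma> - 1)) has_real_derivative - ((1 - \<sigma>) * (1 + y) powr (1 - \<sigma> - 1)) / (\<sigma> - 1)) (at y)"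
        using that assms by (auto intro!: derivative_eq_intros)
      moreover have "- ((1 - \<sigma>) * (1 + y) powr (1 - \<sigma> - 1)) / (\<sigma> - 1) = (1 + y) powr (-\<sigma>)"
      proof -
        have "- ((1 - \<sigma>) * (1 + y) powr (1 - \<sigma> - 1)) = (\<sigma> - 1) * (1 + y) powr (-\<sigma>)"
          by (simp add: algebra_simps)
        thus ?thesis using assms by (simp only:) simp
      qed
      ultimately show ?thesis by (simp only:)
    qed
  qed auto
  also have "(\<lambda>y. ennreal ((1 + y) powr (-\<sigma>)) * indicator {0..} y) = (\<lambda>y. ennreal (?h y))"
    by (auto simp: indicator_def fun_eq_iff)
  finally have "integrable lborel ?h"
    by (intro integrableI_nonneg) (auto intro!: AE_I2)
  moreover from lborel_integrable_real_affine[OF this, of "-1" 0]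
  have "integrable lborel (\<lambda>y. ?h (- y))" by simp
  ultimately have "integrable lborel (\<lambda>y. ?h y + ?h (-y))" by (rule Bochner_Integration.integrable_add)
  thus ?thesis by (rule Bochner_Integration.integrable_bound) (auto simp: indicator_def intro!: AE_I2)
qed

lemma integrable_vertical_line_powr:
  assumes "\<sigma> > 1" "c > 0"
  shows "integrable lborel (\<lambda>y::real. norm (Complex c y) powr (-\<sigma>))"
proof -
  define k where "k = min (1/2) (c/2)"
  have k: "k > 0" using assms by (simp add: k_def)
  have "integrable lborel (\<lambda>y::real. k powr (-\<sigma>) * (1 + \<bar>y\<bar>) powr (-\<sigma>))"
    using assms by (intro integrable_mult_right integrable_one_plus_abs_powr)
  thus ?thesis
  proof (rule Bochner_Integration.integrable_bound)
    show "AE y in lborel. norm (norm (Complex c y) powr (-\<sigma>)) \<le> norm (k powr (-\<sigma>) * (1 + \<bar>y\<bar>) powr (-\<sigma>))"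
    proof (rule AE_I2)
      fix y :: real
      have "c \<le> norm (Complex c y)" using complex_Re_le_cmod[of "Complex c y"] by simp
      moreover have "\<bar>y\<bar> \<le> norm (Complex c y)" using abs_Im_le_cmod[of "Complex c y"] by simp
      ultimately have "c/2 * 1 + 1/2 * \<bar>y\<bar> \<le> norm (Complex c y)" by simp
      moreover have "k * 1 + k * \<bar>y\<bar> \<le> c/2 * 1 + 1/2 * \<bar>y\<bar>" by (intro add_mono mult_right_mono) (auto simp: k_def)
      ultimately have "k * (1 + \<bar>y\<bar>) \<le> norm (Complex c y)" by (simp add: algebra_simps)
      hence "norm (Complex c y) powr (-\<sigma>) \<le> (k * (1 + \<bar>y\<bar>)) powr (-\<sigma>)" using assms k
        by (intro powr_mono2') auto
      also have "\<dots> = k powr (-\<sigma>) * (1 + \<bar>y\<bar>) powr (-\<sigma>)" using k by (simp add: powr_mult)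
      finally show "norm (norm (Complex c y) powr (-\<sigma>)) \<le> norm (k powr (-\<sigma>) * (1 + \<bar>y\<bar>) powr (-\<sigma>))" by simp
    qed
  qed (auto simp: cmod_def)
qed

lemma norm_powr_right_halfplane_le:
  assumes "Re z > 0"
  shows "norm (z powr (-s)) \<le> norm z powr (- Re s) * exp (\<bar>Im s\<bar> * (pi / 2))"
proof -
  have z: "z \<noteq> 0" using assms by auto
  have "\<bar>Im (Ln z)\<bar> < pi/2" using Re_Ln_pos_lt[OF z] assms by blast
  hence "Im s * Im (Ln z) \<le> \<bar>Im s\<bar> * (pi/2)"
    using mult_left_mono[of "\<bar>Im (Ln z)\<bar>" "pi/2" "\<bar>Im s\<bar>"] abs_ge_self[of "Im s * Im (Ln z)"]
    by (simp only: abs_mult) linarith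
  moreover have "norm (z powr (-s)) = exp (- Re s * ln (norm z) + Im s * Im (Ln z))"
    using z by (simp add: powr_def)
  ultimately show ?thesis using z by (simp add: powr_def exp_add[symmetric])
qed

text \<open>
  By \<open>laplace_kernel_integral\<close>, \<open>y \<mapsto> \<Gamma>(s) (c + iy)\<^bsup>-s\<^esup>\<close> is the Fourier transform of the kernel with \<open>w = c\<close>.
  For \<open>Re s > 1\<close> the kernel is bounded and continuous and its transform is integrable, so Fourier
  inversion applies.
\<close>
theorem inverse_laplace_powr:
  assumes s: "Re s > 1" and c: "c > 0" and x: "x > 0"
  shows "integrable lborel (\<lambda>y. Complex c y powr (-s) * exp (Complex c y * of_real x))"
    and "(LINT y|lborel. Complex c y powr (-s) * exp (Complex c y * of_real x))
          = 2 * of_real pi * exp ((s - 1) * of_real (ln x)) / Gamma s"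
proof -
  have [measurable]: "(\<lambda>y. Complex c y powr (-s)) \<in> borel_measurable lborel"
    unfolding Complex_eq powr_def by measurable
  have [measurable]: "(\<lambda>y. Complex c y) \<in> borel_measurable lborel"
    unfolding Complex_eq by measurable
  have int: "integrable lborel (\<lambda>y. Complex c y powr (-s))"
  proof (rule Bochner_Integration.integrable_bound)
    show "integrable lborel (\<lambda>y. norm (Complex c y) powr (- Re s) * exp (\<bar>Im s\<bar> * (pi / 2)))"
      using s c by (intro integrable_mult_left integrable_vertical_line_powr)
    show "AE y in lborel. norm (Complex c y powr (-s)) \<le> norm (norm (Complex c y) powr (- Re s) * exp (\<bar>Im s\<bar> * (pi / 2)))"
      using norm_powr_right_halfplane_le[of "Complex c _" s] c by (intro AE_I2) auto
  qed auto
  have "integrable lborel (\<lambda>y. Complex c y powr (-s) * of_real (exp (c * x)))"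
    using int by (rule integrable_mult_left)
  thus "integrable lborel (\<lambda>y. Complex c y powr (-s) * exp (Complex c y * of_real x))"
    by (rule Bochner_Integration.integrable_bound) (auto simp: norm_mult)
  have G: "Gamma s \<noteq> 0" using s by (auto simp: Gamma_eq_zero_iff elim!: nonpos_Ints_cases)
  define \<phi> where "\<phi> = laplace_kernel s (of_real c)"
  have ft: "(LINT t|lborel. \<phi> t * exp (-(\<i> * of_real y * of_real t))) = Gamma s * Complex c y powr (-s)" for y
  proof -
    have "(\<lambda>t. \<phi> t * exp (-(\<i> * of_real y * of_real t))) = laplace_kernel s (Complex c y)"
      by (auto simp: \<phi>_def laplace_kernel_def fun_eq_iff Complex_eq exp_add[symmetric] algebra_simps)
    thus ?thesis using laplace_kernel_integral[of s "Complex c y"] s c by simp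
  qed
  have "(LINT y|lborel. (LINT t|lborel. \<phi> t * exp (-(\<i> * of_real y * of_real t))) * exp (\<i> * of_real y * of_real x))
          = 2 * of_real pi * \<phi> x"
  proof (rule fourier_inversion)
    show "integrable lborel \<phi>" unfolding \<phi>_def using s c by (intro laplace_kernel_integrable) auto
    show "integrable lborel (\<lambda>y. LINT t|lborel. \<phi> t * exp (- (\<i> * of_real y * of_real t)))"
      unfolding ft by (rule integrable_mult_right) (rule int)
    show "isCont \<phi> x"
    proof -
      have "isCont (\<lambda>t. exp ((s - 1) * of_real (ln t) - of_real c * of_real t)) x"
        using x by (intro continuous_intros) auto
      moreover have "\<forall>\<^sub>F t in nhds x. \<phi> t = exp ((s - 1) * of_real (ln t) - of_real c * of_real t)"
        using eventually_nhds_in_open[of "{0<..}" x] x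
        by (auto elim!: eventually_mono simp: \<phi>_def laplace_kernel_pos)
      ultimately show ?thesis by (subst isCont_cong)
    qed
    define a where "a = Re s - 1"
    have a: "a > 0" using s by (simp add: a_def)
    show "norm (\<phi> t) \<le> exp (a * ln (a / c))" for t
    proof (cases "t > 0")
      case True
      have "ln (c * t / a) \<le> c * t / a - 1" using True a c by (intro ln_le_minus_one) auto
      hence "a * ln (c * t / a) \<le> a * (c * t / a - 1)" using a by (intro mult_left_mono) auto
      also have "\<dots> = c * t - a" using a by (simp add: field_simps)
      also have "ln (c * t / a) = ln t - ln (a / c)" using True a c by (simp add: ln_div ln_mult)
      finally have "a * ln t - c * t \<le> a * ln (a / c)" using a by (simp add: algebra_simps)
      thus ?thesis using True by (simp add: \<phi>_def laplace_kernel_pos a_def)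
    qed (auto simp: \<phi>_def laplace_kernel_def)
  qed
  hence "Gamma s * (LINT y|lborel. Complex c y powr (-s) * exp (\<i> * of_real y * of_real x)) = 2 * of_real pi * \<phi> x"
    unfolding ft by (simp add: mult.assoc)
  hence "(LINT y|lborel. Complex c y powr (-s) * exp (\<i> * of_real y * of_real x)) = 2 * of_real pi * \<phi> x / Gamma s"
    using G by (simp add: field_simps)
  moreover have "(LINT y|lborel. Complex c y powr (-s) * exp (Complex c y * of_real x)) = 
     exp (of_real (c * x)) * (LINT y|lborel. Complex c y powr (-s) * exp (\<i> * of_real y * of_real x))"
    unfolding integral_mult_right_zero[symmetric]
    by (rule Bochner_Integration.integral_cong) (auto simp: Complex_eq exp_add algebra_simps)
  moreover have "exp (of_real (c * x)) * \<phi> x = exp ((s - 1) * of_real (ln x))"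
    using x by (simp add: \<phi>_def laplace_kernel_pos exp_add[symmetric])
  ultimately show "(LINT y|lborel. Complex c y powr (-s) * exp (Complex c y * of_real x))
          = 2 * of_real pi * exp ((s - 1) * of_real (ln x)) / Gamma s"
    by (simp add: field_simps)
qed

section \<open>Bounds for the reciprocal Gamma function\<close>

text \<open>
  In Gauss's product, \<open>|1/\<Gamma>(\<sigma> + i\<tau>)| \<Gamma>(\<sigma>)\<close> is the limit of \<open>\<Prod>\<^sub>k sqrt (1 + (\<tau>/(\<sigma> + k))\<^sup>2)\<close>, which for
  \<open>\<sigma> \<ge> 1\<close> is largest at \<open>\<sigma> = 1\<close>.  There its square is \<open>sinh (\<pi>\<tau>)/(\<pi>\<tau>) \<le> exp (\<pi>|\<tau>|)\<close>
  by the reflection formula.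
\<close>
lemma rGamma_le_rGamma_Re:
  fixes \<sigma> \<tau> :: real assumes "\<sigma> \<ge> 1"
  shows "norm (rGamma (Complex \<sigma> \<tau>)) \<le> rGamma \<sigma> * exp (pi * \<bar>\<tau>\<bar> / 2)"
proof -
  have ser: "norm (rGamma_series (Complex \<sigma> \<tau>) n) \<le> rGamma_series \<sigma> n * norm (rGamma_series (Complex 1 \<tau>) n) / rGamma_series 1 n" 
    if n: "n > 0" and s: "\<sigma> \<ge> 1" for n and \<sigma> :: real
  proof -
    have ratio: "norm (rGamma_series (Complex \<rho> \<tau>) n) = rGamma_series \<rho> n * (\<Prod>k\<in>{0..n}. sqrt (1 + (\<tau> / (\<rho> + real k))\<^sup>2))"
      if r: "\<rho> \<ge> 1" for \<rho> :: real
    proof -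
      have fac: "norm (Complex \<rho> \<tau> + of_nat k) = (\<rho> + real k) * sqrt (1 + (\<tau> / (\<rho> + real k))\<^sup>2)" for k
      proof -
        have p: "\<rho> + real k > 0" using r by auto
        have "norm (Complex \<rho> \<tau> + of_nat k) = sqrt ((\<rho> + real k)\<^sup>2 + \<tau>\<^sup>2)"
          by (simp add: cmod_def)
        also have "(\<rho> + real k)\<^sup>2 + \<tau>\<^sup>2 = (\<rho> + real k)\<^sup>2 * (1 + (\<tau> / (\<rho> + real k))\<^sup>2)"
          using p by (simp add: field_simps)
        also have "sqrt \<dots> = (\<rho> + real k) * sqrt (1 + (\<tau> / (\<rho> + real k))\<^sup>2)"
          using p by (simp add: real_sqrt_mult)
        finally show ?thesis .
      qed
      have "norm (pochhammer (Complex \<rho> \<tau>) (Suc n)) = pochhammer \<rho> (Suc n) * (\<Prod>k\<in>{0..n}. sqrt (1 + (\<tau> / (\<rho> + real k))\<^sup>2))"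
        unfolding pochhammer_Suc_prod prod_norm[symmetric] fac prod.distrib by (rule refl)
      moreover have "norm (exp (Complex \<rho> \<tau> * of_real (ln (real n)))) = exp (\<rho> * ln (real n))" by simp
      ultimately show ?thesis unfolding rGamma_series_def
        by (simp add: norm_divide norm_mult)
    qed
    have pos: "rGamma_series \<rho> n > 0" if "\<rho> \<ge> 1" for \<rho> :: real
      unfolding rGamma_series_def using that by (intro divide_pos_pos pochhammer_pos mult_pos_pos) auto
    have "(\<Prod>k\<in>{0..n}. sqrt (1 + (\<tau> / (\<sigma> + real k))\<^sup>2)) \<le> (\<Prod>k\<in>{0..n}. sqrt (1 + (\<tau> / (1 + real k))\<^sup>2))"
    proof (intro prod_mono conjI real_sqrt_ge_zero real_sqrt_le_mono add_left_mono)
      fix k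
      have "(\<tau> / (\<sigma> + real k))\<^sup>2 = \<tau>\<^sup>2 / (\<sigma> + real k)\<^sup>2" by (simp add: power_divide)
      also have "\<dots> \<le> \<tau>\<^sup>2 / (1 + real k)\<^sup>2" using s by (intro divide_left_mono power_mono mult_pos_pos) auto
      finally show "(\<tau> / (\<sigma> + real k))\<^sup>2 \<le> (\<tau> / (1 + real k))\<^sup>2" by (simp add: power_divide)
    qed auto
    hence "norm (rGamma_series (Complex \<sigma> \<tau>) n) \<le> rGamma_series \<sigma> n * (\<Prod>k\<in>{0..n}. sqrt (1 + (\<tau> / (1 + real k))\<^sup>2))"
      unfolding ratio[OF s] using pos[OF s] by (intro mult_left_mono) auto
    also have "\<dots> = rGamma_series \<sigma> n * norm (rGamma_series (Complex 1 \<tau>) n) / rGamma_series 1 n"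
      using pos[of 1] by (simp add: ratio[of 1])
    finally show ?thesis .
  qed
  have "norm (rGamma (Complex \<sigma> \<tau>)) \<le> rGamma \<sigma> * norm (rGamma (Complex 1 \<tau>)) / rGamma 1"
  proof (rule tendsto_le[OF sequentially_bot])
    show "(\<lambda>n. norm (rGamma_series (Complex \<sigma> \<tau>) n)) \<longlonglongrightarrow> norm (rGamma (Complex \<sigma> \<tau>))"
      by (intro tendsto_intros)
    show "(\<lambda>n. rGamma_series \<sigma> n * norm (rGamma_series (Complex 1 \<tau>) n) / rGamma_series 1 n) \<longlonglongrightarrow> rGamma \<sigma> * norm (rGamma (Complex 1 \<tau>)) / rGamma 1"
      by (intro tendsto_intros) auto
    show "\<forall>\<^sub>F n in sequentially. norm (rGamma_series (Complex \<sigma> \<tau>) n) \<le> rGamma_series \<sigma> n * norm (rGamma_series (Complex 1 \<tau>) n) / rGamma_series 1 n"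
      using eventually_gt_at_top[of 0] by eventually_elim (use ser assms in auto)
  qed
  also have "\<dots> = rGamma \<sigma> * norm (rGamma (Complex 1 \<tau>))" by simp
  also have "norm (rGamma (Complex 1 \<tau>)) \<le> exp (pi * \<bar>\<tau>\<bar> / 2)"
  proof (cases "\<tau> = 0")
    case True
    have "Complex 1 0 = 1" by (simp add: complex_eq_iff)
    thus ?thesis using True by simp
  next
    case False
    define z where "z = \<i> * of_real \<tau>"
    have z0: "z \<noteq> 0" using False by (simp add: z_def)
    have z1: "Complex 1 \<tau> = z + 1" by (simp add: z_def complex_eq_iff)
    have z2: "cnj (z + 1) = - z + 1" by (simp add: z_def)
    have nz: "norm (rGamma (-z+1)) = norm (rGamma (z+1))"
      unfolding z2[symmetric] rGamma_complex_def[symmetric] by (metis cnj_rGamma complex_mod_cnj)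
    have "(z * rGamma (z+1)) * (-z * rGamma (-z+1)) = - z * sin (of_real pi * z) / of_real pi"
      unfolding rGamma_plus1 by (rule rGamma_reflection_complex')
    hence "rGamma (z+1) * rGamma (-z+1) = sin (of_real pi * z) / (of_real pi * z)"
      using z0 by (simp add: field_simps)
    hence "norm (rGamma (z+1)) * norm (rGamma (-z+1)) = norm (sin (of_real pi * z)) / (pi * \<bar>\<tau>\<bar>)"
      by (metis (no_types, lifting) norm_mult norm_divide z_def norm_ii mult_1 norm_of_real abs_of_pos pi_gt_zero)
    hence sq: "(norm (rGamma (z+1)))\<^sup>2 = norm (sin (of_real pi * z)) / (pi * \<bar>\<tau>\<bar>)"
      unfolding nz by (simp add: power2_eq_square)
    define X where "X = pi * \<bar>\<tau>\<bar>"
    have X: "X > 0" using False by (simp add: X_def)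
    have "norm (sin (of_real pi * z)) = \<bar>exp X - exp (-X)\<bar> / 2"
    proof -
      have "sin (of_real pi * z) = - (exp (of_real (-pi * \<tau>)) - exp (of_real (pi * \<tau>))) * \<i> / 2"
        by (simp add: sin_exp_eq z_def field_simps)
      hence "norm (sin (of_real pi * z)) = norm (exp (of_real (-pi * \<tau>)) - exp (of_real (pi * \<tau>)) :: complex) / 2"
        by (simp only: norm_mult norm_divide norm_minus_cancel norm_ii) simp
      also have "exp (of_real (-pi * \<tau>)) - exp (of_real (pi * \<tau>)) = complex_of_real (exp (-pi * \<tau>) - exp (pi * \<tau>))"
        by (simp only: exp_of_real of_real_diff)
      also have "norm \<dots> = \<bar>exp (-pi * \<tau>) - exp (pi * \<tau>)\<bar>" by (rule norm_of_real)
      also have "\<dots> = \<bar>exp X - exp (-X)\<bar>" by (cases "\<tau> > 0") (auto simp: X_def)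
      finally show ?thesis .
    qed
    also have "\<dots> \<le> X * exp X"
    proof -
      have "1 + (-2*X) \<le> exp (-2*X)" by (rule exp_ge_add_one_self)
      hence "1 - exp (-2*X) \<le> 2 * X" by simp
      hence "exp X * (1 - exp (-2*X)) \<le> exp X * (2 * X)" by (intro mult_left_mono) auto
      hence "exp X - exp (-X) \<le> 2 * X * exp X" by (simp add: algebra_simps exp_add[symmetric])
      moreover have "exp X \<ge> exp (-X)" using X by simp
      ultimately show ?thesis by (simp add: abs_if mult_ac)
    qed
    finally have "(norm (rGamma (z+1)))\<^sup>2 \<le> exp X" unfolding sq X_def[symmetric] using X by (simp add: field_simps)
    also have "exp X = (exp (X/2))\<^sup>2" by (simp add: exp_double[symmetric])
    finally have "norm (rGamma (z+1)) \<le> exp (X/2)" by (rule power2_le_imp_le) auto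
    thus ?thesis by (simp add: z1 X_def)
  qed
  finally show ?thesis using assms by (simp add: mult_left_mono Gamma_real_pos rGamma_inverse_Gamma less_imp_le)
qed

text \<open>
  Euler's integral is at least its part over \<open>[\<sigma>, 2\<sigma>]\<close>, where the integrand is at least \<open>\<sigma>\<^bsup>\<sigma>-1\<^esup> e\<^bsup>-2\<sigma>\<^esup>\<close>.
\<close>
lemma rGamma_real_le:
  fixes \<sigma> :: real assumes s: "\<sigma> \<ge> 1"
  shows "rGamma \<sigma> \<le> exp (2 * \<sigma> - \<sigma> * ln \<sigma>)"
proof -
  have s0: "\<sigma> > 0" using s by simp
  have c: "((\<lambda>t. \<sigma> powr (\<sigma> - 1) * exp (- (2*\<sigma>))) has_integral (\<sigma> *\<^sub>R (\<sigma> powr (\<sigma> - 1) * exp (- (2*\<sigma>))))) {\<sigma>..2*\<sigma>}"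
    using has_integral_const_real[of "\<sigma> powr (\<sigma> - 1) * exp (- (2*\<sigma>))" \<sigma> "2*\<sigma>"] s0 by simp
  have "\<sigma> *\<^sub>R (\<sigma> powr (\<sigma> - 1) * exp (- (2*\<sigma>))) \<le> Gamma \<sigma>"
  proof (rule has_integral_le)
    show "((\<lambda>t. if t \<in> {\<sigma>..2*\<sigma>} then \<sigma> powr (\<sigma> - 1) * exp (- (2*\<sigma>)) else 0) has_integral (\<sigma> *\<^sub>R (\<sigma> powr (\<sigma> - 1) * exp (- (2*\<sigma>))))) {0..}"
      using c s0 by (subst has_integral_restrict) auto
    show "((\<lambda>t. t powr (\<sigma> - 1) / exp t) has_integral Gamma \<sigma>) {0..}" using s0 by (rule Gamma_integral_real)
    show "(if t \<in> {\<sigma>..2*\<sigma>} then \<sigma> powr (\<sigma> - 1) * exp (- (2*\<sigma>)) else 0) \<le> t powr (\<sigma> - 1) / exp t" if "t \<in> {0..}" for t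
    proof (cases "t \<in> {\<sigma>..2*\<sigma>}")
      case True
      have "\<sigma> powr (\<sigma> - 1) * exp (- (2*\<sigma>)) \<le> t powr (\<sigma> - 1) * exp (-t)"
        using True s by (intro mult_mono powr_mono2) auto
      thus ?thesis using True by (simp add: exp_minus field_simps)
    qed auto
  qed
  moreover have "\<sigma> *\<^sub>R (\<sigma> powr (\<sigma> - 1) * exp (- (2*\<sigma>))) = exp (\<sigma> * ln \<sigma> - 2 * \<sigma>)"
    using s0 by (simp add: powr_def exp_diff left_diff_distrib exp_minus field_simps)
  ultimately have "exp (\<sigma> * ln \<sigma> - 2 * \<sigma>) \<le> Gamma \<sigma>" by simp
  hence "inverse (Gamma \<sigma>) \<le> inverse (exp (\<sigma> * ln \<sigma> - 2 * \<sigma>))" by (intro le_imp_inverse_le) auto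
  thus ?thesis by (simp add: rGamma_inverse_Gamma exp_minus[symmetric])
qed

section \<open>Fourier series of periodic functions on a strip\<close>

text \<open>
  With a primitive \<open>g\<close> of \<open>f\<close> the integral over the unit segment starting at \<open>w\<close> is \<open>g(w + 1) - g(w)\<close>, whose
  derivative \<open>f(w + 1) - f(w)\<close> vanishes.  Two sets \<open>S\<close> and \<open>T\<close> are kept apart so that the lemma also covers
  a function that is holomorphic only on a rectangle little wider than one period.
\<close>
lemma periodic_segment_integral_indep:
  assumes S: "open S" "convex S" and f: "f holomorphic_on S"
    and T: "open T" "convex T" "T \<subseteq> S" "\<And>w. w \<in> T \<Longrightarrow> w + 1 \<in> S" "\<And>w. w \<in> T \<Longrightarrow> f (w + 1) = f w"
    and w: "w1 \<in> T" "w2 \<in> T"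
  shows "integral {0..1} (\<lambda>x. f (w1 + of_real x)) = integral {0..1} (\<lambda>x. f (w2 + of_real x))"
proof -
  have "\<exists>G. \<forall>z\<in>S. (G has_field_derivative f z) (at z within S)"
  proof (rule holomorphic_convex_primitive[where K = "{}"])
    show "f field_differentiable at x" if "x \<in> interior S - {}" for x
      using that S(1) f holomorphic_on_imp_differentiable_at interior_open by fastforce
  qed (use S f in \<open>auto intro: holomorphic_on_imp_continuous_on\<close>)
  then obtain G where G': "\<And>z. z \<in> S \<Longrightarrow> (G has_field_derivative f z) (at z within S)" by blast
  have G: "(G has_field_derivative f z) (at z)" if "z \<in> S" for z
    using G'[OF that] at_within_open[OF that S(1)] by simp
  have seg: "((\<lambda>x. f (w + of_real x)) has_integral (G (w + 1) - G w)) {0..1}" if "w \<in> T" for w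
  proof -
    have "((\<lambda>x. f (w + of_real x)) has_integral ((G \<circ> (\<lambda>x. w + of_real x)) 1 - (G \<circ> (\<lambda>x. w + of_real x)) 0)) {0..1}"
    proof (rule fundamental_theorem_of_calculus)
      fix x :: real assume x: "x \<in> {0..1}"
      have "(1 - x) *\<^sub>R w + x *\<^sub>R (w + 1) \<in> S"
        using x that T S(2) by (intro convexD) auto
      hence "w + of_real x \<in> S" by (simp add: scaleR_conv_of_real algebra_simps)
      from G[OF this] have "(G has_field_derivative f (w + of_real x)) (at (w + of_real x))" .
      moreover have "((\<lambda>x. w + of_real x) has_vector_derivative 1) (at x within {0..1})"
        by (auto intro!: derivative_eq_intros)
      ultimately have "(G \<circ> (\<lambda>x. w + of_real x) has_vector_derivative (1 * f (w + of_real x))) (at x within {0..1})"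
        by (intro field_vector_diff_chain_within) (auto intro: has_field_derivative_at_within)
      thus "(G \<circ> (\<lambda>x. w + of_real x) has_vector_derivative f (w + of_real x)) (at x within {0..1})" by simp
    qed auto
    thus ?thesis by simp
  qed
  have "\<exists>c. \<forall>w\<in>T. G (w + 1) - G w = c"
  proof (rule has_field_derivative_zero_constant[OF T(2)])
    fix w assume w: "w \<in> T"
    have "((\<lambda>w. G (w + 1) - G w) has_field_derivative f (w + 1) * (1 + 0) - f w) (at w)"
    proof (rule DERIV_diff)
      show "((\<lambda>w. G (w + 1)) has_field_derivative f (w + 1) * (1 + 0)) (at w)"
        by (rule DERIV_chain2[where f = G and g = "\<lambda>w. w + 1"]) (use G[OF T(4)[OF w]] in \<open>auto intro!: derivative_eq_intros\<close>)
      show "(G has_field_derivative f w) (at w)" using w T by (intro G) auto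
    qed
    thus "((\<lambda>w. G (w + 1) - G w) has_field_derivative 0) (at w within T)"
      using T(5)[OF w] by (auto intro: has_field_derivative_at_within)
  qed
  then obtain c where "\<And>w. w \<in> T \<Longrightarrow> G (w + 1) - G w = c" by blast
  thus ?thesis using integral_unique[OF seg[OF w(1)]] integral_unique[OF seg[OF w(2)]] w by simp
qed

definition fourier_coeff :: "(complex \<Rightarrow> complex) \<Rightarrow> int \<Rightarrow> complex" where
  "fourier_coeff F m = integral {0..1} (\<lambda>x. F (of_real x) * exp (- (2 * of_real pi * \<i> * of_int m * of_real x)))"

lemma exp_2pi_i_int_add: "exp (c * (2 * of_real pi * \<i> * of_int m * (w + 1))) = exp (c * (2 * of_real pi * \<i> * of_int m * w))" if "c = 1 \<or> c = -1"
  for c w :: complex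
proof -
  have *: "exp (2 * of_real pi * \<i> * of_int n) = (1::complex)" for n :: int
    using exp_integer_2pi[of "of_int n"] by (simp add: mult_ac)
  have "exp (c * (2 * of_real pi * \<i> * of_int m * (w + 1))) = exp (c * (2 * of_real pi * \<i> * of_int m * w)) * exp (c * (2 * of_real pi * \<i> * of_int m))"
    by (simp add: exp_add[symmetric] algebra_simps)
  also have "exp (c * (2 * of_real pi * \<i> * of_int m)) = 1"
    using that *[of m] *[of "-m"] by auto
  finally show ?thesis by simp
qed

lemma has_sum_int_halves:
  fixes f :: "int \<Rightarrow> 'a :: {topological_comm_monoid_add}"
  assumes "((\<lambda>k::nat. f (int k)) has_sum a) UNIV" "((\<lambda>k::nat. f (- int (Suc k))) has_sum b) UNIV"
  shows "(f has_sum (a + b)) UNIV"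
proof -
  have "(f has_sum a) (range int)" using assms(1) by (subst has_sum_reindex) (auto simp: o_def)
  moreover have "(f has_sum b) (range (\<lambda>k. - int (Suc k)))"
    using assms(2) by (subst has_sum_reindex) (auto simp: o_def inj_def)
  ultimately have "(f has_sum (a + b)) (range int \<union> range (\<lambda>k. - int (Suc k)))"
    by (rule has_sum_Un_disjoint) auto
  also have "range int \<union> range (\<lambda>k. - int (Suc k)) = UNIV"
  proof -
    have "m \<in> range int \<union> range (\<lambda>k. - int (Suc k))" for m :: int
      by (cases m) auto
    thus ?thesis by blast
  qed
  finally show ?thesis .
qed

lemma summable_on_int_geometric:
  fixes r :: real assumes "0 \<le> r" "r < 1"
  shows "(\<lambda>m::int. r ^ nat \<bar>m\<bar>) summable_on UNIV"
proof -
  have s: "(\<lambda>k. r ^ k) sums (1 / (1 - r))" using assms by (intro geometric_sums) auto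
  have "((\<lambda>k. r ^ nat \<bar>int k\<bar>) has_sum (1 / (1 - r))) UNIV"
    using s assms by (intro norm_summable_imp_has_sum) (auto simp: sums_iff)
  moreover have "((\<lambda>k. r ^ nat \<bar>- int (Suc k)\<bar>) has_sum (r * (1 / (1 - r)))) UNIV"
  proof -
    have n: "nat \<bar>- int (Suc k)\<bar> = Suc k" for k by simp
    have "(\<lambda>k. r ^ Suc k) sums (r * (1 / (1 - r)))" using sums_mult[OF s, of r] by simp
    thus ?thesis unfolding n using assms by (intro norm_summable_imp_has_sum) (auto simp: sums_iff abs_mult)
  qed
  ultimately show ?thesis 
    unfolding summable_on_def by (blast intro: has_sum_int_halves)
qed

locale periodic_strip =
  fixes F :: "complex \<Rightarrow> complex" and h :: real
  assumes h: "h > 0" and hol: "F holomorphic_on {w. \<bar>Im w\<bar> < h}"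
    and per: "\<And>w. \<bar>Im w\<bar> < h \<Longrightarrow> F (w + 1) = F w"
begin

abbreviation "Strip \<equiv> {w. \<bar>Im w\<bar> < h}"

lemma open_convex_strip: "open Strip" "convex Strip"
proof -
  have *: "Strip = {w. Im w < h} \<inter> {w. Im w > -h}" by auto
  show "open Strip" unfolding * by (intro open_Int open_halfspace_Im_lt open_halfspace_Im_gt)
  show "convex Strip" unfolding * by (intro convex_Int convex_halfspace_Im_lt convex_halfspace_Im_gt)
qed

lemma coeff_eq_shifted_line: 
  assumes "\<bar>Im w\<bar> < h"
  shows "integral {0..1} (\<lambda>x. F (w + of_real x) * exp (- (2 * of_real pi * \<i> * of_int m * (w + of_real x)))) = fourier_coeff F m"
proof -
  define f where "f = (\<lambda>w. F w * exp (- (2 * of_real pi * \<i> * of_int m * w)))"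
  have "integral {0..1} (\<lambda>x. f (w + of_real x)) = integral {0..1} (\<lambda>x. f (0 + of_real x))"
  proof (rule periodic_segment_integral_indep[OF open_convex_strip _ open_convex_strip])
    show "f holomorphic_on Strip" unfolding f_def by (intro holomorphic_intros hol)
    show "f (w + 1) = f w" if "w \<in> Strip" for w
      using per[of w] that exp_2pi_i_int_add[of "-1" m w] by (simp add: f_def)
  qed (use assms h in auto)
  thus ?thesis by (simp add: f_def fourier_coeff_def)
qed

text \<open>
  Shift the segment of integration to \<open>Im w = \<plusminus>h'\<close>, on the side where the exponential has modulus
  \<open>exp (-2\<pi>h'|m|)\<close>.
\<close>
lemma coeff_bound:
  assumes h': "0 \<le> h'" "h' < h" and M: "\<And>w. \<bar>Im w\<bar> \<le> h' \<Longrightarrow> norm (F w) \<le> M"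
  shows "norm (fourier_coeff F m) \<le> M * exp (- (2 * pi * h' * \<bar>real_of_int m\<bar>))"
proof -
  define w where "w = Complex 0 (- h' * sgn (real_of_int m))"
  have iw: "Im w = - h' * sgn (real_of_int m)" by (simp add: w_def)
  have iw1: "\<bar>Im w\<bar> \<le> h'" using h' by (simp add: iw abs_mult sgn_real_def)
  have iw2: "\<bar>Im w\<bar> < h" using iw1 h' by simp
  have wx: "w + of_real x \<in> Strip" for x :: real using iw2 by simp
  have "fourier_coeff F m = integral {0..1} (\<lambda>x. F (w + of_real x) * exp (- (2 * of_real pi * \<i> * of_int m * (w + of_real x))))"
    by (rule coeff_eq_shifted_line[OF iw2, symmetric])
  also have "norm \<dots> \<le> M * exp (- (2 * pi * h' * \<bar>real_of_int m\<bar>)) * (1 - 0)"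
  proof (rule integral_bound)
    have "continuous_on {0..1} (\<lambda>x. F (w + of_real x))"
      by (rule continuous_on_compose2[OF holomorphic_on_imp_continuous_on[OF hol]])
         (use wx in \<open>auto intro!: continuous_intros\<close>)
    thus "continuous_on {0..1} (\<lambda>x. F (w + of_real x) * exp (- (2 * of_real pi * \<i> * of_int m * (w + of_real x))))"
      by (intro continuous_intros)
    show "norm (F (w + of_real t) * exp (- (2 * of_real pi * \<i> * of_int m * (w + of_real t)))) \<le> M * exp (- (2 * pi * h' * \<bar>real_of_int m\<bar>))" for t
    proof -
      have "norm (exp (- (2 * of_real pi * \<i> * of_int m * (w + of_real t)))) = exp (2 * pi * real_of_int m * Im w)"
        by simp
      also have "2 * pi * real_of_int m * Im w = - (2 * pi * h' * \<bar>real_of_int m\<bar>)"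
        unfolding iw by (simp add: abs_sgn mult_ac)
      finally show ?thesis unfolding norm_mult
        using M[of "w + of_real t"] iw1 by (intro mult_mono) (auto intro: order_trans[OF norm_ge_zero])
    qed
  qed auto
  finally show ?thesis by simp
qed

lemma bounded_substrip:
  assumes h': "h' < h"
  shows "\<exists>M>0. \<forall>w. \<bar>Im w\<bar> \<le> h' \<longrightarrow> norm (F w) \<le> M"
proof -
  have pn: "F (w + of_nat n) = F w" if "\<bar>Im w\<bar> < h" for w n
  proof (induction n)
    case (Suc n)
    have "F (w + of_nat (Suc n)) = F ((w + of_nat n) + 1)" by (simp add: add_ac)
    also have "\<dots> = F (w + of_nat n)" using that by (intro per) auto
    finally show ?case using Suc.IH by simp
  qed auto
  have pi: "F (w + of_int n) = F w" if "\<bar>Im w\<bar> < h" for w n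
  proof (cases "n \<ge> 0")
    case True
    thus ?thesis using pn[OF that, of "nat n"] by simp
  next
    case False
    thus ?thesis using pn[of "w + of_int n" "nat (-n)"] that by simp
  qed
  define K where "K = cbox (Complex 0 (-h')) (Complex 1 h')"
  have K: "K \<subseteq> Strip" using h' by (auto simp: K_def in_cbox_complex_iff)
  have "compact (F ` K)" unfolding K_def
    using K by (intro compact_continuous_image holomorphic_on_imp_continuous_on[OF holomorphic_on_subset[OF hol]] compact_cbox) (auto simp: K_def)
  then obtain M where M: "M > 0" "\<And>w. w \<in> K \<Longrightarrow> norm (F w) \<le> M"
    using compact_imp_bounded bounded_pos by (metis imageI)
  have "norm (F w) \<le> M" if "\<bar>Im w\<bar> \<le> h'" for w
  proof -
    have "w - of_int \<lfloor>Re w\<rfloor> \<in> K" using that by (auto simp: K_def in_cbox_complex_iff) linarith+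
    from M(2)[OF this] show ?thesis using pi[of w "- \<lfloor>Re w\<rfloor>"] that h' by simp
  qed
  thus ?thesis using M by blast
qed

lemma coeff_terms_summable:
  assumes z: "\<bar>Im z\<bar> < h"
  shows "(\<lambda>m. norm (fourier_coeff F m * exp (2 * of_real pi * \<i> * of_int m * z))) summable_on UNIV"
proof -
  obtain h' where h': "\<bar>Im z\<bar> < h'" "h' < h" using dense z by blast
  obtain M where M: "M > 0" "\<And>w. \<bar>Im w\<bar> \<le> h' \<Longrightarrow> norm (F w) \<le> M" using bounded_substrip[OF h'(2)] by blast
  define r where "r = exp (- (2 * pi * (h' - \<bar>Im z\<bar>)))"
  have "(\<lambda>m. M * r ^ nat \<bar>m\<bar>) summable_on (UNIV :: int set)"
    using h' by (intro summable_on_cmult_right summable_on_int_geometric) (auto simp: r_def)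
  thus ?thesis
  proof (rule summable_on_comparison_test)
    fix m :: int
    have "norm (fourier_coeff F m) \<le> M * exp (- (2 * pi * h' * \<bar>real_of_int m\<bar>))"
      using h' M by (intro coeff_bound) auto
    moreover have "norm (exp (2 * of_real pi * \<i> * of_int m * z)) \<le> exp (2 * pi * \<bar>real_of_int m\<bar> * \<bar>Im z\<bar>)"
    proof -
      have "- (real_of_int m * Im z) \<le> \<bar>real_of_int m\<bar> * \<bar>Im z\<bar>" by (metis abs_ge_minus_self abs_mult)
      from mult_left_mono[OF this, of "2 * pi"] show ?thesis by (simp add: mult_ac)
    qed
    ultimately have "norm (fourier_coeff F m * exp (2 * of_real pi * \<i> * of_int m * z)) \<le> 
        (M * exp (- (2 * pi * h' * \<bar>real_of_int m\<bar>))) * exp (2 * pi * \<bar>real_of_int m\<bar> * \<bar>Im z\<bar>)"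
      unfolding norm_mult using M by (intro mult_mono) auto
    also have "\<dots> = M * exp (real (nat \<bar>m\<bar>) * (- (2 * pi * (h' - \<bar>Im z\<bar>))))"
      by (simp add: exp_add[symmetric] algebra_simps)
    also have "\<dots> = M * r ^ nat \<bar>m\<bar>" by (simp only: r_def exp_of_nat_mult)
    finally show "norm (fourier_coeff F m * exp (2 * of_real pi * \<i> * of_int m * z)) \<le> M * r ^ nat \<bar>m\<bar>" .
  qed auto
qed

lemma integral_const_mode: "integral {0..1} (\<lambda>x. c * exp (2 * of_real pi * \<i> * of_int m * (z - (w + of_real x)))) = (if m = 0 then c else 0)"
proof (cases "m = 0")
  case False
  define a where "a = - 2 * of_real pi * \<i> * of_int m"
  have a: "a \<noteq> 0" using False by (simp add: a_def)
  have ea: "exp a = 1" using exp_2pi_i_int_add[of "-1" m 0] by (simp add: a_def)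
  define G where "G = (\<lambda>w. c * exp (a * (w - z)) / a)"
  have "((\<lambda>x. c * exp (a * (w + of_real x - z))) has_integral ((G \<circ> (\<lambda>x. w + of_real x)) 1 - (G \<circ> (\<lambda>x. w + of_real x)) 0)) {0..1::real}"
  proof (rule fundamental_theorem_of_calculus)
    fix x :: real assume x: "x \<in> {0..1}"
    have "(G has_field_derivative c * exp (a * (w + of_real x - z))) (at (w + of_real x))"
      unfolding G_def using a by (auto intro!: derivative_eq_intros)
    moreover have "((\<lambda>x. w + of_real x) has_vector_derivative 1) (at x within {0..1})"
      by (auto intro!: derivative_eq_intros)
    ultimately have "(G \<circ> (\<lambda>x. w + of_real x) has_vector_derivative (1 * (c * exp (a * (w + of_real x - z))))) (at x within {0..1})"
      by (intro field_vector_diff_chain_within) (auto intro: has_field_derivative_at_within)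
    thus "(G \<circ> (\<lambda>x. w + of_real x) has_vector_derivative (c * exp (a * (w + of_real x - z)))) (at x within {0..1})" by simp
  qed auto
  note hi = this
  have "exp (a * (w + 1 - z)) = exp (a * (w - z)) * exp a" by (simp add: exp_add[symmetric] algebra_simps)
  hence eq: "(G \<circ> (\<lambda>x. w + of_real x)) 1 = (G \<circ> (\<lambda>x. w + of_real x)) (0::real)"
    by (simp add: G_def ea)
  have "integral {0..1} (\<lambda>x::real. c * exp (a * (w + of_real x - z))) = 0"
    using hi unfolding eq diff_self by (rule integral_unique)
  also have "(\<lambda>x::real. c * exp (a * (w + of_real x - z))) = (\<lambda>x. c * exp (2 * of_real pi * \<i> * of_int m * (z - (w + of_real x))))"
    by (simp add: a_def algebra_simps)
  finally show ?thesis using False by simp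
qed simp

text \<open>
  Put \<open>q(w) = exp (2\<pi>i(z - w))\<close>.  The function \<open>H(w) = (F(w) - F(z))/(1 - q(w))\<close> is one-periodic and has a removable
  singularity at \<open>z\<close>, so its integrals over a period below and above \<open>z\<close> agree.  Below \<open>z\<close> one has
  \<open>|q| < 1\<close>, and the geometric series turns the integral into the Fourier terms with \<open>m \<ge> 0\<close>, minus \<open>F(z)\<close>;
  above \<open>z\<close> one has \<open>|q| > 1\<close>, and the expansion in \<open>1/q\<close> gives minus the terms with \<open>m < 0\<close>.
\<close>
theorem fourier_series:
  assumes z: "\<bar>Im z\<bar> < h"
  shows "((\<lambda>m. fourier_coeff F m * exp (2 * of_real pi * \<i> * of_int m * z)) has_sum F z) UNIV"
proof -
  define e where "e = (\<lambda>m::int. fourier_coeff F m * exp (2 * of_real pi * \<i> * of_int m * z))"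
  define y1 y2 where "y1 = (Im z - h) / 2" and "y2 = (Im z + h) / 2"
  have y: "\<bar>y1\<bar> < h" "\<bar>y2\<bar> < h" "y1 < Im z" "Im z < y2" using z by (auto simp: y1_def y2_def)
  define w1 w2 where "w1 = Complex (Re z - 1/2) y1" and "w2 = Complex (Re z - 1/2) y2"
  define S where "S = Strip \<inter> {w. Re w < Re z + 3/4} \<inter> {w. Re w > Re z - 3/4}"
  define T where "T = Strip \<inter> {w. Re w < Re z - 1/4} \<inter> {w. Re w > Re z - 3/4}"
  have S: "open S" "convex S" and T: "open T" "convex T" "T \<subseteq> S" unfolding S_def T_def
    by (auto intro!: open_Int open_convex_strip convex_Int open_halfspace_Re_lt open_halfspace_Re_gt convex_halfspace_Re_lt convex_halfspace_Re_gt)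
  have zS: "z \<in> S" using z by (simp add: S_def)
  define q where "q = (\<lambda>w. exp (2 * of_real pi * \<i> * (z - w)))"
  have q1: "q w = 1 \<longleftrightarrow> w = z" if "w \<in> S" for w
  proof
    assume "q w = 1"
    then obtain n :: int where "2 * of_real pi * \<i> * (z - w) = of_int (2 * n) * of_real pi * \<i>"
      unfolding q_def exp_eq_1 by (auto simp: complex_eq_iff algebra_simps)
    hence "z - w = of_int n" by simp
    hence "Re z - Re w = of_int n" "Im z = Im w" by (auto simp: complex_eq_iff)
    moreover have "\<bar>Re z - Re w\<bar> < 1" using that by (auto simp: S_def)
    ultimately have "n = 0" by linarith
    thus "w = z" using \<open>z - w = of_int n\<close> by simp
  qed (simp add: q_def)
  define A where "A = (\<lambda>w. if w = z then deriv F z else (F w - F z) / (w - z))"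
  define B where "B = (\<lambda>w. if w = z then deriv q z else (q w - q z) / (w - z))"
  have "F holomorphic_on S" using hol by (rule holomorphic_on_subset) (auto simp: S_def)
  hence A: "A holomorphic_on S" unfolding A_def using S zS by (intro pole_lemma_open)
  have "q holomorphic_on S" unfolding q_def by (intro holomorphic_intros)
  hence B: "B holomorphic_on S" unfolding B_def using S zS by (intro pole_lemma_open)
  have dq: "deriv q z = - (2 * of_real pi * \<i>)"
    unfolding q_def by (rule DERIV_imp_deriv) (auto intro!: derivative_eq_intros)
  have B0: "B w \<noteq> 0" if "w \<in> S" for w
  proof (cases "w = z")
    case True
    thus ?thesis by (simp add: B_def dq)
  next
    case False
    moreover have "q z = 1" by (simp add: q_def)
    ultimately show ?thesis using q1[OF that] by (simp add: B_def)
  qed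
  define H where "H = (\<lambda>w. - A w / B w)"
  have H: "H holomorphic_on S" unfolding H_def using B0 by (intro holomorphic_intros A B) auto
  have Heq: "H w = (F w - F z) / (1 - q w)" if "w \<in> S" "w \<noteq> z" for w
  proof -
    have "q w \<noteq> 1" using q1 that by blast
    moreover have "q z = 1" by (simp add: q_def)
    moreover have "- (X / d) / ((Q - 1) / d) = X / (1 - Q)" if "d \<noteq> 0" "Q \<noteq> 1" for X d Q :: complex
    proof -
      have "- (X / d) / ((Q - 1) / d) = - (X / (Q - 1))" using that by simp
      also have "\<dots> = X / (1 - Q)" by (metis minus_diff_eq minus_divide_right)
      finally show ?thesis .
    qed
    from this[of "w - z" "q w" "F w - F z"] have "H w = (F w - F z) / (1 - q w)" if "q w \<noteq> 1" "q z = 1"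
      using that \<open>w \<noteq> z\<close> unfolding H_def A_def B_def by simp
    ultimately show ?thesis by simp
  qed
  have qper: "q (w + 1) = q w" for w
    using exp_2pi_i_int_add[of "-1" 1 "w - z"] by (simp add: q_def algebra_simps)
  have Heq2: "integral {0..1} (\<lambda>x. H (w1 + of_real x)) = integral {0..1} (\<lambda>x. H (w2 + of_real x))"
  proof (rule periodic_segment_integral_indep[OF S H T])
    show "w1 \<in> T" "w2 \<in> T" using y by (auto simp: w1_def w2_def T_def)
    show "w + 1 \<in> S" if "w \<in> T" for w using that by (auto simp: S_def T_def)
    show "H (w + 1) = H w" if "w \<in> T" for w
    proof -
      have "w + 1 \<in> S" "w + 1 \<noteq> z" "w \<in> S" "w \<noteq> z" "\<bar>Im w\<bar> < h" using that by (auto simp: S_def T_def)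
      thus ?thesis using Heq per qper by simp
    qed
  qed
  have line: "w \<in> S" "w \<noteq> z" if "w = Complex (Re z - 1/2) y + of_real x" "x \<in> {0..1}" "\<bar>y\<bar> < h" "y \<noteq> Im z" for w x y
    using that by (auto simp: S_def complex_eq_iff)
  have contH: "continuous_on {0..1} (\<lambda>x. H (Complex (Re z - 1/2) y + of_real x))" if "\<bar>y\<bar> < h" "y \<noteq> Im z" for y
    by (rule continuous_on_compose2[OF holomorphic_on_imp_continuous_on[OF H]])
       (use line that in \<open>auto intro!: continuous_intros\<close>)
  have contF: "continuous_on {0..1} (\<lambda>x. F (Complex (Re z - 1/2) y + of_real x))" if "\<bar>y\<bar> < h" for y
    by (rule continuous_on_compose2[OF holomorphic_on_imp_continuous_on[OF hol]])
       (use that in \<open>auto intro!: continuous_intros\<close>)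
  have lterm: "integral {0..1} (\<lambda>x. (F (Complex (Re z - 1/2) y + of_real x) - F z) * exp (2 * of_real pi * \<i> * of_int m * (z - (Complex (Re z - 1/2) y + of_real x))))
      = e m - (if m = 0 then F z else 0)" (is "integral _ (\<lambda>x. (F (?w x) - _) * ?E x) = _") if "\<bar>y\<bar> < h" for y m
  proof -
    have "integral {0..1} (\<lambda>x. (F (?w x) - F z) * ?E x) = integral {0..1} (\<lambda>x. F (?w x) * ?E x - F z * ?E x)"
      by (simp add: algebra_simps)
    also have "\<dots> = integral {0..1} (\<lambda>x. F (?w x) * ?E x) - integral {0..1} (\<lambda>x. F z * ?E x)"
      using contF[OF that] by (intro integral_diff integrable_continuous_real continuous_intros) auto
    also have "integral {0..1} (\<lambda>x. F z * ?E x) = (if m = 0 then F z else 0)" by (rule integral_const_mode)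
    also have "integral {0..1} (\<lambda>x. F (?w x) * ?E x) = integral {0..1} (\<lambda>x. exp (2 * of_real pi * \<i> * of_int m * z) * (F (?w x) * exp (- (2 * of_real pi * \<i> * of_int m * ?w x))))"
      by (rule integral_cong) (simp add: exp_add[symmetric] algebra_simps)
    also have "\<dots> = exp (2 * of_real pi * \<i> * of_int m * z) * fourier_coeff F m"
      using coeff_eq_shifted_line[of "Complex (Re z - 1/2) y" m] that by simp
    finally show ?thesis by (simp add: e_def mult_ac)
  qed
  have geo: "(\<lambda>N. integral {0..1} (\<lambda>x. H (Complex (Re z - 1/2) y + of_real x) * p (Complex (Re z - 1/2) y + of_real x) ^ N)) \<longlonglongrightarrow> 0"
    if y: "\<bar>y\<bar> < h" "y \<noteq> Im z" and p: "\<And>x. norm (p (Complex (Re z - 1/2) y + of_real x)) = \<rho>" "0 \<le> \<rho>" "\<rho> < 1" "continuous_on UNIV p" for y p \<rho>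
  proof -
    let ?w = "\<lambda>x::real. Complex (Re z - 1/2) y + of_real x"
    have "bounded ((\<lambda>x. H (?w x)) ` {0..1})" using contH[OF y] by (intro compact_imp_bounded compact_continuous_image) auto
    then obtain C where C: "\<And>x. x \<in> {0..1} \<Longrightarrow> norm (H (?w x)) \<le> C" by (force simp: bounded_iff)
    have "(\<lambda>N. C * \<rho> ^ N) \<longlonglongrightarrow> C * 0" using p by (intro tendsto_intros LIMSEQ_power_zero) auto
    hence "(\<lambda>N. C * \<rho> ^ N) \<longlonglongrightarrow> 0" by simp
    thus ?thesis
    proof (rule Lim_null_comparison[rotated], intro always_eventually allI)
      fix N
      have "continuous_on {0..1} (\<lambda>x. p (?w x))"
        by (rule continuous_on_compose2[OF p(4)]) (auto intro!: continuous_intros)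
      hence "norm (integral {0..1} (\<lambda>x. H (?w x) * p (?w x) ^ N)) \<le> C * \<rho> ^ N * (1 - 0)"
        using C p by (intro integral_bound continuous_intros contH y)
          (auto simp: norm_mult norm_power intro!: mult_right_mono)
      thus "norm (integral {0..1} (\<lambda>x. H (?w x) * p (?w x) ^ N)) \<le> C * \<rho> ^ N" by simp
    qed
  qed
  have gen: "X * ((1 - Y) / Z) = X / Z - X / Z * Y" for X Y Z :: complex
    by (simp add: diff_divide_distrib right_diff_distrib)
  have contq: "continuous_on UNIV q" "continuous_on UNIV (\<lambda>w. inverse (q w))" 
    unfolding q_def by (auto intro!: continuous_intros)
  have nq: "norm (q (Complex (Re z - 1/2) y + of_real x)) = exp (- (2 * pi * (Im z - y)))" for x y
    by (simp add: q_def)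
  have qpow: "q w ^ k = exp (2 * of_real pi * \<i> * of_int (int k) * (z - w))" for w k
    by (simp add: q_def exp_of_nat_mult[symmetric] mult_ac)
  have qinvpow: "inverse (q w) ^ k = exp (2 * of_real pi * \<i> * of_int (- int k) * (z - w))" for w k
    by (simp add: q_def exp_of_nat_mult[symmetric] mult_ac exp_minus[symmetric])
  have bot: "(\<lambda>k. e (int k) - (if k = 0 then F z else 0)) sums integral {0..1} (\<lambda>x. H (w1 + of_real x))"
  proof -
    let ?w = "\<lambda>x::real. Complex (Re z - 1/2) y1 + of_real x"
    have "(\<Sum>k<N. e (int k) - (if k = 0 then F z else 0)) = integral {0..1} (\<lambda>x. H (w1 + of_real x)) - integral {0..1} (\<lambda>x. H (?w x) * q (?w x) ^ N)" for N
    proof -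
      have "(\<Sum>k<N. e (int k) - (if k = 0 then F z else 0)) = (\<Sum>k<N. integral {0..1} (\<lambda>x. (F (?w x) - F z) * q (?w x) ^ k))"
        unfolding qpow using y by (subst lterm) auto
      also have "\<dots> = integral {0..1} (\<lambda>x. \<Sum>k<N. (F (?w x) - F z) * q (?w x) ^ k)"
        using contF y by (intro integral_sum[symmetric] integrable_continuous_real continuous_intros continuous_on_compose2[OF contq(1)]) auto
      also have "\<dots> = integral {0..1} (\<lambda>x. H (?w x) - H (?w x) * q (?w x) ^ N)"
      proof (rule integral_cong)
        fix x :: real assume x: "x \<in> {0..1}"
        have *: "?w x \<in> S" "?w x \<noteq> z" using line[OF refl x, of y1] y by auto
        have q: "q (?w x) \<noteq> 1" using * q1 by blast
        have "(\<Sum>k<N. (F (?w x) - F z) * q (?w x) ^ k) = (F (?w x) - F z) * ((1 - q (?w x) ^ N) / (1 - q (?w x)))"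
          unfolding sum_distrib_left[symmetric] using q by (simp add: sum_gp_strict)
        also have "\<dots> = H (?w x) - H (?w x) * q (?w x) ^ N"
          unfolding Heq[OF *] by (rule gen)
        finally show "(\<Sum>k<N. (F (?w x) - F z) * q (?w x) ^ k) = H (?w x) - H (?w x) * q (?w x) ^ N" .
      qed
      also have "\<dots> = integral {0..1} (\<lambda>x. H (?w x)) - integral {0..1} (\<lambda>x. H (?w x) * q (?w x) ^ N)"
        using y by (intro integral_diff integrable_continuous_real continuous_intros contH continuous_on_compose2[OF contq(1)]) auto
      finally show ?thesis by (simp add: w1_def)
    qed
    moreover have "(\<lambda>N. integral {0..1} (\<lambda>x. H (?w x) * q (?w x) ^ N)) \<longlonglongrightarrow> 0"
    proof (rule geo)
      show "norm (q (?w x)) = exp (- (2 * pi * (Im z - y1)))" for x by (rule nq)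
    qed (use y contq in auto)
    ultimately show ?thesis unfolding sums_def by (auto intro!: tendsto_eq_intros)
  qed
  have top: "(\<lambda>k. e (- int (Suc k))) sums (- integral {0..1} (\<lambda>x. H (w2 + of_real x)))"
  proof -
    let ?w = "\<lambda>x::real. Complex (Re z - 1/2) y2 + of_real x"
    let ?p = "\<lambda>w. inverse (q w)"
    have "(\<Sum>k<N. e (- int (Suc k))) = integral {0..1} (\<lambda>x. H (?w x) * ?p (?w x) ^ N) - integral {0..1} (\<lambda>x. H (w2 + of_real x))" for N
    proof -
      have "(\<Sum>k<N. e (- int (Suc k))) = (\<Sum>k<N. integral {0..1} (\<lambda>x. (F (?w x) - F z) * ?p (?w x) ^ Suc k))"
        unfolding qinvpow using y by (subst lterm) auto
      also have "\<dots> = integral {0..1} (\<lambda>x. \<Sum>k<N. (F (?w x) - F z) * ?p (?w x) ^ Suc k)"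
        using contF y by (intro integral_sum[symmetric] integrable_continuous_real continuous_intros continuous_on_compose2[OF contq(2)]) auto
      also have "\<dots> = integral {0..1} (\<lambda>x. H (?w x) * ?p (?w x) ^ N - H (?w x))"
      proof (rule integral_cong)
        fix x :: real assume x: "x \<in> {0..1}"
        have *: "?w x \<in> S" "?w x \<noteq> z" using line[OF refl x, of y2] y by auto
        have q: "q (?w x) \<noteq> 1" "q (?w x) \<noteq> 0" using * q1 by (auto simp: q_def)
        have "(\<Sum>k<N. (F (?w x) - F z) * ?p (?w x) ^ Suc k) = (F (?w x) - F z) * ?p (?w x) * (\<Sum>k<N. ?p (?w x) ^ k)"
          by (simp add: sum_distrib_left mult_ac)
        also have "(\<Sum>k<N. ?p (?w x) ^ k) = (1 - ?p (?w x) ^ N) / (1 - ?p (?w x))"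
          using q by (simp add: sum_gp_strict)
        also have "(F (?w x) - F z) * ?p (?w x) * ((1 - ?p (?w x) ^ N) / (1 - ?p (?w x))) = ((F (?w x) - F z) / (1 - q (?w x))) * (?p (?w x) ^ N - 1)"
        proof -
          have "?p (?w x) / (1 - ?p (?w x)) = - 1 / (1 - q (?w x))" using q by (simp add: field_simps)
          hence "(F (?w x) - F z) * (?p (?w x) / (1 - ?p (?w x))) * (1 - ?p (?w x) ^ N) = (F (?w x) - F z) * (- 1 / (1 - q (?w x))) * (1 - ?p (?w x) ^ N)" by simp
          thus ?thesis by (simp add: algebra_simps diff_divide_distrib)
        qed
        finally show "(\<Sum>k<N. (F (?w x) - F z) * ?p (?w x) ^ Suc k) = H (?w x) * ?p (?w x) ^ N - H (?w x)"
          unfolding Heq[OF *] by (simp only: right_diff_distrib mult_1_right)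
      qed
      also have "\<dots> = integral {0..1} (\<lambda>x. H (?w x) * ?p (?w x) ^ N) - integral {0..1} (\<lambda>x. H (?w x))"
        using y by (intro integral_diff integrable_continuous_real continuous_intros contH continuous_on_compose2[OF contq(2)]) auto
      finally show ?thesis by (simp add: w2_def)
    qed
    moreover have "(\<lambda>N. integral {0..1} (\<lambda>x. H (?w x) * ?p (?w x) ^ N)) \<longlonglongrightarrow> 0"
    proof (rule geo)
      show "norm (inverse (q (?w x))) = exp (2 * pi * (Im z - y2))" for x
        unfolding norm_inverse nq by (simp add: exp_minus[symmetric])
    qed (use y contq in \<open>auto simp: mult_pos_neg\<close>)
    ultimately show ?thesis unfolding sums_def by (auto intro!: tendsto_eq_intros)
  qed
  have "(\<lambda>k. (if k = (0::nat) then F z else 0)) sums F z" using sums_single[of 0 "\<lambda>_. F z"] by simp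
  from sums_add[OF bot this] have bot': "(\<lambda>k. e (int k)) sums (integral {0..1} (\<lambda>x. H (w1 + of_real x)) + F z)" by simp
  have se: "(\<lambda>m. norm (e m)) summable_on UNIV" unfolding e_def by (rule coeff_terms_summable[OF z])
  have "summable (\<lambda>k. norm (e (int k)))"
  proof -
    have "(\<lambda>m. norm (e m)) summable_on (range int)" using se by (rule summable_on_subset_banach) auto
    hence "((\<lambda>m. norm (e m)) \<circ> int) summable_on UNIV" by (subst (asm) summable_on_reindex) auto
    thus ?thesis by (simp add: o_def summable_on_UNIV_nonneg_real_iff)
  qed
  from norm_summable_imp_has_sum[OF this bot'] have 1: "((\<lambda>k. e (int k)) has_sum (integral {0..1} (\<lambda>x. H (w1 + of_real x)) + F z)) UNIV" .
  have "summable (\<lambda>k. norm (e (- int (Suc k))))"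
  proof -
    have "(\<lambda>m. norm (e m)) summable_on (range (\<lambda>k. - int (Suc k)))" using se by (rule summable_on_subset_banach) auto
    hence "((\<lambda>m. norm (e m)) \<circ> (\<lambda>k. - int (Suc k))) summable_on UNIV" by (subst (asm) summable_on_reindex) (auto simp: inj_def)
    thus ?thesis by (simp add: o_def summable_on_UNIV_nonneg_real_iff)
  qed
  from norm_summable_imp_has_sum[OF this top] have 2: "((\<lambda>k. e (- int (Suc k))) has_sum (- integral {0..1} (\<lambda>x. H (w2 + of_real x)))) UNIV" .
  from has_sum_int_halves[OF 1 2] show ?thesis by (simp add: Heq2 e_def)
qed

end

section \<open>Infinite products and linearisation at a repelling fixed point\<close>

lemma convergent_prod_LIMSEQ_less:
  fixes f :: "nat \<Rightarrow> complex"
  shows "convergent_prod f \<Longrightarrow> (\<lambda>N. \<Prod>k<N. f k) \<longlonglongrightarrow> prodinf f"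
  using convergent_prod_LIMSEQ[of f] by (subst filterlim_sequentially_Suc[symmetric]) (simp add: lessThan_Suc_atMost)

lemma holomorphic_prodinf:
  fixes g :: "nat \<Rightarrow> complex \<Rightarrow> complex"
  assumes U: "open U" and g: "\<And>k. g k holomorphic_on U"
    and bd: "\<And>z. z \<in> U \<Longrightarrow> \<exists>d>0. \<exists>M. cball z d \<subseteq> U \<and> summable M \<and> (\<forall>k. \<forall>w\<in>cball z d. norm (g k w - 1) \<le> M k)"
  shows "(\<lambda>z. \<Prod>k. g k z) holomorphic_on U"
    and "\<And>z. z \<in> U \<Longrightarrow> convergent_prod (\<lambda>k. g k z)"
proof -
  have conv: "convergent_prod (\<lambda>k. g k z)" if z: "z \<in> U" for z
  proof -
    obtain d M where "d > 0" "summable M" "\<forall>k. \<forall>w\<in>cball z d. norm (g k w - 1) \<le> M k"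
      using bd[OF z] by blast
    hence "summable (\<lambda>k. norm (g k z - 1))"
      by (intro summable_comparison_test[of "\<lambda>k. norm (g k z - 1)" M]) auto
    thus ?thesis by (simp add: abs_convergent_prod_conv_summable abs_convergent_prod_imp_convergent_prod)
  qed
  show "\<And>z. z \<in> U \<Longrightarrow> convergent_prod (\<lambda>k. g k z)" by (rule conv)
  have lim: "(\<lambda>N. \<Prod>k<N. g k z) \<longlonglongrightarrow> (\<Prod>k. g k z)" if "z \<in> U" for z
    by (rule convergent_prod_LIMSEQ_less[OF conv[OF that]])
  show "(\<lambda>z. \<Prod>k. g k z) holomorphic_on U"
  proof (rule holomorphic_uniform_sequence[OF U])
    show "(\<lambda>z. \<Prod>k<N. g k z) holomorphic_on U" for N by (intro holomorphic_intros g)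
    fix z assume z: "z \<in> U"
    then obtain d M where d: "d > 0" "cball z d \<subseteq> U" "summable M" "\<And>k w. w\<in>cball z d \<Longrightarrow> norm (g k w - 1) \<le> M k"
      using bd[OF z] by blast
    have "uniformly_convergent_on (cball z d) (\<lambda>N w. \<Prod>k<N. g k w)"
    proof (rule uniformly_convergent_on_prod')
      show "continuous_on (cball z d) (g k)" for k
        using g d holomorphic_on_imp_continuous_on holomorphic_on_subset by blast
      show "uniformly_convergent_on (cball z d) (\<lambda>N x. \<Sum>n<N. norm (g n x - 1))"
        by (rule Weierstrass_m_test'[OF _ d(3)]) (use d in auto)
    qed auto
    then obtain l where l: "uniform_limit (cball z d) (\<lambda>N w. \<Prod>k<N. g k w) l sequentially"
      by (auto simp: uniformly_convergent_on_def)
    have "l w = (\<Prod>k. g k w)" if "w \<in> cball z d" for w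
      using tendsto_uniform_limitI[OF l that] lim[of w] d(2) that LIMSEQ_unique by blast
    hence "uniform_limit (cball z d) (\<lambda>N w. \<Prod>k<N. g k w) (\<lambda>w. \<Prod>k. g k w) sequentially"
      using l by (subst uniform_limit_cong'[of _ _ _ _ l]) auto
    thus "\<exists>d>0. cball z d \<subseteq> U \<and> uniform_limit (cball z d) (\<lambda>N w. \<Prod>k<N. g k w) (\<lambda>w. \<Prod>k. g k w) sequentially"
      using d by blast
  qed
qed

lemma holomorphic_quadratic_remainder:
  assumes P: "P holomorphic_on ball a \<delta>" and \<delta>: "\<delta> > 0"
  obtains C where "C \<ge> 0" "\<And>w. w \<in> cball a (\<delta>/2) \<Longrightarrow> norm (P w - P a - deriv P a * (w - a)) \<le> C * norm (w - a) ^ 2"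
proof -
  define A where "A = (\<lambda>w. if w = a then deriv P a else (P w - P a) / (w - a))"
  have A: "A holomorphic_on ball a \<delta>" unfolding A_def using P by (intro pole_lemma_open) auto
  define B where "B = (\<lambda>w. if w = a then deriv A a else (A w - A a) / (w - a))"
  have B: "B holomorphic_on ball a \<delta>" unfolding B_def using A by (intro pole_lemma_open) auto
  have "compact (B ` cball a (\<delta>/2))"
    using B \<delta> by (intro compact_continuous_image holomorphic_on_imp_continuous_on[OF holomorphic_on_subset[OF B]]) auto
  then obtain C where C: "C > 0" "\<And>w. w \<in> cball a (\<delta>/2) \<Longrightarrow> norm (B w) \<le> C"
    using compact_imp_bounded bounded_pos by (metis imageI)
  have "norm (P w - P a - deriv P a * (w - a)) \<le> C * norm (w - a) ^ 2" if "w \<in> cball a (\<delta>/2)" for w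
  proof -
    have "P w - P a - deriv P a * (w - a) = B w * (w - a) ^ 2"
    proof (cases "w = a")
      case False
      hence "B w * (w - a) ^ 2 = (A w - A a) * (w - a)" by (simp add: B_def power2_eq_square)
      also have "\<dots> = A w * (w - a) - A a * (w - a)" by (rule left_diff_distrib)
      also have "A w * (w - a) = P w - P a" using False by (simp add: A_def)
      finally show ?thesis by (simp add: A_def)
    qed simp
    thus ?thesis using C(2)[OF that] by (simp add: norm_mult norm_power mult_right_mono)
  qed
  with C that show ?thesis by (metis less_imp_le)
qed

text \<open>
  Koenigs linearisation: \<open>P\<^sup>t(1 - z/E\<^sup>t)\<close> converges near 0.  With \<open>|P(1 + u) - 1| \<le> E|u|(1 + c|u|)\<close>
  and \<open>c' = c/(E - 1)\<close>, induction gives \<open>|P\<^sup>k(1 + u) - 1| \<le> y/(1 - c'y)\<close> for \<open>y = E\<^sup>k|u|\<close>, because the Moebius map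
  \<open>h(x) = E x/(1 - c x)\<close> majorises \<open>|P(1 + u) - 1|\<close> and satisfies \<open>h(y/(1 - c'y)) = E y/(1 - c'E y)\<close>.  So the rescaled iterates are
  uniformly bounded, by Cauchy's inequality they are uniformly Lipschitz, and consecutive ones differ
  by \<open>O(E\<^bsup>-t\<^esup>)\<close>.  The Lipschitz bound for the unscaled iterates is part of the conclusion because the bound
  \<open>|\<Pi>| \<le> 1\<close> on the half-plane rests on it.
\<close>
theorem koenigs_repelling:
  fixes P :: "complex \<Rightarrow> complex" and E \<delta> :: real
  assumes P: "P holomorphic_on ball 1 \<delta>" and \<delta>: "\<delta> > 0" and P1: "P 1 = 1" and dP: "deriv P 1 = of_real E" and E: "E > 1"
  obtains \<rho> C Pl where "\<rho> > 0" "C > 0" "Pl holomorphic_on ball 0 \<rho>" "Pl 0 = 1" "deriv Pl 0 = -1"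
    "\<And>z. z \<in> ball 0 \<rho> \<Longrightarrow> (\<lambda>t. (P ^^ t) (1 - z / of_real E ^ t)) \<longlonglongrightarrow> Pl z"
    "\<And>t u v. norm u \<le> \<rho> / E ^ t \<Longrightarrow> norm v \<le> \<rho> / E ^ t \<Longrightarrow> norm ((P ^^ t) (1 + u) - (P ^^ t) (1 + v)) \<le> C * E ^ t * norm (u - v)"
proof -
  obtain C where C: "C \<ge> 0" "\<And>w. w \<in> cball 1 (\<delta>/2) \<Longrightarrow> norm (P w - 1 - of_real E * (w - 1)) \<le> C * norm (w - 1) ^ 2"
    using holomorphic_quadratic_remainder[OF P \<delta>] P1 dP by metis
  have E0: "E > 0" using E by simp
  define c where "c = C / E"
  have c: "c \<ge> 0" using C E by (simp add: c_def)
  define c' where "c' = c / (E - 1)"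
  have c': "c' \<ge> 0" "c' * E = c' + c" using c E by (auto simp: c'_def field_simps)
  define r where "r = min (\<delta>/8) (1 / (2 * (c' + 1)))"
  have r: "r > 0" "2 * r \<le> \<delta>/4" "c' * r \<le> 1/2"
  proof -
    show "r > 0" using \<delta> c' by (simp add: r_def)
    show "2 * r \<le> \<delta>/4" by (simp add: r_def)
    have m: "c' * r \<le> (c' + 1) * (1 / (2 * (c' + 1)))" using c' \<open>r > 0\<close> by (intro mult_mono) (auto simp: r_def)
    have "c' + 1 > 0" using c'(1) by simp
    hence e: "(c' + 1) * (1 / (2 * (c' + 1))) = 1/2" by (simp add: field_simps)
    show "c' * r \<le> 1/2" using m unfolding e .
  qed
  have orbit: "norm ((P ^^ k) (1 + u) - 1) \<le> 2 * (E ^ k * norm u)" if "E ^ k * norm u \<le> r" for k u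
  proof -
    have "norm ((P ^^ j) (1 + u) - 1) * (1 - c' * (E ^ j * norm u)) \<le> E ^ j * norm u" if "j \<le> k" for j
      using that
    proof (induction j)
      case 0
      have "norm u * (1 - c' * norm u) \<le> norm u * 1" using c' by (intro mult_left_mono) auto
      thus ?case by simp
    next
      case (Suc j)
      define y where "y = E ^ j * norm u"
      define x where "x = norm ((P ^^ j) (1 + u) - 1)"
      have y0: "y \<ge> 0" using E0 by (simp add: y_def)
      have x0: "x \<ge> 0" by (simp add: x_def)
      have Ey: "E * y \<le> r"
      proof -
        have "E ^ Suc j \<le> E ^ k" using Suc.prems E by (intro power_increasing) auto
        hence "E ^ Suc j * norm u \<le> E ^ k * norm u" by (intro mult_right_mono) auto
        thus ?thesis using \<open>E ^ k * norm u \<le> r\<close> by (simp add: y_def mult_ac)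
      qed
      have cEy: "c' * y + c * y \<le> 1/2"
      proof -
        have "c' * (E * y) \<le> c' * r" using Ey c' by (intro mult_left_mono) auto
        also have "c' * (E * y) = (c' * E) * y" by simp
        also have "\<dots> = c' * y + c * y" unfolding c'(2) by (rule distrib_right)
        finally show ?thesis using r by simp
      qed
      have IH: "x * (1 - c' * y) \<le> y" using Suc by (simp add: x_def y_def)
      have cy: "c * y \<ge> 0" using c y0 by simp
      hence c'y: "c' * y \<le> 1/2" using cEy by linarith
      have "x * (1/2) \<le> x * (1 - c' * y)" using c'y x0 by (intro mult_left_mono) auto
      hence x2: "x \<le> 2 * y" using IH by simp
      have "y \<le> E * y" using E y0 by (simp add: mult_le_cancel_right1)
      hence "x \<le> \<delta>/2" using x2 Ey r \<delta> by linarith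
      hence "norm (P ((P ^^ j) (1 + u)) - 1 - of_real E * ((P ^^ j) (1 + u) - 1)) \<le> C * x ^ 2"
        unfolding x_def by (intro C(2)) (auto simp: dist_norm norm_minus_commute)
      moreover have "norm (P ((P ^^ j) (1 + u)) - 1) \<le> norm (P ((P ^^ j) (1 + u)) - 1 - of_real E * ((P ^^ j) (1 + u) - 1)) + norm (of_real E * ((P ^^ j) (1 + u) - 1))"
        using norm_triangle_ineq[of "P ((P ^^ j) (1 + u)) - 1 - of_real E * ((P ^^ j) (1 + u) - 1)" "of_real E * ((P ^^ j) (1 + u) - 1)"] by simp
      moreover have "norm (of_real E * ((P ^^ j) (1 + u) - 1)) = E * x" using E0 by (simp add: norm_mult x_def)
      ultimately have "norm (P ((P ^^ j) (1 + u)) - 1) \<le> E * x + C * x ^ 2" by linarith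
      also have "\<dots> = E * (x + c * x^2)" using E0 by (simp add: c_def field_simps)
      finally have le: "norm (P ((P ^^ j) (1 + u)) - 1) \<le> E * (x + c * x^2)" .
      \<comment> \<open>The Moebius step: \<open>1 - c' E y = 1 - c' y - c y\<close> by the choice of \<open>c'\<close>.\<close>
      have key: "(x + c * x^2) * (1 - c' * y - c * y) \<le> y"
      proof -
        have "(x + c * x^2) * (1 - c' * y - c * y) = (1 + c * x) * (x * (1 - c' * y) - c * x * y)"
          by (simp add: algebra_simps power2_eq_square)
        also have "\<dots> \<le> (1 + c * x) * (y - c * x * y)" using IH c x0 by (intro mult_left_mono) auto
        also have "\<dots> = y - (c * x)^2 * y" by (simp add: algebra_simps power2_eq_square)
        also have "\<dots> \<le> y" using y0 by simp
        finally show ?thesis .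
      qed
      have "norm ((P ^^ Suc j) (1 + u) - 1) * (1 - c' * (E ^ Suc j * norm u)) = norm (P ((P ^^ j) (1 + u)) - 1) * (1 - c' * y - c * y)"
      proof -
        have "c' * (E ^ Suc j * norm u) = (c' * E) * y" by (simp add: y_def)
        thus ?thesis unfolding c'(2) by (simp add: algebra_simps)
      qed
      also have "\<dots> \<le> E * (x + c * x^2) * (1 - c' * y - c * y)"
        using le cEy by (intro mult_right_mono) auto
      also have "\<dots> \<le> E * y" using key E0 by (simp add: mult.assoc)
      also have "\<dots> = E ^ Suc j * norm u" by (simp add: y_def)
      finally show ?case .
    qed
    from this[of k] have *: "norm ((P ^^ k) (1 + u) - 1) * (1 - c' * (E ^ k * norm u)) \<le> E ^ k * norm u" by simp
    have "c' * (E ^ k * norm u) \<le> c' * r" using that c' by (intro mult_left_mono) auto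
    hence "norm ((P ^^ k) (1 + u) - 1) * (1/2) \<le> norm ((P ^^ k) (1 + u) - 1) * (1 - c' * (E ^ k * norm u))"
      using r by (intro mult_left_mono) auto
    with * show ?thesis by simp
  qed
  have orbit': "norm ((P ^^ k) (1 + u) - 1) < \<delta>" if "E ^ t * norm u \<le> r" "k \<le> t" for k t u
  proof -
    have "E ^ k * norm u \<le> E ^ t * norm u" using that E by (intro mult_right_mono power_increasing) auto
    hence "E ^ k * norm u \<le> r" using that by simp
    from orbit[OF this] \<open>E ^ k * norm u \<le> r\<close> r \<delta> show ?thesis by linarith
  qed
  define G where "G = (\<lambda>t z. (P ^^ t) (1 + z / of_real E ^ t))"
  have nz: "E ^ t * norm (z / of_real E ^ t) = norm z" for z :: complex and t using E0 by (simp add: norm_divide norm_power)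
  have hol: "(\<lambda>z. (P ^^ k) (1 + z / of_real E ^ t)) holomorphic_on ball 0 r" if "k \<le> t" for k t
    using that
  proof (induction k)
    case (Suc k)
    have "P \<circ> (\<lambda>z. (P ^^ k) (1 + z / of_real E ^ t)) holomorphic_on ball 0 r"
    proof (rule holomorphic_on_compose_gen[OF _ P])
      show "(\<lambda>z. (P ^^ k) (1 + z / of_real E ^ t)) ` ball 0 r \<subseteq> ball 1 \<delta>"
        using orbit'[of t _ k] Suc.prems by (auto simp: nz dist_norm norm_minus_commute)
    qed (use Suc in auto)
    thus ?case by (simp add: o_def)
  qed (use E0 in \<open>auto intro!: holomorphic_intros\<close>)
  have holG: "G t holomorphic_on ball 0 r" for t unfolding G_def by (rule hol) simp
  have bdG: "norm (G t z - 1) \<le> 2 * r" if "z \<in> ball 0 r" for t z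
    using orbit[of t "z / of_real E ^ t"] that by (simp add: nz G_def)
  have derG: "norm (deriv (G t) z) \<le> 6" if z: "z \<in> cball 0 (r/2)" for t z
  proof -
    have sub: "cball z (r/3) \<subseteq> ball 0 r"
    proof
      fix w assume "w \<in> cball z (r/3)"
      hence "norm w \<le> norm z + r/3" using norm_triangle_sub[of w z] by (simp add: dist_norm norm_minus_commute)
      thus "w \<in> ball 0 r" using z r by simp
    qed
    have "norm ((deriv ^^ 1) (\<lambda>z. G t z - 1) z) \<le> fact 1 * (2 * r) / (r/3) ^ 1"
    proof (rule Cauchy_inequality)
      show "(\<lambda>z. G t z - 1) holomorphic_on ball z (r/3)"
        by (intro holomorphic_intros holomorphic_on_subset[OF holG]) (use sub ball_subset_cball in blast)
      show "continuous_on (cball z (r/3)) (\<lambda>z. G t z - 1)"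
        by (intro continuous_intros holomorphic_on_imp_continuous_on holomorphic_on_subset[OF holG] sub)
      show "norm (G t x - 1) \<le> 2 * r" if "norm (z - x) = r/3" for x
        using sub that by (intro bdG) (auto simp: dist_norm subset_iff)
    qed (use r in auto)
    moreover have "deriv (\<lambda>z. G t z - 1) z = deriv (G t) z"
    proof -
      have "z \<in> ball 0 r" using z r by auto
      hence "(G t has_field_derivative deriv (G t) z) (at z)" by (intro holomorphic_derivI[OF holG]) auto
      thus ?thesis by (intro DERIV_imp_deriv) (auto intro!: derivative_eq_intros)
    qed
    ultimately show ?thesis using r by simp
  qed
  have lip: "norm ((P ^^ t) (1 + u) - (P ^^ t) (1 + v)) \<le> 6 * E ^ t * norm (u - v)"
    if u: "norm u \<le> (r/2) / E ^ t" and v: "norm v \<le> (r/2) / E ^ t" for t u v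
  proof -
    have e: "norm (of_real E ^ t * w :: complex) = E ^ t * norm w" for w
      unfolding norm_mult norm_power norm_of_real using E0 by simp
    have e2: "G t (of_real E ^ t * w) = (P ^^ t) (1 + w)" for w
      using E0 by (simp add: G_def)
    have e3: "E ^ t * norm w \<le> r/2" if "norm w \<le> (r/2) / E ^ t" for w :: complex
      using that E0 pos_le_divide_eq[of "E^t" "norm w" "r/2"] by (simp add: mult.commute)
    have "norm (G t (of_real E ^ t * u) - G t (of_real E ^ t * v)) \<le> 6 * norm (of_real E ^ t * u - of_real E ^ t * v)"
    proof (rule field_differentiable_bound[OF convex_cball])
      show "(G t has_field_derivative deriv (G t) z) (at z within cball 0 (r/2))" if "z \<in> cball 0 (r/2)" for z
        by (rule has_field_derivative_at_within, rule holomorphic_derivI[OF holG]) (use that r in auto)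
      show "of_real E ^ t * u \<in> cball 0 (r/2)" "of_real E ^ t * v \<in> cball 0 (r/2)"
        using e3[OF u] e3[OF v] by (simp_all add: e)
    qed (rule derG)
    also have "of_real E ^ t * u - of_real E ^ t * v = of_real E ^ t * (u - v)" by (simp add: algebra_simps)
    finally show ?thesis unfolding e2 e by (simp add: mult.assoc)
  qed
  \<comment> \<open>One application of \<open>P\<close> may double the scaled distance, and the Lipschitz bound holds up to \<open>r/2\<close>.\<close>
  define \<rho> where "\<rho> = r/4"
  have \<rho>: "\<rho> > 0" using r by (simp add: \<rho>_def)
  define f where "f = (\<lambda>t z. (P ^^ t) (1 - z / of_real E ^ t))"
  have f_eq: "f t z = G t (- z)" for t z by (simp add: f_def G_def)
  have holf: "f t holomorphic_on ball 0 \<rho>" for t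
  proof -
    have "G t \<circ> (\<lambda>z::complex. - z) holomorphic_on ball 0 \<rho>"
    proof (rule holomorphic_on_compose_gen[OF _ holG])
      show "(\<lambda>z::complex. - z) holomorphic_on ball 0 \<rho>" by (rule holomorphic_on_minus[OF holomorphic_on_ident])
      show "(\<lambda>z::complex. - z) ` ball 0 \<rho> \<subseteq> ball 0 r"
      proof
        fix w :: complex assume "w \<in> (\<lambda>z::complex. - z) ` ball 0 \<rho>"
        hence "norm w < \<rho>" by auto
        thus "w \<in> ball 0 r" using r by (simp add: \<rho>_def)
      qed
    qed
    moreover have "f t = G t \<circ> (\<lambda>z. - z)" using f_eq by (simp add: fun_eq_iff)
    ultimately show ?thesis by simp
  qed
  have diff: "norm (f (Suc t) z - f t z) \<le> 6 * C * \<rho>^2 * (1/E) ^ t" if z: "z \<in> ball 0 \<rho>" for t z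
  proof -
    define u where "u = - z / of_real E ^ Suc t"
    define v where "v = P (1 + u) - 1"
    have nu: "norm u = norm z / E ^ Suc t" unfolding u_def norm_divide norm_minus_cancel norm_power norm_of_real using E0 by simp
    have En: "E ^ t \<ge> 1" using E by simp
    have Eu: "E * norm u = norm z / E ^ t" using E0 by (simp add: nu)
    have Eu1: "E * norm u \<le> norm z" unfolding Eu using En by (simp add: divide_le_eq mult_le_cancel_left1)
    have nv: "norm v \<le> 2 * (norm z / E ^ t)"
      using orbit[of 1 u] Eu Eu1 z r by (simp add: v_def \<rho>_def)
    have "norm (f (Suc t) z - f t z) = norm ((P ^^ t) (1 + v) - (P ^^ t) (1 + (- z / of_real E ^ t)))"
      by (simp add: f_def v_def u_def funpow_swap1)
    also have "\<dots> \<le> 6 * E ^ t * norm (v - (- z / of_real E ^ t))"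
    proof (rule lip)
      have "2 * (norm z / E ^ t) \<le> (r/2) / E ^ t" using z E0 by (simp add: \<rho>_def divide_right_mono field_simps)
      thus "norm v \<le> (r/2) / E ^ t" using nv by linarith
      show "norm (- z / of_real E ^ t) \<le> (r/2) / E ^ t" unfolding norm_divide norm_minus_cancel norm_power norm_of_real using z E0 r divide_right_mono[of "norm z" "r/2" "E^t"] by (simp add: \<rho>_def)
    qed
    also have "norm (v - (- z / of_real E ^ t)) = norm (P (1 + u) - 1 - of_real E * ((1 + u) - 1))"
      using E0 by (simp add: v_def u_def)
    also have "\<dots> \<le> C * norm ((1 + u) - 1) ^ 2"
    proof (rule C(2))
      have "norm u \<le> E * norm u" using E by (simp add: mult_le_cancel_right1)
      thus "1 + u \<in> cball 1 (\<delta>/2)" using Eu1 z r \<delta> by (simp add: dist_norm \<rho>_def)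
    qed
    also have "norm ((1 + u) - 1) ^ 2 \<le> (\<rho> / E ^ t) ^ 2"
    proof (rule power_mono)
      have "norm u \<le> E * norm u" using E by (simp add: mult_le_cancel_right1)
      also have "\<dots> \<le> \<rho> / E ^ t" unfolding Eu using z E0 by (intro divide_right_mono) auto
      finally show "norm ((1 + u) - 1) \<le> \<rho> / E ^ t" by simp
    qed auto
    also have "6 * E ^ t * (C * (\<rho> / E ^ t) ^ 2) = 6 * C * \<rho>^2 * (1/E) ^ t"
      using E0 by (simp add: power2_eq_square field_simps)
    finally show ?thesis using C E0 by (simp add: mult_left_mono)
  qed
  have "uniformly_convergent_on (ball 0 \<rho>) (\<lambda>N z. \<Sum>t<N. f (Suc t) z - f t z)"
    by (rule Weierstrass_m_test'[where M = "\<lambda>t. 6 * C * \<rho>^2 * (1/E) ^ t"])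
       (use diff E in \<open>auto intro!: summable_mult summable_geometric\<close>)
  then obtain l where "uniform_limit (ball 0 \<rho>) (\<lambda>N z. \<Sum>t<N. f (Suc t) z - f t z) l sequentially"
    by (auto simp: uniformly_convergent_on_def)
  moreover have "(\<Sum>t<N. f (Suc t) z - f t z) = f N z - f 0 z" for N z
    by (rule sum_lessThan_telescope[of "\<lambda>t. f t z"])
  ultimately have "uniform_limit (ball 0 \<rho>) (\<lambda>N z. f N z - f 0 z) l sequentially"
    by simp
  hence "uniform_limit (ball 0 \<rho>) (\<lambda>N z. (f N z - f 0 z) + f 0 z) (\<lambda>z. l z + f 0 z) sequentially"
    by (intro uniform_limit_add uniform_limit_const)
  hence ul: "uniform_limit (ball 0 \<rho>) f (\<lambda>z. l z + f 0 z) sequentially" by simp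
  define Pl where "Pl = (\<lambda>z. l z + f 0 z)"
  have ul': "uniform_limit (ball 0 \<rho>) f Pl sequentially" using ul by (simp add: Pl_def)
  have lim: "(\<lambda>t. f t z) \<longlonglongrightarrow> Pl z" if "z \<in> ball 0 \<rho>" for z
    using tendsto_uniform_limitI[OF ul' that] .
  have fix1: "(P ^^ t) 1 = 1" for t by (induction t) (auto simp: P1)
  have cb: "\<exists>d>0. cball x d \<subseteq> ball 0 \<rho> \<and> uniform_limit (cball x d) f Pl sequentially" if x: "x \<in> ball 0 \<rho>" for x
  proof -
    obtain d where d: "d > 0" "cball x d \<subseteq> ball 0 \<rho>"
      using open_contains_cball[THEN iffD1, OF open_ball, rule_format, OF x] by blast
    have "uniform_limit (cball x d) f Pl sequentially" by (rule uniform_limit_on_subset[OF ul' d(2)])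
    with d show ?thesis by blast
  qed
  have "\<exists>g'. \<forall>x\<in>ball 0 \<rho>. (Pl has_field_derivative g' x) (at x) \<and> (\<lambda>n. deriv (f n) x) \<longlonglongrightarrow> g' x"
  proof (rule has_complex_derivative_uniform_sequence)
    show "(f n has_field_derivative deriv (f n) x) (at x)" if "x \<in> ball 0 \<rho>" for n x
      using that by (intro holomorphic_derivI[OF holf]) auto
  qed (use cb in auto)
  then obtain g' where g': "\<And>x. x \<in> ball 0 \<rho> \<Longrightarrow> (Pl has_field_derivative g' x) (at x)" "\<And>x. x \<in> ball 0 \<rho> \<Longrightarrow> (\<lambda>n. deriv (f n) x) \<longlonglongrightarrow> g' x"
    by blast
  have holPl: "Pl holomorphic_on ball 0 \<rho>" unfolding holomorphic_on_open[OF open_ball] using g'(1) by blast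
  have dP1: "(P has_field_derivative of_real E) (at 1)"
    using holomorphic_derivI[OF P _ , of 1] \<delta> dP by auto
  have dPt: "((P ^^ t) has_field_derivative (of_real E ^ t)) (at 1)" for t
  proof (induction t)
    case 0
    have "((\<lambda>x. x) has_field_derivative 1) (at (1::complex))" by (rule DERIV_ident)
    thus ?case by (simp add: id_def)
  next
    case (Suc t)
    have "((\<lambda>x. P ((P ^^ t) x)) has_field_derivative of_real E * of_real E ^ t) (at 1)"
      by (rule DERIV_chain2[where f = P]) (use dP1 fix1 Suc in auto)
    thus ?case by (simp add: o_def)
  qed
  have df: "deriv (f t) 0 = -1" for t
  proof -
    have "((\<lambda>z. (P ^^ t) (1 - z / of_real E ^ t)) has_field_derivative (of_real E ^ t * (- 1 / of_real E ^ t))) (at 0)"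
      by (rule DERIV_chain2[where f = "P ^^ t"]) (use dPt E0 in \<open>auto intro!: derivative_eq_intros\<close>)
    thus ?thesis unfolding f_def using E0 by (intro DERIV_imp_deriv) simp
  qed
  have "g' 0 = -1" using g'(2)[of 0] \<rho> df by (simp add: LIMSEQ_const_iff)
  hence dPl: "deriv Pl 0 = -1" using g'(1)[of 0] \<rho> by (intro DERIV_imp_deriv) simp
  have "f t 0 = 1" for t by (simp add: f_def fix1)
  hence Pl0: "Pl 0 = 1" using lim[of 0] \<rho> by (simp add: LIMSEQ_const_iff)
  show ?thesis
  proof (rule that[OF \<rho> _ holPl Pl0 dPl, of 6])
    show "(\<lambda>t. (P ^^ t) (1 - z / of_real E ^ t)) \<longlonglongrightarrow> Pl z" if "z \<in> ball 0 \<rho>" for z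
      using lim[OF that] by (simp add: f_def)
    show "norm ((P ^^ t) (1 + u) - (P ^^ t) (1 + v)) \<le> 6 * E ^ t * norm (u - v)" if "norm u \<le> \<rho> / E ^ t" "norm v \<le> \<rho> / E ^ t" for t u v
    proof (rule lip)
      have "\<rho> / E ^ t \<le> (r/2) / E ^ t" using r E0 by (intro divide_right_mono) (auto simp: \<rho>_def)
      thus "norm u \<le> (r/2) / E ^ t" "norm v \<le> (r/2) / E ^ t" using that by auto
    qed
  qed auto
qed

section \<open>Probability generating functions\<close>

lemma pmf_nat_sums_one: "pmf (p :: nat pmf) sums 1"
  using sums_infsetsum_nat'[OF pmf_abs_summable[of p UNIV]] infsetsum_pmf_eq_1[of p UNIV] by simp

lemma pgf_sums:
  assumes "norm z \<le> 1"
  shows "(\<lambda>k. of_real (pmf p k) * z ^ k) sums pgf p z" "summable (\<lambda>k. norm (of_real (pmf p k) * z ^ k))"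
proof -
  show s: "summable (\<lambda>k. norm (of_real (pmf p k) * z ^ k))"
  proof (rule summable_comparison_test[OF _ sums_summable[OF pmf_nat_sums_one[of p]]])
    show "\<exists>N. \<forall>n\<ge>N. norm (norm (of_real (pmf p n) * z ^ n)) \<le> pmf p n"
      using assms by (auto simp: norm_mult norm_power intro!: mult_left_le power_le_one)
  qed
  show "(\<lambda>k. of_real (pmf p k) * z ^ k) sums pgf p z"
    unfolding pgf_def using summable_norm_cancel[OF s] by (rule summable_sums)
qed

lemma pgf_one [simp]: "pgf p 1 = 1"
proof -
  have "(\<lambda>k. of_real (pmf p k) :: complex) sums of_real 1"
    by (rule sums_of_real) (rule pmf_nat_sums_one)
  thus ?thesis by (simp add: pgf_def sums_iff)
qed

lemma pgf_zero [simp]: "pgf p 0 = of_real (pmf p 0)"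
  by (simp add: pgf_def)

lemma norm_pgf_le_1: "norm z \<le> 1 \<Longrightarrow> norm (pgf p z) \<le> 1"
proof -
  assume z: "norm z \<le> 1"
  have "norm (pgf p z) \<le> (\<Sum>k. norm (of_real (pmf p k) * z ^ k))"
    unfolding pgf_def using pgf_sums(2)[OF z] by (rule summable_norm)
  also have "\<dots> \<le> (\<Sum>k. pmf p k)"
    using z sums_summable[OF pmf_nat_sums_one[of p]] pgf_sums(2)[OF z]
    by (intro suminf_le) (auto simp: norm_mult norm_power intro!: mult_left_le power_le_one)
  also have "\<dots> = 1" using pmf_nat_sums_one[of p] by (simp add: sums_iff)
  finally show ?thesis .
qed

lemma pgf_holomorphic_summable:
  assumes "summable (\<lambda>k. pmf p k * R ^ k)" "R > 0"
  shows "pgf p holomorphic_on ball 0 R"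
proof (rule power_series_holomorphic[where a = "\<lambda>k. of_real (pmf p k)"])
  fix w :: complex assume w: "w \<in> ball 0 R"
  have "summable (\<lambda>k. of_real (pmf p k) * (of_real R :: complex) ^ k)"
    using summable_of_real[OF assms(1), where 'a = complex] by simp
  from powser_inside[OF this, of w] w assms
  have "summable (\<lambda>k. of_real (pmf p k) * w ^ k)" by simp
  thus "(\<lambda>n. of_real (pmf p n) * (w - 0) ^ n) sums pgf p w"
    by (simp add: pgf_def summable_sums)
qed

lemma pgf_holomorphic_unit: "pgf p holomorphic_on ball 0 1"
  using sums_summable[OF pmf_nat_sums_one[of p]] by (intro pgf_holomorphic_summable) auto

text \<open>
  Where the power series diverges its sum is one fixed constant \<open>c\<close>.  If the radius of
  convergence were 1, analyticity at 1 would make the generating function equal to \<open>c\<close> near 1, hence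
  on the unit disc; a constant power series, however, converges everywhere.
\<close>
theorem pgf_analytic_radius:
  assumes "pgf p analytic_on {1}"
  obtains R where "R > 1" "pgf p holomorphic_on ball 0 R"
proof (cases "\<exists>R>1. summable (\<lambda>k. pmf p k * R ^ k)")
  case True
  thus ?thesis using pgf_holomorphic_summable that by fastforce
next
  case False
  obtain e where e: "e > 0" "pgf p holomorphic_on ball 1 e"
    using assms by (auto simp: analytic_on_def)
  define c :: complex where "c = (THE s. False)"
  have c: "pgf p z = c" if "norm z > 1" for z
  proof -
    have "\<not> summable (\<lambda>k. of_real (pmf p k) * z ^ k)"
    proof
      assume s: "summable (\<lambda>k. of_real (pmf p k) * z ^ k)"
      define r where "r = (1 + norm z) / 2"
      have r: "r > 1" "norm (of_real r :: complex) < norm z" using that unfolding norm_of_real by (auto simp: r_def)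
      from powser_insidea[OF s r(2)] have "summable (\<lambda>k. pmf p k * r ^ k)"
        using r by (simp add: norm_mult norm_power)
      thus False using False r by blast
    qed
    hence "(\<lambda>s. (\<lambda>k. of_real (pmf p k) * z ^ k) sums s) = (\<lambda>_. False)"
      by (auto simp: summable_def)
    thus ?thesis unfolding pgf_def suminf_def c_def by simp
  qed
  have 1: "pgf p z = c" if "z \<in> ball 1 e" for z
  proof (rule analytic_continuation_open[of "ball 1 e \<inter> {z. Re z > 1}" "ball 1 e" "pgf p" "\<lambda>_. c"])
    have "of_real (1 + e/2) \<in> ball (1::complex) e \<inter> {z. Re z > 1}" using e by (simp add: dist_norm)
    thus "ball (1::complex) e \<inter> {z. Re z > 1} \<noteq> {}" by blast
    show "pgf p z = c" if "z \<in> ball 1 e \<inter> {z. Re z > 1}" for z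
      using that complex_Re_le_cmod[of z] by (intro c) auto
  qed (use e that in \<open>auto intro!: open_Int open_halfspace_Re_gt\<close>)
  have 2: "pgf p z = c" if "z \<in> ball 0 1" for z
  proof (rule analytic_continuation_open[of "ball 1 e \<inter> ball 0 1" "ball 0 1" "pgf p" "\<lambda>_. c"])
    define m where "m = min (e/2) (1/2)"
    have m: "m > 0" "m < e" "m < 1" using e by (auto simp: m_def)
    have "of_real (1 - m) \<in> ball (1::complex) e \<inter> ball 0 1"
    proof
      show "of_real (1 - m) \<in> ball (1::complex) e" using m by (simp add: dist_norm)
      have "norm (of_real (1 - m) :: complex) < 1" using m unfolding norm_of_real by simp
      thus "of_real (1 - m) \<in> ball (0::complex) 1" by (simp only: mem_ball_0)
    qed
    
    thus "ball (1::complex) e \<inter> ball 0 1 \<noteq> {}" by blast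
  qed (use e that 1 in \<open>auto intro!: open_Int pgf_holomorphic_unit\<close>)
  have s: "(\<lambda>k. pmf p k * (1/2) ^ k) sums Re (pgf p (1/2))"
    using sums_Re[OF pgf_sums(1)[of "1/2" p]]
    by (simp add: power_divide flip: of_real_power of_real_divide)
  have "pgf p (1/2) = of_real (pmf p 0)" using 2[of 0] 2[of "1/2"] by simp
  hence "Re (pgf p (1/2)) = pmf p 0" by simp
  with s have s: "(\<lambda>k. pmf p k * (1/2) ^ k) sums pmf p 0" by simp
  have "(\<lambda>k. pmf p (Suc k) * (1/2) ^ Suc k) sums (pmf p 0 - pmf p 0 * (1/2) ^ 0)"
    using s by (subst sums_Suc_iff) simp
  hence z: "(\<lambda>k. pmf p (Suc k) * (1/2) ^ Suc k) sums 0" by simp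
  hence "pmf p (Suc k) * (1/2) ^ Suc k = 0" for k
    using suminf_eq_zero_iff[OF sums_summable[OF z]] z by (auto simp: sums_iff)
  hence "pmf p (Suc k) = 0" for k by simp
  hence "pmf p k * 2 ^ k = 0" if "k \<notin> {0}" for k using that by (cases k) auto
  hence "summable (\<lambda>k. pmf p k * 2 ^ k)" by (intro summable_finite[of "{0}"]) auto
  thus ?thesis using False by force
qed

lemma norm_pgf_le:
  assumes p0: "pmf p 0 = 0" and z: "norm z \<le> 1"
  shows "norm (pgf p z) \<le> norm z * (pmf p 1 + (1 - pmf p 1) * norm z)"
proof -
  have s1: "(\<lambda>k. pmf p (Suc (Suc k))) sums (1 - pmf p 1)"
    using pmf_nat_sums_one[of p] p0 by (subst sums_Suc_iff, subst sums_Suc_iff) auto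
  have s2: "(\<lambda>k. pmf p k * norm z ^ k) sums (\<Sum>k. norm (of_real (pmf p k) * z ^ k))"
    using pgf_sums(2)[OF z] by (simp add: norm_mult norm_power summable_sums)
  hence s3: "(\<lambda>k. pmf p (Suc (Suc k)) * norm z ^ Suc (Suc k)) sums ((\<Sum>k. norm (of_real (pmf p k) * z ^ k)) - pmf p 1 * norm z)"
    using p0 by (subst sums_Suc_iff, subst sums_Suc_iff) auto
  have "(\<Sum>k. norm (of_real (pmf p k) * z ^ k)) - pmf p 1 * norm z \<le> (1 - pmf p 1) * norm z ^ 2"
  proof (rule sums_le[OF _ s3 sums_mult2[OF s1]])
    fix k
    have "norm z ^ Suc (Suc k) \<le> norm z ^ 2" using z by (intro power_decreasing) auto
    thus "pmf p (Suc (Suc k)) * norm z ^ Suc (Suc k) \<le> pmf p (Suc (Suc k)) * norm z ^ 2"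
      by (intro mult_left_mono) auto
  qed
  moreover have "norm (pgf p z) \<le> (\<Sum>k. norm (of_real (pmf p k) * z ^ k))"
    unfolding pgf_def using pgf_sums(2)[OF z] by (rule summable_norm)
  ultimately show ?thesis by (simp add: algebra_simps power2_eq_square)
qed

text \<open>
  Equality in the triangle inequality for \<open>\<Sum>\<^sub>k p\<^sub>k w\<^sup>k\<close> forces the terms with \<open>k = 1\<close> and \<open>k = j + 2\<close> to have
  the same argument.
\<close>
lemma pgf_unimodular_imp_root_of_unity:
  assumes p0: "pmf p 0 = 0" and p1: "pmf p 1 > 0" and j: "pmf p (Suc (Suc j)) > 0" and w: "norm w = 1" and P: "norm (pgf p w) = 1"
  shows "w ^ Suc j = 1"
proof -
  let ?j = "Suc (Suc j)"
  define r where "r = (\<lambda>k. if k = 1 \<or> k = ?j then 0 else pmf p k)"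
  have "(\<lambda>k. pmf p k - (if k \<in> {1, ?j} then pmf p k else 0)) sums (1 - (\<Sum>k\<in>{1, ?j}. pmf p k))"
    by (intro sums_diff pmf_nat_sums_one sums_If_finite_set) auto
  also have "(\<lambda>k. pmf p k - (if k \<in> {1, ?j} then pmf p k else 0)) = r" by (auto simp: r_def)
  finally have r: "r sums (1 - (pmf p 1 + pmf p ?j))" by simp
  have rn: "norm (of_real (r k) * w ^ k) = r k" for k
    using w by (simp add: norm_mult norm_power r_def)
  have "(\<lambda>k. of_real (pmf p k) * w ^ k - (if k \<in> {1, ?j} then of_real (pmf p k) * w ^ k else 0)) sums (pgf p w - (\<Sum>k\<in>{1, ?j}. of_real (pmf p k) * w ^ k))"
    using w by (intro sums_diff pgf_sums sums_If_finite_set) auto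
  also have "(\<lambda>k. of_real (pmf p k) * w ^ k - (if k \<in> {1, ?j} then of_real (pmf p k) * w ^ k else 0)) = (\<lambda>k. of_real (r k) * w ^ k)"
    by (auto simp: r_def)
  finally have s: "(\<lambda>k. of_real (r k) * w ^ k) sums (pgf p w - (of_real (pmf p 1) * w + of_real (pmf p ?j) * w ^ ?j))"
    by simp
  have "norm (pgf p w - (of_real (pmf p 1) * w + of_real (pmf p ?j) * w ^ ?j)) \<le> 1 - (pmf p 1 + pmf p ?j)"
  proof -
    have "norm (\<Sum>k. of_real (r k) * w ^ k) \<le> (\<Sum>k. norm (of_real (r k) * w ^ k))"
      by (rule summable_norm) (use r in \<open>simp add: rn sums_iff\<close>)
    thus ?thesis unfolding rn using r s by (simp add: sums_iff)
  qed
  moreover have "norm (pgf p w) \<le> norm (pgf p w - (of_real (pmf p 1) * w + of_real (pmf p ?j) * w ^ ?j)) + norm (of_real (pmf p 1) * w + of_real (pmf p ?j) * w ^ ?j)"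
    using norm_triangle_ineq[of "pgf p w - (of_real (pmf p 1) * w + of_real (pmf p ?j) * w ^ ?j)" "of_real (pmf p 1) * w + of_real (pmf p ?j) * w ^ ?j"] by simp
  ultimately have "pmf p 1 + pmf p ?j \<le> norm (of_real (pmf p 1) * w + of_real (pmf p ?j) * w ^ ?j)"
    using P by linarith
  also have "of_real (pmf p 1) * w + of_real (pmf p ?j) * w ^ ?j = w * (of_real (pmf p 1) + of_real (pmf p ?j) * w ^ Suc j)"
    by (simp add: algebra_simps)
  also have "norm \<dots> = norm (of_real (pmf p 1) + of_real (pmf p ?j) * w ^ Suc j)" using w by (simp add: norm_mult)
  finally have le: "pmf p 1 + pmf p ?j \<le> norm (of_real (pmf p 1) + of_real (pmf p ?j) * w ^ Suc j)" .
  define x where "x = w ^ Suc j"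
  define a b where "a = pmf p 1" and "b = pmf p ?j"
  have ab: "a > 0" "b > 0" using p1 j by (auto simp: a_def b_def)
  have x: "norm x = 1" using w by (simp add: x_def norm_power norm_mult)
  have x2: "(Re x)^2 + (Im x)^2 = 1" using x by (simp add: cmod_def)
  have "(a + b)^2 \<le> (norm (of_real a + of_real b * x))^2" using le ab by (intro power_mono) (auto simp: a_def b_def x_def)
  also have "\<dots> = (a + b * Re x)^2 + (b * Im x)^2" unfolding cmod_power2 by simp
  also have "\<dots> = a^2 + 2 * (a * b) * Re x + b^2 * ((Re x)^2 + (Im x)^2)" by (simp add: power2_eq_square algebra_simps)
  finally have "2 * (a * b) * 1 \<le> 2 * (a * b) * Re x" unfolding x2 by (simp add: power2_eq_square algebra_simps)
  hence "Re x \<ge> 1" using ab by simp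
  moreover have "Re x \<le> 1" using complex_Re_le_cmod[of x] x by simp
  ultimately have "Re x = 1" by simp
  moreover from this x2 have "Im x = 0" by simp
  ultimately have "x = 1" by (simp add: complex_eq_iff)
  thus ?thesis by (simp add: x_def)
qed

text \<open>
  The difference quotients of \<open>P\<close> along \<open>s \<rightarrow> 1\<close>, \<open>s < 1\<close> are real, and by \<open>norm_pgf_le\<close> at least
  \<open>1 + (1 - p\<^sub>1) s\<close>; hence \<open>E \<ge> 2 - p\<^sub>1 > 1\<close>.
\<close>
lemma gw_E_props:
  assumes p0: "pmf p 0 = 0" and p1: "pmf p 1 < 1" and an: "pgf p analytic_on {1}"
  shows "gw_E p > 1" "deriv (pgf p) 1 = of_real (gw_E p)"
proof -
  obtain R where R: "R > 1" "pgf p holomorphic_on ball 0 R" using pgf_analytic_radius[OF an] .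
  have d: "(pgf p has_field_derivative deriv (pgf p) 1) (at 1)"
    using R by (intro holomorphic_derivI[OF R(2)]) auto
  define s where "s = (\<lambda>n. 1 - 1 / real (Suc (Suc n)))"
  have s: "s n > 0" "s n < 1" for n by (auto simp: s_def field_simps)
  have slim: "s \<longlonglongrightarrow> 1"
  proof -
    have "(\<lambda>n. 1 - inverse (real (Suc (Suc n)))) \<longlonglongrightarrow> 1 - 0"
      by (intro tendsto_intros LIMSEQ_Suc[OF LIMSEQ_inverse_real_of_nat])
    thus ?thesis by (simp add: s_def[abs_def] inverse_eq_divide)
  qed
  define q where "q = (\<lambda>n. (pgf p (of_real (s n)) - 1) / (of_real (s n) - 1))"
  have "q \<longlonglongrightarrow> deriv (pgf p) 1"
  proof -
    have "((\<lambda>w. (pgf p w - pgf p 1) / (w - 1)) \<longlongrightarrow> deriv (pgf p) 1) (at 1)"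
      using d by (simp add: has_field_derivative_iff)
    moreover have "filterlim (\<lambda>n. complex_of_real (s n)) (at 1) sequentially"
      using s tendsto_of_real[OF slim, where 'a = complex]
      by (auto simp: filterlim_at intro!: always_eventually) (metis less_irrefl of_real_eq_1_iff)
    ultimately show ?thesis unfolding q_def using filterlim_compose by fastforce
  qed
  have real: "pgf p (of_real x) = of_real (\<Sum>k. pmf p k * x ^ k)" "norm (pgf p (of_real x)) = (\<Sum>k. pmf p k * x ^ k)" if "0 \<le> x" "x \<le> 1" for x
  proof -
    have "summable (\<lambda>k. pmf p k * x ^ k)"
      using pgf_sums(2)[of "of_real x" p] that by (simp add: norm_mult norm_power)
    moreover have "(\<lambda>k. of_real (pmf p k) * of_real x ^ k) = (\<lambda>k. complex_of_real (pmf p k * x ^ k))" by simp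
    ultimately show 1: "pgf p (of_real x) = of_real (\<Sum>k. pmf p k * x ^ k)" unfolding pgf_def
      using suminf_of_real by metis
    have "(\<Sum>k. pmf p k * x ^ k) \<ge> 0" using \<open>summable _\<close> that by (intro suminf_nonneg) auto
    thus "norm (pgf p (of_real x)) = (\<Sum>k. pmf p k * x ^ k)" unfolding 1 by simp
  qed
  define b where "b = (\<lambda>n. ((\<Sum>k. pmf p k * s n ^ k) - 1) / (s n - 1))"
  have qb: "q n = of_real (b n)" for n
    unfolding q_def b_def using real(1)[of "s n"] s[of n] by simp
  have "(\<lambda>n. Im (q n)) \<longlonglongrightarrow> Im (deriv (pgf p) 1)" "(\<lambda>n. Re (q n)) \<longlonglongrightarrow> Re (deriv (pgf p) 1)"
    using \<open>q \<longlonglongrightarrow> _\<close> by (auto intro: tendsto_Im tendsto_Re)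
  hence lims: "(\<lambda>n. 0) \<longlonglongrightarrow> Im (deriv (pgf p) 1)" "b \<longlonglongrightarrow> Re (deriv (pgf p) 1)" by (auto simp: qb)
  from lims(1) have "Im (deriv (pgf p) 1) = 0" by (simp add: LIMSEQ_const_iff)
  thus "deriv (pgf p) 1 = of_real (gw_E p)" by (simp add: gw_E_def complex_eq_iff)
  have "b n \<ge> 1 + (1 - pmf p 1) * s n" for n
  proof -
    have "(\<Sum>k. pmf p k * s n ^ k) \<le> s n * (pmf p 1 + (1 - pmf p 1) * s n)"
      using norm_pgf_le[OF p0, of "of_real (s n)"] real(2)[of "s n"] s[of n] by (simp del: of_real_eq_iff)
    hence "1 - (\<Sum>k. pmf p k * s n ^ k) \<ge> 1 - s n * (pmf p 1 + (1 - pmf p 1) * s n)" by simp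
    also have "1 - s n * (pmf p 1 + (1 - pmf p 1) * s n) = (1 + (1 - pmf p 1) * s n) * (1 - s n)"
      by (simp add: algebra_simps)
    finally have "1 + (1 - pmf p 1) * s n \<le> (1 - (\<Sum>k. pmf p k * s n ^ k)) / (1 - s n)"
      using s[of n] by (simp add: pos_le_divide_eq)
    also have "\<dots> = b n" unfolding b_def by (metis minus_diff_eq minus_divide_divide)
    finally show ?thesis .
  qed
  moreover have "(\<lambda>n. 1 + (1 - pmf p 1) * s n) \<longlonglongrightarrow> 1 + (1 - pmf p 1) * 1" by (intro tendsto_intros slim)
  ultimately have "1 + (1 - pmf p 1) * 1 \<le> Re (deriv (pgf p) 1)" using lims(2) by (intro LIMSEQ_le) auto
  thus "gw_E p > 1" using p1 by (simp add: gw_E_def)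
qed

section \<open>The function \<open>\<Pi>\<close> on a sector\<close>

text \<open>
  For \<open>\<kappa> = tan \<epsilon>\<close> with \<open>0 < \<epsilon> < \<pi>/2\<close> this is the open sector of all \<open>z \<noteq> 0\<close> with \<open>|arg z| < \<pi>/2 + \<epsilon>\<close>.
\<close>
definition sector :: "real \<Rightarrow> complex set" where
  "sector \<kappa> = {z. Re z > - \<kappa> * \<bar>Im z\<bar>}"

lemma open_sector: "open (sector \<kappa>)"
  unfolding sector_def by (intro open_Collect_less continuous_intros)

lemma sector_scale: "c > 0 \<Longrightarrow> of_real c * z \<in> sector \<kappa> \<longleftrightarrow> z \<in> sector \<kappa>"
proof -
  assume c: "c > 0"
  have "- \<kappa> * \<bar>Im (of_real c * z)\<bar> = c * (- \<kappa> * \<bar>Im z\<bar>)" using c by (simp add: abs_mult)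
  moreover have "Re (of_real c * z) = c * Re z" by simp
  ultimately show ?thesis unfolding sector_def using c by (simp only: mem_Collect_eq mult_less_cancel_left_pos)
qed

lemma sector_scale_div: "c > 0 \<Longrightarrow> z / of_real c \<in> sector \<kappa> \<longleftrightarrow> z \<in> sector \<kappa>"
  using sector_scale[of "inverse c" z \<kappa>] by (simp add: field_simps)

lemma sector_nonzero: "z \<in> sector \<kappa> \<Longrightarrow> z \<noteq> 0"
  by (auto simp: sector_def)

lemma halfplane_sector: "\<kappa> > 0 \<Longrightarrow> Re z \<ge> 0 \<Longrightarrow> z \<noteq> 0 \<Longrightarrow> z \<in> sector \<kappa>"
  unfolding sector_def by (cases "Im z = 0") (auto simp: complex_eq_iff intro: less_le_trans[of _ 0])

locale gw_immigration =
  fixes p q :: "nat pmf"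
  assumes p0: "pmf p 0 = 0" and p1_pos: "0 < pmf p 1" and p1_less: "pmf p 1 < 1" and q0_nz: "pmf q 0 \<noteq> 0"
    and an_p: "pgf p analytic_on {1}" and an_q: "pgf q analytic_on {1}"
begin

abbreviation "P \<equiv> pgf p"
abbreviation "Q \<equiv> pgf q"
abbreviation "E \<equiv> gw_E p"
abbreviation "p1 \<equiv> pmf p 1"
abbreviation "q0 \<equiv> pmf q 0"
abbreviation "Pf \<equiv> gw_Pi p"

lemma E_gt_1: "E > 1" and deriv_P_1: "deriv P 1 = of_real E"
  using gw_E_props[OF p0 p1_less an_p] by auto

lemma E_pos: "E > 0" using E_gt_1 by simp

lemma q0_pos: "q0 > 0" using q0_nz pmf_nonneg[of q 0] by linarith

lemma q0_le_1: "q0 \<le> 1" by (rule pmf_le_1)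

text \<open>
  The limit operator is total, so the value of \<open>\<Pi>\<close> alone does not tell whether its defining sequence
  converges.
\<close>
definition conv_at :: "complex \<Rightarrow> complex \<Rightarrow> bool" where
  "conv_at z L \<longleftrightarrow> (\<lambda>t. (P ^^ t) (1 - z / of_real E ^ t)) \<longlonglongrightarrow> L"

lemma conv_at_imp_Pf: "conv_at z L \<Longrightarrow> Pf z = L"
  unfolding conv_at_def gw_Pi_def by (rule limI)

lemma norm_P_less_1: "norm w < 1 \<Longrightarrow> norm (P w) < 1"
proof -
  assume w: "norm w < 1"
  have "norm (P w) \<le> norm w * (p1 + (1 - p1) * norm w)" using norm_pgf_le[OF p0, of w] w by simp
  also have "\<dots> \<le> norm w * (p1 + (1 - p1) * 1)" using w p1_less by (intro mult_left_mono add_left_mono) auto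
  also have "\<dots> < 1" using w by simp
  finally show ?thesis .
qed

lemma iterate_le_1: "norm w \<le> 1 \<Longrightarrow> norm ((P ^^ t) w) \<le> 1"
  by (induction t) (auto intro: norm_pgf_le_1)

lemma conv_at_step:
  assumes R: "P holomorphic_on ball 0 R" and c: "conv_at z L" and L: "norm L < R"
  shows "conv_at (of_real E * z) (P L)"
proof -
  have "isCont P L" using holomorphic_on_imp_continuous_on[OF R] L
    by (simp add: continuous_on_eq_continuous_at)
  from isCont_tendsto_compose[OF this c[unfolded conv_at_def]]
  have "(\<lambda>t. (P ^^ Suc t) (1 - of_real E * z / of_real E ^ Suc t)) \<longlonglongrightarrow> P L"
    using E_pos by simp
  thus ?thesis unfolding conv_at_def by (rule filterlim_sequentially_Suc[THEN iffD1])
qed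

end

text \<open>
  The domain of \<open>\<Pi>\<close> used below: a disc around 0 together with a sector containing the closed right
  half-plane without 0.  In the disc \<open>\<Pi>\<close> may leave the unit disc, but not the disc of
  radius \<open>R\<close> on which both generating functions are holomorphic.
\<close>
locale gw_sector = gw_immigration +
  fixes R \<rho> \<kappa> :: real
  assumes R: "R > 1" "P holomorphic_on ball 0 R" "Q holomorphic_on ball 0 R"
    and rho: "\<rho> > 0" and kappa: "\<kappa> > 0"
    and conv: "\<And>z. z \<in> ball 0 \<rho> \<union> sector \<kappa> \<Longrightarrow> conv_at z (Pf z)"
    and Pf_hol: "Pf holomorphic_on ball 0 \<rho> \<union> sector \<kappa>"
    and Pf_R: "\<And>z. z \<in> ball 0 \<rho> \<union> sector \<kappa> \<Longrightarrow> norm (Pf z) < R"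
    and Pf_less_1: "\<And>z. z \<in> sector \<kappa> \<Longrightarrow> norm z \<ge> \<rho> / E \<Longrightarrow> norm (Pf z) < 1"
    and Pf_half: "\<And>z. Re z \<ge> 0 \<Longrightarrow> z \<noteq> 0 \<Longrightarrow> norm (Pf z) < 1"
    and Pf_0: "Pf 0 = 1"

context gw_immigration
begin

text \<open>
  Near 0, \<open>\<Pi>\<close> is the Koenigs function of \<open>P\<close> at 1.  For \<open>Re z \<ge> 0\<close> the point \<open>1 - z/E\<^sup>t\<close> exceeds the unit disc by
  at most \<open>O(E\<^bsup>-2t\<^esup>)\<close> and \<open>P\<^sup>t\<close> stretches distances by \<open>O(E\<^sup>t)\<close>, so \<open>|\<Pi>(z)| \<le> 1\<close>.  If \<open>|\<Pi>(z)| = 1\<close>, then \<open>\<Pi>(z/E)\<close> is a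
  root of unity of fixed order, which for small \<open>z \<noteq> 0\<close> contradicts the local injectivity of a power of
  \<open>\<Pi>\<close>.  Thus \<open>|\<Pi>| < 1\<close> on a compact half-annulus, hence on the same annulus in a slightly larger sector, and
  \<open>\<Pi>(E z) = P(\<Pi>(z))\<close> carries convergence, holomorphy and the bound outwards.
\<close>
theorem gw_sector_exists: "\<exists>R \<rho> \<kappa>. gw_sector p q R \<rho> \<kappa>"
proof -
  obtain Rp where Rp: "Rp > 1" "P holomorphic_on ball 0 Rp" using pgf_analytic_radius[OF an_p] .
  obtain Rq where Rq: "Rq > 1" "Q holomorphic_on ball 0 Rq" using pgf_analytic_radius[OF an_q] .
  define R where "R = min Rp Rq"
  have R: "R > 1" "P holomorphic_on ball 0 R" "Q holomorphic_on ball 0 R"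
    using Rp Rq by (auto simp: R_def intro: holomorphic_on_subset)
  have PR1: "P holomorphic_on ball 1 (R - 1)"
  proof (rule holomorphic_on_subset[OF R(2)])
    show "ball 1 (R - 1) \<subseteq> ball (0::complex) R"
    proof
      fix w :: complex assume "w \<in> ball 1 (R - 1)"
      hence "norm (w - 1) < R - 1" by (simp add: dist_norm norm_minus_commute)
      moreover have "norm w \<le> norm (w - 1) + norm (1::complex)" by (metis diff_add_cancel norm_triangle_ineq)
      ultimately show "w \<in> ball 0 R" by simp
    qed
  qed
  have "R - 1 > 0" using R by simp
  obtain \<rho>0 C Pl where rho0: "\<rho>0 > 0" and C: "C > 0" and Pl: "Pl holomorphic_on ball 0 \<rho>0" "Pl 0 = 1" "deriv Pl 0 = -1"
    and Pl_conv: "\<And>z. z \<in> ball 0 \<rho>0 \<Longrightarrow> (\<lambda>t. (P ^^ t) (1 - z / of_real E ^ t)) \<longlonglongrightarrow> Pl z"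
    and lip: "\<And>t u v. norm u \<le> \<rho>0 / E ^ t \<Longrightarrow> norm v \<le> \<rho>0 / E ^ t \<Longrightarrow> norm ((P ^^ t) (1 + u) - (P ^^ t) (1 + v)) \<le> C * E ^ t * norm (u - v)"
    by (rule koenigs_repelling[OF PR1 \<open>R - 1 > 0\<close> pgf_one deriv_P_1 E_gt_1]) (rule that, assumption+)
  have Pl_conv': "conv_at z (Pl z)" if "z \<in> ball 0 \<rho>0" for z using Pl_conv[OF that] by (simp add: conv_at_def)
  obtain j where j: "pmf p (Suc (Suc j)) > 0"
  proof -
    have "\<exists>j. pmf p (Suc (Suc j)) > 0"
    proof (rule ccontr)
      assume "\<not> ?thesis"
      hence "pmf p (Suc (Suc j)) = 0" for j using pmf_nonneg[of p "Suc (Suc j)"] by (metis less_eq_real_def)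
      hence "pmf p k = 0" if "k \<notin> {1}" for k using that p0 by (cases k; cases "k - 1") auto
      hence "pmf p sums (\<Sum>k\<in>{1}. pmf p k)" by (intro sums_finite) auto
      with pmf_nat_sums_one[of p] have "p1 = 1" by (simp add: sums_iff)
      thus False using p1_less by simp
    qed
    thus ?thesis using that by blast
  qed
  \<comment> \<open>A power of \<open>\<Pi>\<close>, so that one use of injectivity excludes all roots of unity of this order.\<close>
  define g where "g = (\<lambda>z. Pl z ^ Suc j)"
  have g: "g holomorphic_on ball 0 \<rho>0" unfolding g_def by (intro holomorphic_intros Pl)
  have dPl: "(Pl has_field_derivative -1) (at 0)" using holomorphic_derivI[OF Pl(1), of 0] rho0 Pl(3) by simp
  from dPl have "(g has_field_derivative (of_nat (Suc j) * (-1 * Pl 0 ^ j))) (at 0)"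
    unfolding g_def by (intro DERIV_power_Suc[THEN DERIV_cong]) (auto simp: algebra_simps)
  hence dg: "deriv g 0 = - of_nat (Suc j)" using Pl(2) by (intro DERIV_imp_deriv) simp
  have z0: "(0::complex) \<in> ball 0 \<rho>0" using rho0 by simp
  have dg0: "deriv g 0 \<noteq> 0" unfolding dg neg_equal_0_iff_equal of_nat_eq_0_iff by simp
  obtain r1 where r1: "r1 > 0" "ball (0::complex) r1 \<subseteq> ball 0 \<rho>0" "inj_on g (ball 0 r1)"
    by (rule has_complex_derivative_locally_injective[OF g z0 open_ball dg0]) (rule that, assumption+)
  have nroot: "Pl z ^ Suc j \<noteq> 1" if "z \<noteq> 0" "norm z < r1" for z
  proof
    assume "Pl z ^ Suc j = 1"
    hence "g z = g 0" using Pl(2) by (simp add: g_def)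
    with inj_onD[OF r1(3) this] that r1(1) show False by simp
  qed
  have "isCont Pl 0" using dPl by (rule DERIV_isCont)
  from this[unfolded continuous_at_eps_delta, rule_format, OF \<open>R - 1 > 0\<close>]
  obtain r2 where r2': "r2 > 0" "\<forall>z. dist z 0 < r2 \<longrightarrow> dist (Pl z) (Pl 0) < R - 1" by blast
  have r2: "norm (Pl z - 1) < R - 1" if "norm z < r2" for z
  proof -
    have "dist z 0 < r2" using that by simp
    from r2'(2)[rule_format, OF this] show ?thesis unfolding Pl(2) dist_norm .
  qed
  note r2 = r2'(1) r2
  define r where "r = min (\<rho>0 / 2) (min r1 r2)"
  have r: "r > 0" "r \<le> \<rho>0/2" "r \<le> r1" "r \<le> r2" using rho0 r1 r2 by (auto simp: r_def)
  have PlR: "norm (Pl z) < R" if "norm z < r" for z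
  proof -
    have "norm (Pl z) \<le> norm (Pl z - 1) + norm (1::complex)" by (metis diff_add_cancel norm_triangle_ineq)
    thus ?thesis using r2(2)[of z] that r by simp
  qed
  have le1: "norm (Pl z) \<le> 1" if z: "norm z < r" "Re z \<ge> 0" for z
  proof -
    have b: "norm ((P ^^ t) (1 - z / of_real E ^ t)) \<le> 1 + C * (norm z)\<^sup>2 * (1/E) ^ t" for t
    proof -
      define v where "v = 1 - z / of_real E ^ t"
      define n where "n = norm v"
      have Et: "E ^ t > 0" using E_pos by simp
      have nv: "norm (v - 1) = norm z / E ^ t" using E_pos by (simp add: v_def norm_divide norm_power)
      have n2: "n\<^sup>2 \<le> 1 + (norm z / E ^ t)\<^sup>2"
      proof -
        have "Re (z / of_real E ^ t) = Re z / E ^ t" by (metis Re_divide_of_real of_real_power)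
        hence "Re (v - 1) \<le> 0" using z Et by (simp add: v_def)
        moreover have "n\<^sup>2 = 1 + 2 * Re (v - 1) + (norm (v - 1))\<^sup>2"
          unfolding n_def cmod_power2 by (simp add: power2_eq_square algebra_simps)
        ultimately show ?thesis unfolding nv by simp
      qed
      show ?thesis
      proof (cases "n \<le> 1")
        case True
        hence "norm ((P ^^ t) v) \<le> 1" unfolding n_def by (rule iterate_le_1)
        moreover have "C * (norm z)\<^sup>2 * (1/E) ^ t \<ge> 0" using C E_pos by simp
        ultimately show ?thesis by (simp add: v_def)
      next
        case False
        \<comment> \<open>Compare with the radial projection of \<open>v\<close> to the unit circle, whose orbit stays in the closed disc.\<close>
        define v' where "v' = v / of_real n"
        have v0: "v \<noteq> 0" using False by (auto simp: n_def)
        have nv': "norm v' = 1" using v0 by (simp add: v'_def n_def norm_divide)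
        have "v - v' = v' * of_real (n - 1)" using False by (simp add: v'_def field_simps)
        hence d: "norm (v - v') = n - 1" using False nv' by (simp only: norm_mult norm_of_real) simp
        have "n * n - 1 \<le> (norm z / E ^ t)\<^sup>2" using n2 by (simp add: power2_eq_square)
        moreover have "(n - 1) * 1 \<le> (n - 1) * (n + 1)" using False by (intro mult_left_mono) auto
        ultimately have n1: "n - 1 \<le> (norm z / E ^ t)\<^sup>2" by (simp add: algebra_simps)
        have "n \<le> norm (v - 1) + norm (1::complex)" unfolding n_def by (metis diff_add_cancel norm_triangle_ineq)
        hence "norm (v - v') \<le> norm (v - 1)" using d by simp
        moreover have "norm (v' - 1) \<le> norm (v - v') + norm (v - 1)" by (metis norm_minus_commute norm_triangle_ineq diff_add_cancel add_diff_eq)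
        ultimately have "norm (v' - 1) \<le> 2 * (norm z / E ^ t)" using nv by simp
        also have "\<dots> \<le> \<rho>0 / E ^ t" using z r Et by (simp add: field_simps)
        finally have a1: "norm (v' - 1) \<le> \<rho>0 / E ^ t" .
        have a2: "norm (v - 1) \<le> \<rho>0 / E ^ t" unfolding nv using z r rho0 Et by (intro divide_right_mono) auto
        have "norm ((P ^^ t) v) \<le> norm ((P ^^ t) v') + norm ((P ^^ t) v - (P ^^ t) v')"
          by (metis norm_triangle_sub)
        also have "norm ((P ^^ t) v - (P ^^ t) v') \<le> C * E ^ t * norm (v - v')"
          using lip[OF a2 a1] by simp
        also have "\<dots> \<le> C * E ^ t * (norm z / E ^ t)\<^sup>2" unfolding d using n1 C E_pos by (intro mult_left_mono) auto
        also have "\<dots> = C * (norm z)\<^sup>2 * (1/E) ^ t" using E_pos by (simp add: power2_eq_square field_simps)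
        also have "norm ((P ^^ t) v') \<le> 1" using nv' by (intro iterate_le_1) simp
        finally show ?thesis by (simp add: v_def)
      qed
    qed
    have "(\<lambda>t. 1 + C * (norm z)\<^sup>2 * (1/E) ^ t) \<longlonglongrightarrow> 1 + C * (norm z)\<^sup>2 * 0"
      using E_gt_1 by (intro tendsto_intros LIMSEQ_power_zero) auto
    hence "norm (Pl z) \<le> 1 + C * (norm z)\<^sup>2 * 0"
      using z r rho0 by (intro LIMSEQ_le[OF tendsto_norm[OF Pl_conv]]) (use b in auto)
    thus ?thesis by simp
  qed
  have half: "norm (Pl z) < 1" if z: "norm z < r" "Re z \<ge> 0" "z \<noteq> 0" for z
  proof (rule ccontr)
    assume "\<not> norm (Pl z) < 1"
    hence n1: "norm (Pl z) = 1" using le1[of z] z by simp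
    define w where "w = Pl (z / of_real E)"
    have zE: "norm (z / of_real E) < r" "Re (z / of_real E) \<ge> 0" "z / of_real E \<noteq> 0"
    proof -
      have "norm z / E \<le> norm z / 1" using E_gt_1 by (intro divide_left_mono) auto
      thus "norm (z / of_real E) < r" using z E_pos by (simp add: norm_divide)
    qed (use z E_pos in \<open>auto simp: Re_divide_of_real\<close>)
    have w1: "norm w \<le> 1" unfolding w_def using zE by (intro le1)
    have "conv_at (of_real E * (z / of_real E)) (P w)"
      unfolding w_def using zE r rho0 PlR[of "z / of_real E"] by (intro conv_at_step[OF R(2)] Pl_conv') auto
    hence "conv_at z (P w)" using E_pos by simp
    moreover have "conv_at z (Pl z)" using z r rho0 by (intro Pl_conv') auto
    ultimately have Pw: "P w = Pl z" using conv_at_imp_Pf by metis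
    have "norm w = 1"
    proof (rule ccontr)
      assume "norm w \<noteq> 1"
      hence "norm w < 1" using w1 by simp
      from norm_P_less_1[OF this] show False using Pw n1 by simp
    qed
    hence "w ^ Suc j = 1" using Pw n1 by (intro pgf_unimodular_imp_root_of_unity[OF p0 p1_pos j]) auto
    moreover have "norm (z / of_real E) < r1" using zE r by simp
    ultimately show False using nroot[OF zE(3)] unfolding w_def by blast
  qed
  define \<rho> where "\<rho> = r / 2"
  have rho: "\<rho> > 0" "\<rho> < r" using r by (auto simp: \<rho>_def)
  have rhoE: "\<rho> / E < \<rho>" "\<rho> / E > 0" using rho E_gt_1 by (auto simp: field_simps)
  have Pf_Pl: "Pf z = Pl z" if "norm z < r" for z
    using conv_at_imp_Pf[OF Pl_conv'] that r rho0 by auto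
  obtain \<kappa> where kappa: "\<kappa> > 0" "\<And>z. z \<in> sector \<kappa> \<Longrightarrow> \<rho> / E \<le> norm z \<Longrightarrow> norm z \<le> \<rho> \<Longrightarrow> norm (Pl z) < 1"
  proof -
    \<comment> \<open>The points of the annulus to be avoided; they have real part at most that of \<open>m\<close>, which is negative.\<close>
    define K where "K = {z \<in> cball 0 \<rho> - ball 0 (\<rho> / E). norm (Pl z) \<ge> 1}"
    have "continuous_on (cball 0 \<rho> - ball 0 (\<rho> / E)) (\<lambda>z. norm (Pl z))"
      by (intro continuous_intros continuous_on_subset[OF holomorphic_on_imp_continuous_on[OF Pl(1)]]) (use rho r rho0 in auto)
    from continuous_closed_preimage[OF this closed_Diff[OF closed_cball open_ball] closed_atLeast[of "1::real"]]
    have "closed K" by (simp add: K_def vimage_def Int_def)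
    moreover have "bounded K" by (rule bounded_subset[OF bounded_cball[of 0 \<rho>]]) (auto simp: K_def)
    ultimately have K: "compact K" by (simp add: compact_eq_bounded_closed)
    have Kneg: "Re z < 0" if "z \<in> K" for z
      using half[of z] that rho rhoE by (force simp: K_def)
    show ?thesis
    proof (cases "K = {}")
      case True
      show ?thesis
      proof (rule that[of 1])
        fix z :: complex assume "\<rho> / E \<le> norm z" "norm z \<le> \<rho>"
        moreover have "z \<notin> K" using True by simp
        ultimately show "norm (Pl z) < 1" by (simp add: K_def not_le)
      qed simp
    next
      case False
      have "continuous_on K Re" by (intro continuous_intros)
      then obtain m where m: "m \<in> K" "\<And>z. z \<in> K \<Longrightarrow> Re z \<le> Re m"
        using continuous_attains_sup[OF K False, of Re] by blast
      have m0: "Re m < 0" by (rule Kneg[OF m(1)])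
      show ?thesis
      proof (rule that)
        define \<kappa> where "\<kappa> = - Re m / (2 * \<rho>)"
        show k0: "\<kappa> > 0" unfolding \<kappa>_def using m0 rho by (intro divide_pos_pos) auto
        fix z assume z: "z \<in> sector \<kappa>" "\<rho> / E \<le> norm z" "norm z \<le> \<rho>"
        show "norm (Pl z) < 1"
        proof (rule ccontr)
          assume "\<not> norm (Pl z) < 1"
          hence "z \<in> K" using z by (auto simp: K_def)
          hence "Re z \<le> Re m" by (rule m(2))
          moreover have "\<kappa> * \<bar>Im z\<bar> \<le> \<kappa> * \<rho>"
            using abs_Im_le_cmod[of z] z k0 by (intro mult_left_mono) auto
          moreover have "\<kappa> * \<rho> = - Re m / 2" using rho by (simp add: \<kappa>_def)
          moreover have "Re z > - (\<kappa> * \<bar>Im z\<bar>)" using z(1) unfolding sector_def by simp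
          ultimately show False using m0 by linarith
        qed
      qed
    qed
  qed
  have main: "conv_at z (Pf z) \<and> norm (Pf z) < R \<and> (\<rho> / E \<le> norm z \<longrightarrow> norm (Pf z) < 1)"
    if "z \<in> sector \<kappa>" "norm z < \<rho> * E ^ k" for z k
    using that
  proof (induction k arbitrary: z)
    case 0
    thus ?case using Pl_conv'[of z] Pf_Pl[of z] PlR[of z] kappa(2)[of z] rho r rho0 by auto
  next
    case (Suc k)
    show ?case
    proof (cases "norm z \<le> \<rho>")
      case True
      thus ?thesis using Pl_conv'[of z] Pf_Pl[of z] PlR[of z] kappa(2)[of z] rho r rho0 Suc.prems by auto
    next
      case False
      have nz: "norm (z / of_real E) = norm z / E" using E_pos by (simp add: norm_divide)
      have "z / of_real E \<in> sector \<kappa>" using Suc.prems E_pos by (simp add: sector_scale_div)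
      moreover have "norm (z / of_real E) < \<rho> * E ^ k" unfolding nz using Suc.prems E_pos by (simp add: field_simps)
      moreover have "\<rho> / E \<le> norm (z / of_real E)" unfolding nz using False E_pos by (intro divide_right_mono) auto
      ultimately have IH: "conv_at (z / of_real E) (Pf (z / of_real E))" "norm (Pf (z / of_real E)) < 1"
        using Suc.IH[of "z / of_real E"] by auto
      have "conv_at (of_real E * (z / of_real E)) (P (Pf (z / of_real E)))"
        by (rule conv_at_step[OF R(2) IH(1)]) (use IH(2) R in auto)
      hence c: "conv_at z (P (Pf (z / of_real E)))" using E_pos by simp
      have "norm (P (Pf (z / of_real E))) < 1" by (rule norm_P_less_1[OF IH(2)])
      thus ?thesis using c conv_at_imp_Pf[OF c] R by auto
    qed
  qed
  have ex_k: "\<exists>k. norm z < \<rho> * E ^ k" for z :: complex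
  proof -
    obtain k where "norm z / \<rho> < E ^ k" using real_arch_pow[OF E_gt_1] by blast
    thus ?thesis using rho by (intro exI[of _ k]) (simp add: field_simps)
  qed
  have sec: "conv_at z (Pf z)" "norm (Pf z) < R" "\<rho> / E \<le> norm z \<Longrightarrow> norm (Pf z) < 1" if "z \<in> sector \<kappa>" for z
    using main[OF that] ex_k[of z] by blast+
  have hol0: "Pf holomorphic_on ball 0 \<rho>"
  proof -
    have "Pl holomorphic_on ball 0 \<rho>" using Pl(1) by (rule holomorphic_on_subset) (use rho r rho0 in auto)
    thus ?thesis by (rule holomorphic_transform) (use Pf_Pl rho in auto)
  qed
  have holk: "Pf holomorphic_on ball 0 \<rho> \<union> (sector \<kappa> \<inter> ball 0 (\<rho> * E ^ k))" for k
  proof (induction k)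
    case 0
    have "ball 0 \<rho> \<union> (sector \<kappa> \<inter> ball 0 (\<rho> * E ^ 0)) = ball 0 \<rho>" by auto
    thus ?case using hol0 by simp
  next
    case (Suc k)
    have "Pf holomorphic_on sector \<kappa> \<inter> ball 0 (\<rho> * E ^ Suc k)"
    proof -
      have "P \<circ> (Pf \<circ> (\<lambda>z. z / of_real E)) holomorphic_on sector \<kappa> \<inter> ball 0 (\<rho> * E ^ Suc k)"
      proof (rule holomorphic_on_compose_gen[OF holomorphic_on_compose_gen[OF _ Suc.IH] R(2)])
        show "(\<lambda>z. z / of_real E) holomorphic_on sector \<kappa> \<inter> ball 0 (\<rho> * E ^ Suc k)"
          using E_pos by (intro holomorphic_intros) auto
        have s: "z / of_real E \<in> sector \<kappa> \<inter> ball 0 (\<rho> * E ^ k)" if "z \<in> sector \<kappa> \<inter> ball 0 (\<rho> * E ^ Suc k)" for z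
          using that E_pos by (simp add: sector_scale_div norm_divide field_simps)
        thus "(\<lambda>z. z / of_real E) ` (sector \<kappa> \<inter> ball 0 (\<rho> * E ^ Suc k)) \<subseteq> ball 0 \<rho> \<union> (sector \<kappa> \<inter> ball 0 (\<rho> * E ^ k))"
          by blast
        show "(Pf \<circ> (\<lambda>z. z / of_real E)) ` (sector \<kappa> \<inter> ball 0 (\<rho> * E ^ Suc k)) \<subseteq> ball 0 R"
          using s sec(2) by (auto simp: o_def)
      qed
      moreover have "(P \<circ> (Pf \<circ> (\<lambda>z. z / of_real E))) z = Pf z" if "z \<in> sector \<kappa> \<inter> ball 0 (\<rho> * E ^ Suc k)" for z
      proof -
        have "z / of_real E \<in> sector \<kappa>" using that E_pos by (simp add: sector_scale_div)
        from conv_at_step[OF R(2) sec(1,2)[OF this]] have "conv_at z (P (Pf (z / of_real E)))" using E_pos by simp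
        from conv_at_imp_Pf[OF this] show ?thesis by simp
      qed
      ultimately show ?thesis by (rule holomorphic_transform)
    qed
    thus ?case using hol0 by (intro holomorphic_on_Un open_Int open_sector open_ball)
  qed
  have "gw_sector p q R \<rho> \<kappa>"
  proof unfold_locales
    show "Pf holomorphic_on ball 0 \<rho> \<union> sector \<kappa>"
      unfolding holomorphic_on_open[OF open_Un[OF open_ball open_sector]]
    proof
      fix z assume z: "z \<in> ball 0 \<rho> \<union> sector \<kappa>"
      obtain k where k: "norm z < \<rho> * E ^ k" using ex_k by blast
      have o: "open (ball 0 \<rho> \<union> (sector \<kappa> \<inter> ball 0 (\<rho> * E ^ k)))" by (intro open_Un open_Int open_sector open_ball)
      show "\<exists>f'. (Pf has_field_derivative f') (at z)"
        using holk[of k] z k unfolding holomorphic_on_open[OF o] by auto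
    qed
    show "conv_at z (Pf z)" if "z \<in> ball 0 \<rho> \<union> sector \<kappa>" for z
      using that sec(1) Pl_conv'[of z] Pf_Pl[of z] rho r rho0 by auto
    show "norm (Pf z) < R" if "z \<in> ball 0 \<rho> \<union> sector \<kappa>" for z
      using that sec(2) PlR[of z] Pf_Pl[of z] rho by auto
    show "norm (Pf z) < 1" if "Re z \<ge> 0" "z \<noteq> 0" for z
    proof (cases "norm z < r")
      case True
      thus ?thesis using half that Pf_Pl by simp
    next
      case False
      thus ?thesis using sec(3)[OF halfplane_sector[OF kappa(1) that]] rhoE rho by simp
    qed
    show "Pf 0 = 1" using Pf_Pl[of 0] Pl(2) r by simp
  qed (use R rho kappa sec in auto)
  thus ?thesis by blast
qed

end

section \<open>The functions \<open>\<Phi>\<close>, \<open>\<Psi>\<close> and \<open>R\<close>\<close>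

text \<open>
  The difference quotient at \<open>a\<close> extends holomorphically to \<open>S\<close> and is bounded on \<open>K\<close>.
\<close>
lemma holomorphic_lipschitz_at:
  assumes f: "f holomorphic_on S" and S: "open S" and K: "compact K" "K \<subseteq> S"
  obtains C where "C > 0" "\<And>v. v \<in> K \<Longrightarrow> norm (f v - f a) \<le> C * norm (v - a)"
proof -
  define A where "A = (\<lambda>w. if w = a then deriv f a else (f w - f a) / (w - a))"
  have A: "A holomorphic_on S" unfolding A_def using f S by (intro pole_lemma_open)
  have "compact (A ` K)"
    using K by (intro compact_continuous_image holomorphic_on_imp_continuous_on[OF holomorphic_on_subset[OF A]])
  then obtain C where C: "C > 0" "\<And>w. w \<in> K \<Longrightarrow> norm (A w) \<le> C"
    using compact_imp_bounded[of "A ` K"] unfolding bounded_pos by auto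
  have "norm (f v - f a) \<le> C * norm (v - a)" if "v \<in> K" for v
  proof -
    have "f v - f a = A v * (v - a)" by (simp add: A_def)
    thus ?thesis using C(2)[OF that] by (simp add: norm_mult mult_right_mono)
  qed
  with C(1) that show ?thesis by blast
qed

lemma prodinf_shift:
  fixes f :: "nat \<Rightarrow> complex"
  assumes "convergent_prod (\<lambda>n. f (Suc n))"
  shows "convergent_prod f" "prodinf f = f 0 * (\<Prod>n. f (Suc n))"
proof -
  show c: "convergent_prod f" using assms convergent_prod_iff_shift[of f 1] by simp
  have "(\<lambda>N. \<Prod>k<Suc N. f k) \<longlonglongrightarrow> prodinf f"
    by (rule LIMSEQ_Suc) (rule convergent_prod_LIMSEQ_less[OF c])
  moreover have "(\<Prod>k<Suc N. f k) = f 0 * (\<Prod>k<N. f (Suc k))" for N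
    by (rule prod.lessThan_Suc_shift)
  moreover have "(\<lambda>N. f 0 * (\<Prod>k<N. f (Suc k))) \<longlonglongrightarrow> f 0 * (\<Prod>n. f (Suc n))"
    by (intro tendsto_intros convergent_prod_LIMSEQ_less[OF assms])
  ultimately show "prodinf f = f 0 * (\<Prod>n. f (Suc n))" by (auto intro: LIMSEQ_unique)
qed

context gw_immigration
begin

lemma iterate_zero [simp]: "(P ^^ t) 0 = 0"
  by (induction t) (auto simp: p0)

lemma iterate_ball: "z \<in> ball 0 1 \<Longrightarrow> (P ^^ t) z \<in> ball 0 1"
  by (induction t) (auto intro: norm_P_less_1)

lemma iterate_holomorphic: "(P ^^ t) holomorphic_on ball 0 1"
proof (induction t)
  case 0
  show ?case by (simp add: id_def)
next
  case (Suc t)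
  have "P \<circ> (P ^^ t) holomorphic_on ball 0 1"
    by (rule holomorphic_on_compose_gen[OF Suc pgf_holomorphic_unit]) (use iterate_ball in blast)
  thus ?case unfolding funpow.simps(2) .
qed

lemma iterate_decay:
  assumes "norm z \<le> r" "r < 1"
  shows "norm ((P ^^ t) z) \<le> (p1 + (1 - p1) * r) ^ t * norm z" "norm ((P ^^ t) z) \<le> r"
proof -
  have r0: "r \<ge> 0" using assms norm_ge_zero order_trans by blast
  have l: "0 \<le> p1 + (1 - p1) * r" "p1 + (1 - p1) * r \<le> 1"
  proof -
    show "0 \<le> p1 + (1 - p1) * r" using r0 p1_pos p1_less by simp
    have "(1 - p1) * r \<le> (1 - p1) * 1" using assms p1_less by (intro mult_left_mono) auto
    thus "p1 + (1 - p1) * r \<le> 1" by simp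
  qed
  have "norm ((P ^^ t) z) \<le> (p1 + (1 - p1) * r) ^ t * norm z \<and> norm ((P ^^ t) z) \<le> r"
  proof (induction t)
    case (Suc t)
    have "norm (P ((P ^^ t) z)) \<le> norm ((P ^^ t) z) * (p1 + (1 - p1) * norm ((P ^^ t) z))"
      using Suc assms by (intro norm_pgf_le[OF p0]) auto
    also have "\<dots> \<le> norm ((P ^^ t) z) * (p1 + (1 - p1) * r)"
      using Suc p1_less by (intro mult_left_mono add_left_mono) auto
    finally have *: "norm (P ((P ^^ t) z)) \<le> norm ((P ^^ t) z) * (p1 + (1 - p1) * r)" .
    have "norm ((P ^^ t) z) * (p1 + (1 - p1) * r) \<le> ((p1 + (1 - p1) * r) ^ t * norm z) * (p1 + (1 - p1) * r)"
      using Suc l by (intro mult_right_mono) auto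
    moreover have "norm ((P ^^ t) z) * (p1 + (1 - p1) * r) \<le> r * 1"
      using Suc l r0 by (intro mult_mono) auto
    ultimately show ?case using * by (simp add: mult_ac)
  qed (use assms in auto)
  thus "norm ((P ^^ t) z) \<le> (p1 + (1 - p1) * r) ^ t * norm z" "norm ((P ^^ t) z) \<le> r" by auto
qed

lemma contraction_rate:
  assumes "0 \<le> r" "r < 1"
  shows "0 \<le> p1 + (1 - p1) * r" "p1 + (1 - p1) * r < 1"
proof -
  show "0 \<le> p1 + (1 - p1) * r" using assms p1_pos p1_less by simp
  have "(1 - p1) * r < (1 - p1) * 1" using assms p1_less by (intro mult_strict_left_mono) auto
  thus "p1 + (1 - p1) * r < 1" by simp
qed

text \<open>
  Orbits of \<open>P\<close> in a disc of radius \<open>r < 1\<close> tend to 0 geometrically and uniformly, so the factors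
  \<open>G(P\<^sup>t(z))\<close> tend to \<open>G(0) = 1\<close> geometrically.  Both \<open>\<Psi>\<close> and, through \<open>P_quotient\<close>, \<open>\<Phi>\<close> are such products.
\<close>
lemma orbit_product:
  assumes G: "G holomorphic_on ball 0 1" "G 0 = 1"
  shows "(\<lambda>z. \<Prod>t. G ((P ^^ t) z)) holomorphic_on ball 0 1"
    and "\<And>z. z \<in> ball 0 1 \<Longrightarrow> convergent_prod (\<lambda>t. G ((P ^^ t) z))"
proof -
  have hol: "(\<lambda>z. G ((P ^^ t) z)) holomorphic_on ball 0 1" for t
  proof -
    have "G \<circ> (P ^^ t) holomorphic_on ball 0 1"
      by (rule holomorphic_on_compose_gen[OF iterate_holomorphic G(1)]) (use iterate_ball in blast)
    thus ?thesis by (simp add: o_def)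
  qed
  have bd: "\<exists>d>0. \<exists>M. cball z d \<subseteq> ball 0 1 \<and> summable M \<and> (\<forall>t. \<forall>w\<in>cball z d. norm (G ((P ^^ t) w) - 1) \<le> M t)" if z: "z \<in> ball 0 1" for z
  proof -
    define d where "d = (1 - norm z) / 2"
    define r where "r = (1 + norm z) / 2"
    have d: "d > 0" and r: "0 \<le> r" "r < 1" using z by (auto simp: d_def r_def)
    have w: "norm w \<le> r" if "w \<in> cball z d" for w
    proof -
      have "norm w \<le> norm z + norm (w - z)" by (rule norm_triangle_sub)
      moreover have "norm (w - z) \<le> d" using that by (simp add: dist_norm norm_minus_commute)
      ultimately show ?thesis by (simp add: d_def r_def field_simps)
    qed
    have cb: "cball z d \<subseteq> ball 0 1" using w r by (force simp: subset_iff)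
    have cr: "cball 0 r \<subseteq> ball (0::complex) 1" using r by auto
    obtain C where C: "C > 0" "\<And>v. v \<in> cball 0 r \<Longrightarrow> norm (G v - G 0) \<le> C * norm (v - 0)"
      using holomorphic_lipschitz_at[OF G(1) open_ball compact_cball cr] by blast
    define l where "l = p1 + (1 - p1) * r"
    have l: "0 \<le> l" "l < 1" unfolding l_def using contraction_rate[OF r] by auto
    have "norm (G ((P ^^ t) w) - 1) \<le> C * l ^ t" if "w \<in> cball z d" for t w
    proof -
      have "norm (G ((P ^^ t) w) - 1) \<le> C * norm ((P ^^ t) w)"
        using C(2)[of "(P ^^ t) w"] iterate_decay(2)[OF w[OF that] r(2)] G(2) by simp
      also have "norm ((P ^^ t) w) \<le> l ^ t * norm w" unfolding l_def by (rule iterate_decay(1)[OF w[OF that] r(2)])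
      also have "\<dots> \<le> l ^ t * 1" using w[OF that] r l by (intro mult_left_mono) auto
      finally show ?thesis using C by (simp add: mult_left_mono)
    qed
    moreover have "summable (\<lambda>t. C * l ^ t)" using l by (intro summable_mult summable_geometric) auto
    ultimately show ?thesis using d cb by blast
  qed
  show "(\<lambda>z. \<Prod>t. G ((P ^^ t) z)) holomorphic_on ball 0 1"
    by (rule holomorphic_prodinf(1)[OF open_ball hol bd])
  show "convergent_prod (\<lambda>t. G ((P ^^ t) z))" if "z \<in> ball 0 1" for z
    by (rule holomorphic_prodinf(2)[OF open_ball hol bd that])
qed

text \<open>
  \<open>P(w)/(p\<^sub>1 w)\<close> with the singularity at 0 removed; \<open>\<Phi>(z)\<close> is \<open>z\<close> times its product along the orbit of \<open>z\<close>.
\<close>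
definition P_quotient :: "complex \<Rightarrow> complex" where
  "P_quotient w = (\<Sum>k. of_real (pmf p (Suc k) / p1) * w ^ k)"

lemma P_quotient: "w \<in> ball 0 1 \<Longrightarrow> P w = of_real p1 * w * P_quotient w" "P_quotient holomorphic_on ball 0 1" "P_quotient 0 = 1"
proof -
  have sm: "(\<lambda>k. of_real (pmf p (Suc k) / p1) * w ^ k) sums P_quotient w" if "w \<in> ball 0 1" for w
  proof -
    have "summable (\<lambda>k. of_real (pmf p (Suc k) / p1) * w ^ k)"
    proof (rule summable_norm_cancel, rule summable_comparison_test)
      show "summable (\<lambda>k. pmf p (Suc k) / p1)"
        using sums_summable[OF pmf_nat_sums_one[of p]] by (intro summable_divide) (subst summable_Suc_iff)
      show "\<exists>N. \<forall>k\<ge>N. norm (norm (of_real (pmf p (Suc k) / p1) * w ^ k)) \<le> pmf p (Suc k) / p1"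
        using that p1_pos by (auto simp: norm_mult norm_power norm_divide intro!: mult_left_le power_le_one divide_right_mono)
    qed
    thus ?thesis unfolding P_quotient_def by (rule summable_sums)
  qed
  show "P w = of_real p1 * w * P_quotient w" if "w \<in> ball 0 1"
  proof -
    have "(\<lambda>k. of_real (pmf p k) * w ^ k) sums P w" using that by (intro pgf_sums) auto
    hence "(\<lambda>k. of_real (pmf p (Suc k)) * w ^ Suc k) sums P w"
      by (subst sums_Suc_iff) (simp add: p0)
    moreover have "(\<lambda>k. (of_real p1 * w) * (of_real (pmf p (Suc k) / p1) * w ^ k)) sums (of_real p1 * w * P_quotient w)"
      by (rule sums_mult[OF sm[OF that]])
    moreover have "(\<lambda>k. (of_real p1 * w) * (of_real (pmf p (Suc k) / p1) * w ^ k)) = (\<lambda>k. of_real (pmf p (Suc k)) * w ^ Suc k)"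
      using p1_pos by (auto simp: field_simps)
    ultimately show ?thesis by (metis sums_unique2)
  qed
  show "P_quotient holomorphic_on ball 0 1"
    by (rule power_series_holomorphic[where a = "\<lambda>k. of_real (pmf p (Suc k) / p1)"]) (use sm in auto)
  show "P_quotient 0 = 1" unfolding P_quotient_def powser_zero using p1_pos by simp
qed

lemma iterate_eq_product:
  assumes "z \<in> ball 0 1"
  shows "(P ^^ t) z = of_real p1 ^ t * (z * (\<Prod>k<t. P_quotient ((P ^^ k) z)))"
proof (induction t)
  case (Suc t)
  have "(P ^^ Suc t) z = of_real p1 * (P ^^ t) z * P_quotient ((P ^^ t) z)"
    using P_quotient(1)[OF iterate_ball[OF assms, of t]] by simp
  thus ?case using Suc by (simp add: mult_ac)
qed simp

lemma Phi_tendsto: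
  assumes "z \<in> ball 0 1"
  shows "(\<lambda>t. (P ^^ t) z / of_real p1 ^ t) \<longlonglongrightarrow> z * (\<Prod>k. P_quotient ((P ^^ k) z))"
proof -
  have "(P ^^ t) z / of_real p1 ^ t = z * (\<Prod>k<t. P_quotient ((P ^^ k) z))" for t
    using iterate_eq_product[OF assms, of t] p1_pos by simp
  moreover have "(\<lambda>t. z * (\<Prod>k<t. P_quotient ((P ^^ k) z))) \<longlonglongrightarrow> z * (\<Prod>k. P_quotient ((P ^^ k) z))"
    by (intro tendsto_intros convergent_prod_LIMSEQ_less orbit_product P_quotient assms)
  ultimately show ?thesis by simp
qed

lemma Phi_eq: "z \<in> ball 0 1 \<Longrightarrow> gw_Phi p z = z * (\<Prod>k. P_quotient ((P ^^ k) z))"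
  unfolding gw_Phi_def by (intro limI Phi_tendsto)

lemma Phi_lim: "z \<in> ball 0 1 \<Longrightarrow> (\<lambda>t. (P ^^ t) z / of_real p1 ^ t) \<longlonglongrightarrow> gw_Phi p z"
  using Phi_tendsto Phi_eq by simp

lemma Phi_hol: "gw_Phi p holomorphic_on ball 0 1"
proof -
  have "(\<lambda>z. z * (\<Prod>k. P_quotient ((P ^^ k) z))) holomorphic_on ball 0 1"
    by (intro holomorphic_intros orbit_product P_quotient)
  thus ?thesis by (rule holomorphic_transform) (simp add: Phi_eq)
qed

lemma Phi_0: "gw_Phi p 0 = 0" using Phi_eq[of 0] by simp

lemma Phi_deriv_0: "(gw_Phi p has_field_derivative 1) (at 0)"
proof -
  let ?h = "\<lambda>z. \<Prod>k. P_quotient ((P ^^ k) z)"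
  have "?h holomorphic_on ball 0 1" by (intro orbit_product P_quotient)
  hence "(?h has_field_derivative deriv ?h 0) (at 0)" by (rule holomorphic_derivI) auto
  hence "((\<lambda>z. z * ?h z) has_field_derivative (1 * ?h 0 + deriv ?h 0 * 0)) (at 0)"
    by (intro DERIV_mult DERIV_ident)
  hence "((\<lambda>z. z * ?h z) has_field_derivative 1) (at 0)" by (simp add: P_quotient)
  thus ?thesis
    by (rule DERIV_cong_ev[THEN iffD1, rotated 3])
       (use eventually_nhds_in_open[of "ball 0 1" "0::complex"] Phi_eq in \<open>auto elim!: eventually_mono\<close>)
qed

lemma Psi_hol: "gw_Psi p q holomorphic_on ball 0 1"
  and Psi_conv: "z \<in> ball 0 1 \<Longrightarrow> convergent_prod (\<lambda>t. Q ((P ^^ t) z) / of_real q0)"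
proof -
  have *: "(\<lambda>w. Q w / of_real q0) holomorphic_on ball 0 1" "Q 0 / of_real q0 = 1"
    using q0_nz by (auto intro!: holomorphic_intros pgf_holomorphic_unit)
  show "gw_Psi p q holomorphic_on ball 0 1"
    using orbit_product(1)[OF *] by (simp add: gw_Psi_def[abs_def])
  show "z \<in> ball 0 1 \<Longrightarrow> convergent_prod (\<lambda>t. Q ((P ^^ t) z) / of_real q0)"
    using orbit_product(2)[OF *] .
qed

lemma Psi_0: "gw_Psi p q 0 = 1"
  unfolding gw_Psi_def using q0_nz by simp

end

context gw_sector
begin

abbreviation "Om \<equiv> ball 0 \<rho> \<union> sector \<kappa>"

lemma open_Om: "open Om" by (intro open_Un open_ball open_sector)

lemma Om_scale: 
  assumes "z \<in> Om" "0 \<le> s" "s \<le> 1"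
  shows "of_real s * z \<in> Om"
proof (cases "s = 0")
  case False
  hence s: "s > 0" using assms by simp
  show ?thesis
  proof (cases "z \<in> sector \<kappa>")
    case True
    thus ?thesis using s by (simp add: sector_scale)
  next
    case False
    hence "norm z < \<rho>" using assms by simp
    moreover have "s * norm z \<le> 1 * norm z" using assms by (intro mult_right_mono) auto
    ultimately show ?thesis using s by (simp add: norm_mult)
  qed
qed (use rho in auto)

lemma sector_E: "z \<in> sector \<kappa> \<Longrightarrow> of_real E ^ k * z \<in> sector \<kappa>"
  using sector_scale[of "E ^ k" z \<kappa>] E_pos by simp

lemma Om_div_E: "z \<in> Om \<Longrightarrow> z / of_real E ^ k \<in> Om"
  using Om_scale[of z "inverse (E ^ k)"] E_gt_1
  by (simp add: field_simps inverse_le_1_iff)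

lemma Pf_E: "z \<in> Om \<Longrightarrow> Pf (of_real E * z) = P (Pf z)"
  using conv_at_imp_Pf[OF conv_at_step[OF R(2) conv Pf_R]] by simp

lemma Pf_iterate: "z \<in> sector \<kappa> \<Longrightarrow> (P ^^ k) (Pf z) = Pf (of_real E ^ k * z)"
proof (induction k)
  case (Suc k)
  have "Pf (of_real E * (of_real E ^ k * z)) = P (Pf (of_real E ^ k * z))"
    using sector_E[OF Suc.prems, of k] by (intro Pf_E) auto
  thus ?case using Suc by (simp add: mult_ac)
qed simp

lemma large_iterate: 
  assumes "z \<noteq> (0::complex)"
  obtains k where "norm (of_real E ^ k * z) > s"
proof -
  obtain k where "s / norm z < E ^ k" using real_arch_pow[OF E_gt_1] by blast
  hence "s < E ^ k * norm z" using assms by (simp add: field_simps)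
  thus ?thesis using that[of k] E_pos by (simp add: norm_mult norm_power)
qed

lemma Pf_large_ball: "z \<in> sector \<kappa> \<Longrightarrow> norm z \<ge> \<rho> / E \<Longrightarrow> Pf z \<in> ball 0 1"
  using Pf_less_1 by simp

text \<open>
  On the sector \<open>\<Pi>(z)\<close> may lie outside the unit disc when \<open>z\<close> is small, but its orbit under \<open>P\<close> enters that
  disc, so \<open>\<Phi>(\<Pi>(z))\<close> and \<open>\<Psi>(\<Pi>(z))\<close> are still given by their defining limits.
\<close>
definition "Wf z = gw_Phi p (Pf z)"
definition "Lf z = gw_R p q z * gw_Psi p q (Pf z)"

lemma Phi_lim_sector:
  assumes z: "z \<in> sector \<kappa>"
  shows "(\<lambda>t. (P ^^ t) (Pf z) / of_real p1 ^ t) \<longlonglongrightarrow> Wf z"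
proof -
  obtain k where k: "norm (of_real E ^ k * z) > \<rho> / E"
    using large_iterate sector_nonzero[OF z] by blast
  have "Pf (of_real E ^ k * z) \<in> ball 0 1" using k by (intro Pf_large_ball sector_E z) auto
  from Phi_lim[OF this] have "(\<lambda>t. (P ^^ t) ((P ^^ k) (Pf z)) / of_real p1 ^ t) \<longlonglongrightarrow> gw_Phi p (Pf (of_real E ^ k * z))"
    unfolding Pf_iterate[OF z] .
  from tendsto_divide[OF this tendsto_const, of "of_real p1 ^ k"]
  have "(\<lambda>t. (P ^^ (t + k)) (Pf z) / of_real p1 ^ (t + k)) \<longlonglongrightarrow> gw_Phi p (Pf (of_real E ^ k * z)) / of_real p1 ^ k"
    using p1_pos by (simp add: funpow_add power_add)
  hence "(\<lambda>t. (P ^^ t) (Pf z) / of_real p1 ^ t) \<longlonglongrightarrow> gw_Phi p (Pf (of_real E ^ k * z)) / of_real p1 ^ k"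
    by (rule LIMSEQ_offset)
  moreover from limI[OF this] have "Wf z = gw_Phi p (Pf (of_real E ^ k * z)) / of_real p1 ^ k"
    unfolding Wf_def gw_Phi_def .
  ultimately show ?thesis by simp
qed

lemma Wf_E: "z \<in> sector \<kappa> \<Longrightarrow> Wf (of_real E * z) = of_real p1 * Wf z"
proof -
  assume z: "z \<in> sector \<kappa>"
  have "(\<lambda>t. of_real p1 * ((P ^^ Suc t) (Pf z) / of_real p1 ^ Suc t)) \<longlonglongrightarrow> of_real p1 * Wf z"
    by (intro tendsto_mult tendsto_const LIMSEQ_Suc Phi_lim_sector z)
  moreover have "of_real p1 * ((P ^^ Suc t) (Pf z) / of_real p1 ^ Suc t) = (P ^^ t) (Pf (of_real E * z)) / of_real p1 ^ t" for t
    using p1_pos Pf_E[of z] z by (simp add: funpow_swap1)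
  ultimately have "(\<lambda>t. (P ^^ t) (Pf (of_real E * z)) / of_real p1 ^ t) \<longlonglongrightarrow> of_real p1 * Wf z" by simp
  from limI[OF this] show ?thesis unfolding Wf_def gw_Phi_def .
qed

lemma Psi_conv_sector:
  assumes z: "z \<in> sector \<kappa>"
  shows "convergent_prod (\<lambda>t. Q ((P ^^ t) (Pf z)) / of_real q0)"
proof -
  obtain k where k: "norm (of_real E ^ k * z) > \<rho> / E"
    using large_iterate sector_nonzero[OF z] by blast
  have "Pf (of_real E ^ k * z) \<in> ball 0 1" using k by (intro Pf_large_ball sector_E z) auto
  from Psi_conv[OF this] have "convergent_prod (\<lambda>t. Q ((P ^^ t) ((P ^^ k) (Pf z))) / of_real q0)"
    unfolding Pf_iterate[OF z] .
  hence "convergent_prod (\<lambda>t. Q ((P ^^ (t + k)) (Pf z)) / of_real q0)" by (simp add: funpow_add)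
  thus ?thesis using convergent_prod_iff_shift[of "\<lambda>t. Q ((P ^^ t) (Pf z)) / of_real q0" k] by simp
qed

lemma Psi_shift_sector:
  assumes z: "z \<in> sector \<kappa>"
  shows "gw_Psi p q (Pf z) = Q (Pf z) / of_real q0 * gw_Psi p q (Pf (of_real E * z))"
proof -
  have Ez: "of_real E * z \<in> sector \<kappa>" using sector_E[OF z, of 1] by simp
  have s: "(P ^^ Suc t) (Pf z) = (P ^^ t) (Pf (of_real E * z))" for t
    using Pf_E[of z] z by (simp add: funpow_swap1)
  have "convergent_prod (\<lambda>t. Q ((P ^^ Suc t) (Pf z)) / of_real q0)"
    unfolding s by (rule Psi_conv_sector[OF Ez])
  from prodinf_shift(2)[OF this] show ?thesis unfolding gw_Psi_def s by simp
qed

lemma QPf_hol: "(\<lambda>z. Q (Pf z)) holomorphic_on Om"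
proof -
  have "Q \<circ> Pf holomorphic_on Om"
    by (rule holomorphic_on_compose_gen[OF Pf_hol R(3)]) (use Pf_R in auto)
  thus ?thesis by (simp add: o_def)
qed

lemma R_product: "gw_R p q holomorphic_on Om" "\<And>z. z \<in> Om \<Longrightarrow> convergent_prod (\<lambda>t. Q (Pf (z / of_real E ^ Suc t)))"
proof -
  have hol: "(\<lambda>z. Q (Pf (z / of_real E ^ Suc t))) holomorphic_on Om" for t
  proof -
    have "(\<lambda>z. Q (Pf z)) \<circ> (\<lambda>z. z / of_real E ^ Suc t) holomorphic_on Om"
    proof (rule holomorphic_on_compose_gen[OF _ QPf_hol])
      show "(\<lambda>z. z / of_real E ^ Suc t) holomorphic_on Om" using E_pos by (intro holomorphic_intros) auto
      show "(\<lambda>z. z / of_real E ^ Suc t) ` Om \<subseteq> Om" using Om_div_E by blast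
    qed
    thus ?thesis by (simp add: o_def)
  qed
  have bd: "\<exists>d>0. \<exists>M. cball z d \<subseteq> Om \<and> summable M \<and> (\<forall>t. \<forall>w\<in>cball z d. norm (Q (Pf (w / of_real E ^ Suc t)) - 1) \<le> M t)" if z: "z \<in> Om" for z
  proof -
    obtain d where d: "d > 0" "cball z d \<subseteq> Om" using open_contains_cball[THEN iffD1, OF open_Om, rule_format, OF z] by blast
    \<comment> \<open>The points \<open>w/E\<^bsup>t+1\<^esup>\<close> at which the factors are evaluated all lie in this compact star.\<close>
    define K where "K = (\<lambda>(s, w). of_real s * w) ` ({0..1::real} \<times> cball z d)"
    have "compact K" unfolding K_def
      by (intro compact_continuous_image compact_Times compact_Icc compact_cball)
         (auto intro!: continuous_intros simp: split_beta)
    moreover have "K \<subseteq> Om"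
    proof
      fix x assume "x \<in> K"
      then obtain s w where "x = of_real s * w" "0 \<le> s" "s \<le> 1" "w \<in> cball z d" by (auto simp: K_def)
      thus "x \<in> Om" using Om_scale d(2) by blast
    qed
    ultimately obtain C where C: "C > 0" "\<And>v. v \<in> K \<Longrightarrow> norm (Q (Pf v) - Q (Pf 0)) \<le> C * norm (v - 0)"
      using holomorphic_lipschitz_at[OF QPf_hol open_Om] by blast
    define B where "B = norm z + d"
    have "norm (Q (Pf (w / of_real E ^ Suc t)) - 1) \<le> C * B * (1/E) ^ Suc t" if w: "w \<in> cball z d" for t w
    proof -
      have "of_real ((1/E) ^ Suc t) * w \<in> K" unfolding K_def
        using w E_gt_1 by (intro image_eqI[where x = "((1/E) ^ Suc t, w)"]) (auto intro!: power_le_one simp del: power_Suc)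
      moreover have "w / of_real E ^ Suc t = of_real ((1/E) ^ Suc t) * w" by (simp add: power_one_over field_simps)
      ultimately have "norm (Q (Pf (w / of_real E ^ Suc t)) - 1) \<le> C * norm (of_real ((1/E) ^ Suc t) * w)"
        using C(2)[of "w / of_real E ^ Suc t"] by (simp add: Pf_0 del: power_Suc)
      also have "norm (of_real ((1/E) ^ Suc t) * w) = (1/E) ^ Suc t * norm w"
        unfolding norm_mult norm_of_real using E_pos by (simp del: power_Suc)
      also have "norm w \<le> B"
      proof -
        have "norm w \<le> norm z + norm (w - z)" by (rule norm_triangle_sub)
        moreover have "norm (w - z) \<le> d" using w by (simp add: dist_norm norm_minus_commute)
        ultimately show ?thesis by (simp add: B_def)
      qed
      finally show ?thesis using C E_pos by (simp add: mult_ac mult_left_mono del: power_Suc)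
    qed
    moreover have "summable (\<lambda>t. C * B * (1/E) ^ Suc t)"
      using E_gt_1 by (intro summable_mult summable_Suc_iff[THEN iffD2] summable_geometric) auto
    ultimately show ?thesis using d by blast
  qed
  show "gw_R p q holomorphic_on Om"
    using holomorphic_prodinf(1)[OF open_Om hol bd] by (simp add: gw_R_def[abs_def])
  show "convergent_prod (\<lambda>t. Q (Pf (z / of_real E ^ Suc t)))" if "z \<in> Om" for z
    by (rule holomorphic_prodinf(2)[OF open_Om hol bd that])
qed

lemma R_E: "z \<in> sector \<kappa> \<Longrightarrow> gw_R p q (of_real E * z) = Q (Pf z) * gw_R p q z"
proof -
  assume z: "z \<in> sector \<kappa>"
  have s: "of_real E * z / of_real E ^ Suc (Suc t) = z / of_real E ^ Suc t" for t using E_pos by simp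
  have "convergent_prod (\<lambda>t. Q (Pf (of_real E * z / of_real E ^ Suc (Suc t))))"
    unfolding s using z by (intro R_product) auto
  from prodinf_shift(2)[OF this] show ?thesis unfolding gw_R_def s using E_pos by simp
qed

lemma Lf_E: "z \<in> sector \<kappa> \<Longrightarrow> Lf (of_real E * z) = of_real q0 * Lf z"
  unfolding Lf_def using q0_pos by (simp add: R_E Psi_shift_sector)

text \<open>
  The scaling relation expresses \<open>f\<close> near \<open>z\<close> through \<open>f\<close> near \<open>E\<^sup>k z\<close>, which is as large as desired.
\<close>
lemma scaling_holomorphic:
  assumes f: "f holomorphic_on sector \<kappa> \<inter> {z. norm z > s}" and c: "c \<noteq> 0"
    and fE: "\<And>z. z \<in> sector \<kappa> \<Longrightarrow> f (of_real E * z) = c * f z"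
  shows "f holomorphic_on sector \<kappa>"
proof -
  have o: "open (sector \<kappa> \<inter> {z::complex. norm z > s})"
    by (intro open_Int open_sector open_Collect_less continuous_intros)
  have fk: "f (of_real E ^ k * z) = c ^ k * f z" if "z \<in> sector \<kappa>" for z k
  proof (induction k)
    case (Suc k)
    have "f (of_real E * (of_real E ^ k * z)) = c * f (of_real E ^ k * z)" by (intro fE sector_E that)
    thus ?case using Suc by (simp add: mult_ac)
  qed simp
  have "\<exists>f'. (f has_field_derivative f') (at z)" if z: "z \<in> sector \<kappa>" for z
  proof -
    obtain k where k: "norm (of_real E ^ k * z) > s" using large_iterate sector_nonzero[OF z] by blast
    have "of_real E ^ k * z \<in> sector \<kappa> \<inter> {z. norm z > s}" using k sector_E[OF z] by simp
    then obtain f' where f': "(f has_field_derivative f') (at (of_real E ^ k * z))"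
      using f unfolding holomorphic_on_open[OF o] by blast
    have "((\<lambda>w. of_real E ^ k * w) has_field_derivative of_real E ^ k) (at z)" by (auto intro!: derivative_eq_intros)
    from DERIV_chain2[OF f' this]
    have "((\<lambda>w. f (of_real E ^ k * w)) has_field_derivative f' * of_real E ^ k) (at z)" .
    hence d: "((\<lambda>w. f (of_real E ^ k * w) / c ^ k) has_field_derivative f' * of_real E ^ k / c ^ k) (at z)"
      by (rule DERIV_cdivide)
    have "(f has_field_derivative f' * of_real E ^ k / c ^ k) (at z)"
      by (rule has_field_derivative_transform_within_open[OF d open_sector z]) (use c fk in auto)
    thus ?thesis by blast
  qed
  thus ?thesis unfolding holomorphic_on_open[OF open_sector] by blast
qed

lemma Pf_hol_sector: "Pf holomorphic_on sector \<kappa>"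
  using Pf_hol by (rule holomorphic_on_subset) auto

lemma Wf_hol: "Wf holomorphic_on sector \<kappa>"
proof (rule scaling_holomorphic[where f = Wf and c = "of_real p1", OF _ _ Wf_E])
  have "gw_Phi p \<circ> Pf holomorphic_on sector \<kappa> \<inter> {z. norm z > \<rho> / E}"
    by (rule holomorphic_on_compose_gen[OF _ Phi_hol])
       (use Pf_less_1 in \<open>auto intro: holomorphic_on_subset[OF Pf_hol_sector]\<close>)
  thus "Wf holomorphic_on sector \<kappa> \<inter> {z. norm z > \<rho> / E}" by (simp add: Wf_def[abs_def] o_def)
qed (use p1_pos in auto)

lemma Lf_hol: "Lf holomorphic_on sector \<kappa>"
proof (rule scaling_holomorphic[where f = Lf and c = "of_real q0", OF _ _ Lf_E])
  have "gw_Psi p q \<circ> Pf holomorphic_on sector \<kappa> \<inter> {z. norm z > \<rho> / E}"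
    by (rule holomorphic_on_compose_gen[OF _ Psi_hol])
       (use Pf_less_1 in \<open>auto intro: holomorphic_on_subset[OF Pf_hol_sector]\<close>)
  moreover have "gw_R p q holomorphic_on sector \<kappa> \<inter> {z. norm z > \<rho> / E}"
    by (rule holomorphic_on_subset[OF R_product(1)]) auto
  ultimately have "(\<lambda>z. gw_R p q z * (gw_Psi p q \<circ> Pf) z) holomorphic_on sector \<kappa> \<inter> {z. norm z > \<rho> / E}"
    by (intro holomorphic_intros)
  thus "Lf holomorphic_on sector \<kappa> \<inter> {z. norm z > \<rho> / E}" by (simp add: Lf_def[abs_def] o_def)
qed (use q0_nz in auto)

end

section \<open>Periodic functions on a strip and their coefficients\<close>

context gw_sector
begin

lemma lnE_pos: "ln E > 0" using E_gt_1 by simp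

text \<open>
  \<open>h0\<close> is the half-width of the strip that \<open>\<zeta> \<mapsto> E\<^sup>\<zeta>\<close> maps into the sector; \<open>h1\<close> is a smaller half-width, still above
  \<open>\<pi>/(2 ln E)\<close>, on which bounds hold up to the boundary.
\<close>
definition h0 :: real where "h0 = (pi / 2 + arctan \<kappa>) / ln E"
definition h1 :: real where "h1 = (pi / 2 + arctan \<kappa> / 2) / ln E"

lemma strip_widths: "pi / (2 * ln E) < h1" "h1 < h0" "h0 > 0" "h1 > 0"
proof -
  have k: "arctan \<kappa> > 0" using kappa by simp
  have "pi / (2 * ln E) = (pi / 2) / ln E" by simp
  also have "\<dots> < h1" unfolding h1_def using k lnE_pos by (intro divide_strict_right_mono) auto
  finally show 1: "pi / (2 * ln E) < h1" .
  show 2: "h1 < h0" unfolding h1_def h0_def using k lnE_pos by (intro divide_strict_right_mono) auto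
  have "pi / (2 * ln E) > 0" using lnE_pos by simp
  with 1 2 show "h1 > 0" "h0 > 0" by linarith+
qed

lemma exp_strip_sector:
  assumes "\<bar>Im \<zeta>\<bar> < h0"
  shows "exp (\<zeta> * of_real (ln E)) \<in> sector \<kappa>"
proof -
  define \<theta> where "\<theta> = Im \<zeta> * ln E"
  have th: "\<bar>\<theta>\<bar> < pi / 2 + arctan \<kappa>"
    using assms lnE_pos by (simp add: \<theta>_def h0_def abs_mult field_simps)
  have key: "cos \<theta> + \<kappa> * \<bar>sin \<theta>\<bar> > 0"
  proof (cases "\<bar>\<theta>\<bar> \<le> pi / 2")
    case True
    have c: "cos \<theta> \<ge> 0" using True by (intro cos_ge_zero) auto
    show ?thesis
    proof (cases "cos \<theta> = 0")
      case True
      hence "sin \<theta> \<noteq> 0" using sin_cos_squared_add[of \<theta>] by auto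
      thus ?thesis using True kappa by simp
    next
      case False
      hence "cos \<theta> > 0" using c by simp
      moreover have "\<kappa> * \<bar>sin \<theta>\<bar> \<ge> 0" using kappa by simp
      ultimately show ?thesis by linarith
    qed
  next
    case False
    define \<phi> where "\<phi> = \<bar>\<theta>\<bar> - pi / 2"
    have ph: "0 < \<phi>" "\<phi> < arctan \<kappa>" "\<phi> < pi / 2" using False th arctan_ubound[of \<kappa>] by (auto simp: \<phi>_def)
    have "cos \<theta> = cos \<bar>\<theta>\<bar>" by simp
    also have "\<bar>\<theta>\<bar> = \<phi> + pi / 2" by (simp add: \<phi>_def)
    finally have c: "cos \<theta> = - sin \<phi>" by (simp add: cos_add)
    have "\<bar>sin \<theta>\<bar> = \<bar>sin \<bar>\<theta>\<bar>\<bar>" by (simp add: abs_if)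
    also have "\<bar>\<theta>\<bar> = \<phi> + pi / 2" by (simp add: \<phi>_def)
    finally have s: "\<bar>sin \<theta>\<bar> = \<bar>cos \<phi>\<bar>" by (simp add: sin_add)
    have cp: "cos \<phi> > 0" using ph by (intro cos_gt_zero_pi) auto
    have "tan \<phi> < tan (arctan \<kappa>)" using ph arctan_ubound[of \<kappa>] by (intro tan_monotone) auto
    hence "tan \<phi> < \<kappa>" by (simp add: tan_arctan)
    hence "sin \<phi> < \<kappa> * cos \<phi>" using cp by (simp add: tan_def field_simps)
    thus ?thesis using c s cp by simp
  qed
  define r where "r = exp (Re \<zeta> * ln E)"
  have r: "r > 0" by (simp add: r_def)
  have "Re (exp (\<zeta> * of_real (ln E))) = r * cos \<theta>" "Im (exp (\<zeta> * of_real (ln E))) = r * sin \<theta>"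
    by (simp_all add: Re_exp Im_exp r_def \<theta>_def)
  moreover have "r * (cos \<theta> + \<kappa> * \<bar>sin \<theta>\<bar>) > 0" using r key by simp
  ultimately show ?thesis using r unfolding sector_def by (simp add: abs_mult algebra_simps)
qed

text \<open>
  The analytic extensions of \<open>K\<close> and \<open>L\<close> to the strip.
\<close>
definition Kt :: "complex \<Rightarrow> complex" where "Kt \<zeta> = exp (- \<zeta> * of_real (ln p1)) * Wf (exp (\<zeta> * of_real (ln E)))"
definition Lt :: "complex \<Rightarrow> complex" where "Lt \<zeta> = exp (- \<zeta> * of_real (ln q0)) * Lf (exp (\<zeta> * of_real (ln E)))"

lemma exp_strip_add_1: "exp ((\<zeta> + 1 :: complex) * of_real (ln E)) = of_real E * exp (\<zeta> * of_real (ln E))"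
  using E_pos by (simp add: distrib_right exp_add exp_of_real)

lemma strip_compose_hol:
  assumes "f holomorphic_on sector \<kappa>"
  shows "(\<lambda>\<zeta>. f (exp (\<zeta> * of_real (ln E)))) holomorphic_on {w. \<bar>Im w\<bar> < h0}"
proof -
  have "f \<circ> (\<lambda>\<zeta>. exp (\<zeta> * of_real (ln E))) holomorphic_on {w. \<bar>Im w\<bar> < h0}"
    by (rule holomorphic_on_compose_gen[OF _ assms]) (auto intro!: holomorphic_intros exp_strip_sector)
  thus ?thesis by (simp add: o_def)
qed

lemma periodic_strip_scaling:
  assumes f: "f holomorphic_on sector \<kappa>" and s: "s > 0"
    and fE: "\<And>z. z \<in> sector \<kappa> \<Longrightarrow> f (of_real E * z) = of_real s * f z"
  shows "periodic_strip (\<lambda>\<zeta>. exp (- \<zeta> * of_real (ln s)) * f (exp (\<zeta> * of_real (ln E)))) h0"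
proof
  show "h0 > 0" by (rule strip_widths)
  show "(\<lambda>\<zeta>. exp (- \<zeta> * of_real (ln s)) * f (exp (\<zeta> * of_real (ln E)))) holomorphic_on {w. \<bar>Im w\<bar> < h0}"
    by (intro holomorphic_intros strip_compose_hol f)
  fix w assume w: "\<bar>Im w\<bar> < h0"
  have "complex_of_real s = exp (of_real (ln s))" using s by (simp add: exp_of_real)
  hence "exp (- (w + 1) * of_real (ln s)) * of_real s = exp (- (w + 1) * of_real (ln s)) * exp (of_real (ln s))"
    by (rule arg_cong)
  hence "exp (- (w + 1) * of_real (ln s)) * of_real s = exp (- w * of_real (ln s))"
    unfolding exp_add[symmetric] by (simp add: algebra_simps)
  thus "exp (- (w + 1) * of_real (ln s)) * f (exp ((w + 1) * of_real (ln E))) = exp (- w * of_real (ln s)) * f (exp (w * of_real (ln E)))"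
    unfolding exp_strip_add_1 using fE[OF exp_strip_sector[OF w]] by (simp add: mult.assoc[symmetric])
qed

lemma strip_Kt: "periodic_strip Kt h0"
  unfolding Kt_def[abs_def] by (intro periodic_strip_scaling Wf_hol p1_pos Wf_E)

lemma strip_Lt: "periodic_strip Lt h0"
  unfolding Lt_def[abs_def] by (intro periodic_strip_scaling Lf_hol q0_pos Lf_E)

definition Fn :: "nat \<Rightarrow> complex \<Rightarrow> complex" where "Fn n \<zeta> = Kt \<zeta> ^ (n + 1) * Lt \<zeta>"

lemma strip_Fn: "periodic_strip (Fn n) h0"
proof -
  interpret K: periodic_strip Kt h0 by (rule strip_Kt)
  interpret L: periodic_strip Lt h0 by (rule strip_Lt)
  show ?thesis
  proof
    show "Fn n holomorphic_on {w. \<bar>Im w\<bar> < h0}" unfolding Fn_def[abs_def]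
      by (intro holomorphic_intros K.hol L.hol)
  qed (use K.h K.per L.per in \<open>auto simp: Fn_def\<close>)
qed

lemma gw_K_eq: "gw_K p x = Kt (of_real x)"
  unfolding gw_K_def Kt_def Wf_def using p1_pos E_pos by (simp add: powr_def exp_of_real[symmetric])

lemma gw_L_eq: "gw_L p q x = Lt (of_real x)"
  unfolding gw_L_def Lt_def Lf_def using q0_pos E_pos by (simp add: powr_def exp_of_real[symmetric])

lemma gw_theta_eq: "gw_theta p q n m = fourier_coeff (Fn n) m"
  unfolding gw_theta_def fourier_coeff_def Fn_def gw_K_eq gw_L_eq by simp

lemma Kt_Lt_bounded:
  obtains CK CL where "CK > 0" "CL > 0" "\<And>w. \<bar>Im w\<bar> \<le> h1 \<Longrightarrow> norm (Kt w) \<le> CK" "\<And>w. \<bar>Im w\<bar> \<le> h1 \<Longrightarrow> norm (Lt w) \<le> CL"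
  using periodic_strip.bounded_substrip[OF strip_Kt strip_widths(2)] periodic_strip.bounded_substrip[OF strip_Lt strip_widths(2)] by blast

definition strip_coord :: "complex \<Rightarrow> complex" where "strip_coord z = Ln z / of_real (ln E)"

lemma strip_coord:
  assumes "Re z \<ge> 0" "z \<noteq> 0"
  shows "\<bar>Im (strip_coord z)\<bar> \<le> pi / (2 * ln E)" "\<bar>Im (strip_coord z)\<bar> \<le> h1" "\<bar>Im (strip_coord z)\<bar> < h0"
    "exp (strip_coord z * of_real (ln E)) = z" "Re (strip_coord z) = ln (norm z) / ln E"
proof -
  have "\<bar>Im (Ln z)\<bar> \<le> pi / 2" using Re_Ln_pos_le[OF assms(2)] assms(1) by blast
  hence "\<bar>Im (Ln z)\<bar> / ln E \<le> (pi / 2) / ln E" using lnE_pos by (intro divide_right_mono) auto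
  thus 1: "\<bar>Im (strip_coord z)\<bar> \<le> pi / (2 * ln E)"
    using lnE_pos by (simp add: strip_coord_def Im_divide_of_real)
  show "\<bar>Im (strip_coord z)\<bar> \<le> h1" "\<bar>Im (strip_coord z)\<bar> < h0" using 1 strip_widths by linarith+
  show "exp (strip_coord z * of_real (ln E)) = z" using assms lnE_pos by (simp add: strip_coord_def)
  show "Re (strip_coord z) = ln (norm z) / ln E" using assms by (simp add: strip_coord_def Re_divide_of_real)
qed

lemma Wf_Kt: "Re z \<ge> 0 \<Longrightarrow> z \<noteq> 0 \<Longrightarrow> Wf z = exp (strip_coord z * of_real (ln p1)) * Kt (strip_coord z)"
  unfolding Kt_def by (simp add: strip_coord(4) mult.assoc[symmetric] exp_add[symmetric])

lemma Lf_Lt: "Re z \<ge> 0 \<Longrightarrow> z \<noteq> 0 \<Longrightarrow> Lf z = exp (strip_coord z * of_real (ln q0)) * Lt (strip_coord z)"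
  unfolding Lt_def by (simp add: strip_coord(4) mult.assoc[symmetric] exp_add[symmetric])

lemma norm_Wf_Lf:
  assumes "Re z \<ge> 0" "z \<noteq> 0"
  shows "norm (Wf z) = norm z powr (log E p1) * norm (Kt (strip_coord z))"
    and "norm (Lf z) = norm z powr (log E q0) * norm (Lt (strip_coord z))"
proof -
  have "norm (exp (strip_coord z * of_real (ln p1))) = norm z powr (log E p1)"
    using assms by (simp add: strip_coord(5) powr_def log_def)
  thus "norm (Wf z) = norm z powr (log E p1) * norm (Kt (strip_coord z))"
    unfolding Wf_Kt[OF assms] norm_mult by simp
  have "norm (exp (strip_coord z * of_real (ln q0))) = norm z powr (log E q0)"
    using assms by (simp add: strip_coord(5) powr_def log_def)
  thus "norm (Lf z) = norm z powr (log E q0) * norm (Lt (strip_coord z))"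
    unfolding Lf_Lt[OF assms] norm_mult by simp
qed

text \<open>
  The argument of \<open>\<Gamma>\<close> in the theorem; \<open>-sexp n m\<close> is the exponent of \<open>z\<close> that belongs to the \<open>m\<close>-th Fourier mode of
  \<open>K\<^bsup>n+1\<^esup> L\<close>.
\<close>
definition sexp :: "nat \<Rightarrow> int \<Rightarrow> complex" where
  "sexp n m = - ((of_real (ln (p1 ^ (n + 1) * q0)) + 2 * of_real pi * \<i> * of_int m) / of_real (ln E))"

lemma gw_Gamma_eq: "gw_Gamma p q n m = Gamma (sexp n m)"
  by (simp add: gw_Gamma_def sexp_def)

lemma ln_p1q0: "ln (p1 ^ (n + 1) * q0) = (real n + 1) * ln p1 + ln q0"
  using p1_pos q0_pos by (simp add: ln_mult ln_realpow algebra_simps)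

lemma sexp_Re: "Re (sexp n m) = - log E (p1 ^ (n + 1) * q0)"
  and sexp_Re': "Re (sexp n m) = (real n + 1) * (- log E p1) + (- log E q0)"
  and sexp_Im: "Im (sexp n m) = - (2 * pi * real_of_int m / ln E)"
proof -
  show 1: "Re (sexp n m) = - log E (p1 ^ (n + 1) * q0)"
    by (simp add: sexp_def log_def Re_divide_of_real)
  show "Re (sexp n m) = (real n + 1) * (- log E p1) + (- log E q0)"
    unfolding 1 log_def ln_p1q0 by (simp add: add_divide_distrib diff_divide_distrib)
  show "Im (sexp n m) = - (2 * pi * real_of_int m / ln E)"
    by (simp add: sexp_def Im_divide_of_real)
qed

text \<open>
  This is the Fourier series of \<open>K\<^bsup>n+1\<^esup> L\<close> at \<open>log\<^sub>E z\<close>, rewritten in powers of \<open>z\<close>.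
\<close>
lemma Wf_Lf_expansion:
  assumes z: "Re z \<ge> 0" "z \<noteq> 0"
  shows "((\<lambda>m. gw_theta p q n m * z powr (- sexp n m)) has_sum (Wf z ^ (n + 1) * Lf z)) UNIV"
proof -
  let ?\<zeta> = "strip_coord z"
  have "((\<lambda>m. gw_theta p q n m * exp (2 * of_real pi * \<i> * of_int m * ?\<zeta>)) has_sum Fn n ?\<zeta>) UNIV"
    unfolding gw_theta_eq by (rule periodic_strip.fourier_series[OF strip_Fn strip_coord(3)[OF z]])
  from has_sum_cmult_right[OF this, of "exp (?\<zeta> * of_real (ln (p1 ^ (n + 1) * q0)))"]
  have "((\<lambda>m. exp (?\<zeta> * of_real (ln (p1 ^ (n + 1) * q0))) * (gw_theta p q n m * exp (2 * of_real pi * \<i> * of_int m * ?\<zeta>))) has_sum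
     exp (?\<zeta> * of_real (ln (p1 ^ (n + 1) * q0))) * Fn n ?\<zeta>) UNIV" .
  moreover have "exp (?\<zeta> * of_real (ln (p1 ^ (n + 1) * q0))) * (gw_theta p q n m * exp (2 * of_real pi * \<i> * of_int m * ?\<zeta>))
     = gw_theta p q n m * z powr (- sexp n m)" for m
  proof -
    have "?\<zeta> * of_real (ln (p1 ^ (n + 1) * q0)) + 2 * of_real pi * \<i> * of_int m * ?\<zeta> = - sexp n m * Ln z"
      unfolding sexp_def strip_coord_def by (simp add: algebra_simps add_divide_distrib)
    moreover have "exp (?\<zeta> * of_real (ln (p1 ^ (n + 1) * q0))) * (gw_theta p q n m * exp (2 * of_real pi * \<i> * of_int m * ?\<zeta>))
      = gw_theta p q n m * exp (?\<zeta> * of_real (ln (p1 ^ (n + 1) * q0)) + 2 * of_real pi * \<i> * of_int m * ?\<zeta>)"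
      by (simp add: exp_add mult_ac)
    ultimately show ?thesis using z by (simp add: powr_def)
  qed
  moreover have "exp (?\<zeta> * of_real (ln (p1 ^ (n + 1) * q0))) * Fn n ?\<zeta> = Wf z ^ (n + 1) * Lf z"
  proof -
    have "?\<zeta> * of_real (ln (p1 ^ (n + 1) * q0)) = of_nat (n + 1) * (?\<zeta> * of_real (ln p1)) + ?\<zeta> * of_real (ln q0)"
      unfolding ln_p1q0 by (simp add: algebra_simps)
    hence "exp (?\<zeta> * of_real (ln (p1 ^ (n + 1) * q0))) = exp (?\<zeta> * of_real (ln p1)) ^ (n + 1) * exp (?\<zeta> * of_real (ln q0))"
      by (simp only: exp_add exp_of_nat_mult)
    thus ?thesis unfolding Fn_def Wf_Kt[OF z] Lf_Lt[OF z] power_mult_distrib by (simp only: mult_ac)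
  qed
  ultimately show ?thesis by (simp only:)
qed

lemma theta_bound:
  assumes "\<And>w. \<bar>Im w\<bar> \<le> h1 \<Longrightarrow> norm (Kt w) \<le> CK" "\<And>w. \<bar>Im w\<bar> \<le> h1 \<Longrightarrow> norm (Lt w) \<le> CL" "CK > 0" "CL > 0"
  shows "norm (gw_theta p q n m) \<le> CK ^ (n + 1) * CL * exp (- (2 * pi * h1 * \<bar>real_of_int m\<bar>))"
  unfolding gw_theta_eq
proof (rule periodic_strip.coeff_bound[OF strip_Fn])
  show "0 \<le> h1" "h1 < h0" using strip_widths by auto
  show "norm (Fn n w) \<le> CK ^ (n + 1) * CL" if "\<bar>Im w\<bar> \<le> h1" for w
    unfolding Fn_def norm_mult norm_power using assms(1,2)[OF that] assms(3,4)
    by (intro mult_mono power_mono) auto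
qed

end

section \<open>The local inverse of \<open>\<Phi>\<close> and \<open>\<Pi> R\<close> near infinity\<close>

context gw_immigration
begin

lemma Phi_local_inverse_exists: "\<exists>g. is_local_inverse_0 (gw_Phi p) g"
proof -
  have d: "deriv (gw_Phi p) 0 \<noteq> 0" using Phi_deriv_0 by (simp add: DERIV_imp_deriv)
  have z: "(0::complex) \<in> ball 0 1" by simp
  obtain r where r: "r > 0" "ball (0::complex) r \<subseteq> ball 0 1" "inj_on (gw_Phi p) (ball 0 r)"
    by (rule has_complex_derivative_locally_injective[OF Phi_hol z open_ball d]) (rule that, assumption+)
  have hol: "gw_Phi p holomorphic_on ball 0 r" using Phi_hol r(2) by (rule holomorphic_on_subset)
  obtain g where g: "g holomorphic_on (gw_Phi p ` ball 0 r)" "\<And>z. z \<in> ball 0 r \<Longrightarrow> g (gw_Phi p z) = z"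
    using holomorphic_has_inverse[OF hol open_ball r(3)] by metis
  have op: "open (gw_Phi p ` ball 0 r)" by (rule open_mapping_thm3[OF hol open_ball r(3)])
  have 0: "0 \<in> gw_Phi p ` ball 0 r" using Phi_0 r(1) by (metis centre_in_ball imageI)
  have "is_local_inverse_0 (gw_Phi p) g"
    unfolding is_local_inverse_0_def
  proof (intro conjI)
    show "g analytic_on {0}" using g(1) op 0 by (auto simp: analytic_at)
    show "g 0 = 0" using g(2)[of 0] r(1) Phi_0 by simp
    show "\<forall>\<^sub>F z in nhds 0. gw_Phi p (g z) = z"
      using eventually_nhds_in_open[OF op 0] by (rule eventually_mono) (use g(2) in auto)
    show "\<forall>\<^sub>F z in nhds 0. g (gw_Phi p z) = z"
      using eventually_nhds_in_open[OF open_ball, of 0 0 r] r(1) g(2) by (auto elim!: eventually_mono)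
  qed
  thus ?thesis by blast
qed

abbreviation "G \<equiv> gw_Phi_inv p"

lemma Phi_inv: "is_local_inverse_0 (gw_Phi p) G"
  using someI_ex[OF Phi_local_inverse_exists] by (simp add: gw_Phi_inv_def)

text \<open>
  The local inverse of \<open>\<Phi>\<close> is holomorphic at 0 with derivative 1, so its quotient by the argument extends
  by the value 1, the one chosen in the definition of \<open>A\<close>, and \<open>\<Psi>\<close> has no zeros near 0.  The last equation
  covers the case \<open>\<Phi>(u) = 0\<close> because there \<open>u = 0\<close>.
\<close>
theorem A_fun_near_0:
  obtains r e where "r > 0" "e > 0" "e \<le> 1" "gw_A_fun p q holomorphic_on ball 0 r"
    "\<And>u. norm u < e \<Longrightarrow> norm (gw_Phi p u) < r"
    "\<And>u. norm u < e \<Longrightarrow> gw_Phi p u * gw_A_fun p q (gw_Phi p u) * gw_Psi p q u = u"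
proof -
  have G: "G analytic_on {0}" "G 0 = 0" "\<forall>\<^sub>F z in nhds 0. gw_Phi p (G z) = z" "\<forall>\<^sub>F z in nhds 0. G (gw_Phi p z) = z"
    using Phi_inv by (auto simp: is_local_inverse_0_def)
  obtain r1 where r1: "r1 > 0" "G holomorphic_on ball 0 r1" using G(1) by (auto simp: analytic_on_def)
  have dG: "deriv G 0 = 1"
  proof -
    have "(G has_field_derivative deriv G 0) (at (gw_Phi p 0))"
      unfolding Phi_0 using r1 by (intro holomorphic_derivI[OF r1(2)]) auto
    from DERIV_chain2[OF this Phi_deriv_0] have "((\<lambda>z. G (gw_Phi p z)) has_field_derivative deriv G 0 * 1) (at 0)" .
    moreover have "((\<lambda>z. G (gw_Phi p z)) has_field_derivative 1) (at 0)"
    proof -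
      have "\<forall>\<^sub>F z in nhds 0. z = G (gw_Phi p z)" using G(4) by (rule eventually_mono) simp
      from iffD1[OF DERIV_cong_ev[OF refl this refl] DERIV_ident] show ?thesis .
    qed
    ultimately show ?thesis using DERIV_unique by fastforce
  qed
  \<comment> \<open>\<open>G(z)/z\<close>, with value 1 at 0, matching the convention in the definition of \<open>A\<close>.\<close>
  define g1 where "g1 = (\<lambda>z. if z = 0 then deriv G 0 else (G z - G 0) / (z - 0))"
  have g1: "g1 holomorphic_on ball 0 r1" unfolding g1_def using r1 by (intro pole_lemma_open) auto
  have "isCont (gw_Psi p q) 0"
    using holomorphic_on_imp_continuous_on[OF Psi_hol] by (simp add: continuous_on_eq_continuous_at)
  hence "(gw_Psi p q \<longlongrightarrow> gw_Psi p q 0) (nhds 0)"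
    unfolding isCont_def tendsto_at_iff_tendsto_nhds .
  hence "\<forall>\<^sub>F u in nhds 0. gw_Psi p q u \<noteq> 0"
    by (rule tendsto_imp_eventually_ne) (simp add: Psi_0)
  then obtain e1 where e1: "e1 > 0" "\<And>u. norm u < e1 \<Longrightarrow> gw_Psi p q u \<noteq> 0"
    by (auto simp: eventually_nhds_metric dist_norm)
  have "isCont G 0" using holomorphic_on_imp_continuous_on[OF r1(2)] r1(1) by (simp add: continuous_on_eq_continuous_at)
  moreover have "min e1 1 > 0" using e1 by simp
  ultimately have "\<exists>d>0. \<forall>z. dist z 0 < d \<longrightarrow> dist (G z) (G 0) < min e1 1"
    unfolding continuous_at_eps_delta by blast
  then obtain r2 where r2: "r2 > 0" "\<And>z. norm z < r2 \<Longrightarrow> norm (G z) < min e1 1"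
    using G(2) by (auto simp: dist_norm)
  define r where "r = min r1 r2"
  have r: "r > 0" "r \<le> r1" "r \<le> r2" using r1 r2 by (auto simp: r_def)
  have hol: "gw_A_fun p q holomorphic_on ball 0 r"
  proof -
    have "gw_Psi p q \<circ> G holomorphic_on ball 0 r"
      by (rule holomorphic_on_compose_gen[OF holomorphic_on_subset[OF r1(2)] Psi_hol]) (use r r2 in auto)
    moreover have "g1 holomorphic_on ball 0 r" using g1 by (rule holomorphic_on_subset) (use r in auto)
    ultimately have "(\<lambda>z. g1 z / (gw_Psi p q \<circ> G) z) holomorphic_on ball 0 r"
      using r r2 e1(2) by (intro holomorphic_on_divide) (auto simp: o_def)
    thus ?thesis
      by (rule holomorphic_transform) (auto simp: gw_A_fun_def g1_def dG G(2) Psi_0)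
  qed
  have "isCont (gw_Phi p) 0" using Phi_deriv_0 by (rule DERIV_isCont)
  hence "\<exists>d>0. \<forall>z. dist z 0 < d \<longrightarrow> dist (gw_Phi p z) (gw_Phi p 0) < r"
    unfolding continuous_at_eps_delta using r(1) by blast
  then obtain e2 where e2: "e2 > 0" "\<And>z. norm z < e2 \<Longrightarrow> norm (gw_Phi p z) < r"
    using Phi_0 by (auto simp: dist_norm)
  obtain e3 where e3: "e3 > 0" "\<And>u. norm u < e3 \<Longrightarrow> G (gw_Phi p u) = u"
    using G(4) by (auto simp: eventually_nhds_metric dist_norm)
  define e where "e = min (min e1 1) (min e2 e3)"
  show ?thesis
  proof (rule that[of r e])
    show "gw_Phi p u * gw_A_fun p q (gw_Phi p u) * gw_Psi p q u = u" if u: "norm u < e" for u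
    proof (cases "gw_Phi p u = 0")
      case True
      hence "u = 0" using e3(2)[of u] u G(2) by (simp add: e_def)
      thus ?thesis using True by simp
    next
      case False
      thus ?thesis using e3(2)[of u] e1(2)[of u] u by (simp add: e_def gw_A_fun_def)
    qed
  qed (use r e1 e2 e3 hol in \<open>auto simp: e_def\<close>)
qed

end

context gw_sector
begin

lemma annulus_index:
  assumes "s > 0" "s \<le> (x::real)"
  obtains k where "s * E ^ k \<le> x" "x < s * E ^ Suc k"
proof -
  obtain N where "x / s < E ^ N" using real_arch_pow[OF E_gt_1] by blast
  hence N: "x < s * E ^ N" using assms by (simp add: field_simps)
  define n where "n = (LEAST n. x < s * E ^ n)"
  have n: "x < s * E ^ n" unfolding n_def by (rule LeastI) (rule N)
  have "n \<noteq> 0" using n assms by (intro notI) simp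
  then obtain k where k: "n = Suc k" by (cases n) auto
  have "\<not> x < s * E ^ k" using not_less_Least[of k "\<lambda>n. x < s * E ^ n"] k by (simp add: n_def)
  thus ?thesis using that[of k] n k by simp
qed

text \<open>
  Every large \<open>z\<close> is \<open>E\<^sup>k z'\<close> with \<open>z'\<close> in a fixed compact half-annulus, on which \<open>|\<Pi>|\<close> is bounded by some
  \<open>r < 1\<close>; and \<open>\<Pi>(z) = P\<^sup>k(\<Pi>(z'))\<close> is then at most \<open>(p\<^sub>1 + (1 - p\<^sub>1) r)\<^sup>k\<close>.
\<close>
lemma Pf_small_at_infinity:
  assumes "e > 0"
  obtains c where "c > 0" "\<And>z. Re z \<ge> 0 \<Longrightarrow> norm z \<ge> c \<Longrightarrow> norm (Pf z) < e"
proof -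
  define K where "K = (cball 0 (\<rho> * E) - ball 0 \<rho>) \<inter> {z. Re z \<ge> 0}"
  have K: "compact K" unfolding K_def
    by (intro compact_Int_closed compact_diff compact_cball open_ball closed_halfspace_Re_ge)
  have K0: "Re z \<ge> 0 \<and> z \<noteq> 0" if "z \<in> K" for z using that rho by (auto simp: K_def)
  have "K \<subseteq> sector \<kappa>" using halfplane_sector[OF kappa] K0 by blast
  hence "continuous_on K (\<lambda>z. norm (Pf z))"
    by (intro continuous_intros holomorphic_on_imp_continuous_on holomorphic_on_subset[OF Pf_hol_sector])
  moreover have "of_real \<rho> \<in> K" using rho E_gt_1 by (auto simp: K_def)
  hence "K \<noteq> {}" by blast
  ultimately obtain m where m: "m \<in> K" "\<And>z. z \<in> K \<Longrightarrow> norm (Pf z) \<le> norm (Pf m)"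
    using continuous_attains_sup[OF K, of "\<lambda>z. norm (Pf z)"] by blast
  define r where "r = norm (Pf m)"
  have r: "0 \<le> r" "r < 1" using Pf_half[of m] K0[OF m(1)] by (auto simp: r_def)
  define l where "l = p1 + (1 - p1) * r"
  have l: "0 \<le> l" "l < 1" unfolding l_def using contraction_rate[OF r] by auto
  have "(\<lambda>k. l ^ k) \<longlonglongrightarrow> 0" using l by (intro LIMSEQ_power_zero) auto
  hence "\<forall>\<^sub>F k in sequentially. l ^ k < e" using assms by (rule order_tendstoD)
  then obtain N where N: "\<And>k. k \<ge> N \<Longrightarrow> l ^ k < e" by (auto simp: eventually_sequentially)
  show ?thesis
  proof (rule that[of "\<rho> * E ^ N"])
    show "\<rho> * E ^ N > 0" using rho E_pos by simp
    fix z assume z: "Re z \<ge> 0" "norm z \<ge> \<rho> * E ^ N"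
    have "\<rho> * 1 \<le> \<rho> * E ^ N" using rho E_gt_1 by (intro mult_left_mono) auto
    hence "\<rho> \<le> norm z" using z by simp
    then obtain k where k: "\<rho> * E ^ k \<le> norm z" "norm z < \<rho> * E ^ Suc k" using annulus_index[OF rho] by blast
    have "N < Suc k"
    proof (rule ccontr)
      assume "\<not> N < Suc k"
      hence "E ^ Suc k \<le> E ^ N" using E_gt_1 by (intro power_increasing) auto
      hence "\<rho> * E ^ Suc k \<le> \<rho> * E ^ N" using rho by (intro mult_left_mono) auto
      thus False using k z by simp
    qed
    define z' where "z' = z / of_real E ^ k"
    have nz': "norm z' = norm z / E ^ k" unfolding z'_def norm_divide norm_power norm_of_real using E_pos by simp
    have Ek: "E ^ k > 0" using E_pos by simp
    have "Re z' = Re z / E ^ k" unfolding z'_def by (metis Re_divide_of_real of_real_power)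
    hence "Re z' \<ge> 0" using z Ek by simp
    moreover have "\<rho> \<le> norm z'" "norm z' \<le> \<rho> * E" unfolding nz' using k Ek by (auto simp: field_simps)
    ultimately have z'K: "z' \<in> K" by (auto simp: K_def)
    hence "z' \<in> sector \<kappa>" using K0 halfplane_sector[OF kappa] by blast
    have "Pf z = (P ^^ k) (Pf z')" unfolding Pf_iterate[OF \<open>z' \<in> sector \<kappa>\<close>] using E_pos by (simp add: z'_def)
    moreover have "norm (Pf z') \<le> r" unfolding r_def by (rule m(2)[OF z'K])
    hence "norm ((P ^^ k) (Pf z')) \<le> l ^ k * norm (Pf z')" unfolding l_def by (rule iterate_decay(1)[OF _ r(2)])
    moreover have "l ^ k * norm (Pf z') \<le> l ^ k * 1" using \<open>norm (Pf z') \<le> r\<close> r l by (intro mult_left_mono) auto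
    moreover have "l ^ k < e" using N \<open>N < Suc k\<close> by simp
    ultimately show "norm (Pf z) < e" by simp
  qed
qed

theorem Pi_imm_eq:
  obtains c r where "c > 0" "r > 0" "gw_A_fun p q holomorphic_on ball 0 r"
    "\<And>z. Re z \<ge> 0 \<Longrightarrow> norm z \<ge> c \<Longrightarrow> norm (Wf z) < r"
    "\<And>z. Re z \<ge> 0 \<Longrightarrow> norm z \<ge> c \<Longrightarrow> gw_Pi_imm p q z = Wf z * gw_A_fun p q (Wf z) * Lf z"
proof -
  obtain r e where re: "r > 0" "e > 0" "e \<le> 1" "gw_A_fun p q holomorphic_on ball 0 r"
    "\<And>u. norm u < e \<Longrightarrow> norm (gw_Phi p u) < r"
    "\<And>u. norm u < e \<Longrightarrow> gw_Phi p u * gw_A_fun p q (gw_Phi p u) * gw_Psi p q u = u"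
    using A_fun_near_0 by blast
  obtain c where c: "c > 0" "\<And>z. Re z \<ge> 0 \<Longrightarrow> norm z \<ge> c \<Longrightarrow> norm (Pf z) < e"
    using Pf_small_at_infinity[OF re(2)] by blast
  show ?thesis
  proof (rule that[OF c(1) re(1) re(4)])
    fix z assume z: "Re z \<ge> 0" "norm z \<ge> c"
    show "norm (Wf z) < r" unfolding Wf_def by (intro re(5) c z)
    have "gw_Pi_imm p q z = Pf z * gw_R p q z" by (simp add: gw_Pi_imm_def)
    also have "Pf z = gw_Phi p (Pf z) * gw_A_fun p q (gw_Phi p (Pf z)) * gw_Psi p q (Pf z)"
      by (rule re(6)[symmetric]) (intro c z)
    finally show "gw_Pi_imm p q z = Wf z * gw_A_fun p q (Wf z) * Lf z"
      by (simp add: Wf_def Lf_def mult_ac)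
  qed
qed

lemma A_series:
  assumes "gw_A_fun p q holomorphic_on ball 0 r" "norm w < r"
  shows "(\<lambda>n. gw_A p q n * w ^ n) sums gw_A_fun p q w"
  using holomorphic_power_series[OF assms(1), of w] assms(2) by (simp add: gw_A_def)

lemma A_abs_summable:
  assumes "gw_A_fun p q holomorphic_on ball 0 r" "0 \<le> s" "s < r"
  shows "summable (\<lambda>n. norm (gw_A p q n) * s ^ n)"
proof -
  define t where "t = (s + r) / 2"
  have t: "s < t" "t < r" using assms by (auto simp: t_def)
  have "summable (\<lambda>n. gw_A p q n * of_real t ^ n)"
    using A_series[OF assms(1), of "of_real t"] t assms by (intro sums_summable[of _ "gw_A_fun p q (of_real t)"]) auto
  from powser_insidea[OF this, of "of_real s"] show ?thesis
    using t assms by (simp add: norm_mult norm_power)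
qed

end

section \<open>Integrals along vertical lines\<close>

lemma integrable_powr_decay:
  fixes g :: "real \<Rightarrow> complex"
  assumes cont: "continuous_on UNIV g" and \<delta>: "\<delta> > 1" and Y: "Y \<ge> 1" and b: "\<And>y. \<bar>y\<bar> \<ge> Y \<Longrightarrow> norm (g y) \<le> C * \<bar>y\<bar> powr (-\<delta>)"
    and C: "C \<ge> 0"
  shows "integrable lborel g"
proof -
  have "compact (g ` {-Y..Y})" using cont by (intro compact_continuous_image) (auto intro: continuous_on_subset)
  then obtain B where B: "B > 0" "\<And>y. y \<in> {-Y..Y} \<Longrightarrow> norm (g y) \<le> B"
    using compact_imp_bounded[of "g ` {-Y..Y}"] unfolding bounded_pos by auto
  define D where "D = B * (1 + Y) powr \<delta> + C * 2 powr \<delta>"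
  have "integrable lborel (\<lambda>y::real. D * (1 + \<bar>y\<bar>) powr (-\<delta>))"
    by (intro integrable_mult_right integrable_one_plus_abs_powr \<delta>)
  thus ?thesis
  proof (rule Bochner_Integration.integrable_bound)
    show "g \<in> borel_measurable lborel" using borel_measurable_continuous_onI[OF cont] by simp
    show "AE y in lborel. norm (g y) \<le> norm (D * (1 + \<bar>y\<bar>) powr (-\<delta>))"
    proof (rule AE_I2)
      fix y :: real
      have D0: "B * (1 + Y) powr \<delta> \<ge> 0" "C * 2 powr \<delta> \<ge> 0" using B C by auto
      have "norm (g y) \<le> D * (1 + \<bar>y\<bar>) powr (-\<delta>)"
      proof (cases "\<bar>y\<bar> \<ge> Y")
        case True
        have "\<bar>y\<bar> powr (-\<delta>) \<le> ((1 + \<bar>y\<bar>) / 2) powr (-\<delta>)"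
          using True Y \<delta> by (intro powr_mono2') auto
        also have "\<dots> = 2 powr \<delta> * (1 + \<bar>y\<bar>) powr (-\<delta>)"
          by (simp add: powr_divide powr_minus field_simps)
        finally have "C * \<bar>y\<bar> powr (-\<delta>) \<le> C * (2 powr \<delta> * (1 + \<bar>y\<bar>) powr (-\<delta>))" using C by (rule mult_left_mono)
        also have "\<dots> = (C * 2 powr \<delta>) * (1 + \<bar>y\<bar>) powr (-\<delta>)" by simp
        also have "\<dots> \<le> D * (1 + \<bar>y\<bar>) powr (-\<delta>)"
          using D0 by (intro mult_right_mono) (auto simp: D_def)
        finally show ?thesis using b[OF True] by simp
      next
        case False
        have "norm (g y) \<le> B" using False by (intro B) auto
        also have "B = B * ((1 + Y) powr \<delta> * (1 + Y) powr (-\<delta>))" using Y by (simp add: powr_minus)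
        also have "\<dots> \<le> B * ((1 + Y) powr \<delta> * (1 + \<bar>y\<bar>) powr (-\<delta>))"
          using False B Y \<delta> by (intro mult_left_mono powr_mono2') auto
        also have "\<dots> = (B * (1 + Y) powr \<delta>) * (1 + \<bar>y\<bar>) powr (-\<delta>)" by simp
        also have "\<dots> \<le> D * (1 + \<bar>y\<bar>) powr (-\<delta>)"
          using D0 by (intro mult_right_mono) (auto simp: D_def)
        finally show ?thesis .
      qed
      thus "norm (g y) \<le> norm (D * (1 + \<bar>y\<bar>) powr (-\<delta>))" by (simp add: abs_le_iff)
    qed
  qed
qed

lemma symmetric_integral_limit:
  fixes g :: "real \<Rightarrow> complex"
  assumes "integrable lborel g"
  shows "(\<lambda>n. integral {- real n..real n} g) \<longlonglongrightarrow> (LINT y|lborel. g y)"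
proof -
  have [measurable]: "g \<in> borel_measurable lborel" using assms by auto
  have "(\<lambda>n. LINT y|lborel. indicator {- real n..real n} y *\<^sub>R g y) \<longlonglongrightarrow> (LINT y|lborel. g y)"
  proof (rule integral_dominated_convergence[where w = "\<lambda>y. norm (g y)"])
    show "AE y in lborel. (\<lambda>n. indicator {- real n..real n} y *\<^sub>R g y) \<longlonglongrightarrow> g y"
    proof (rule AE_I2, rule tendsto_eventually)
      fix y :: real
      obtain N :: nat where N: "\<bar>y\<bar> \<le> real N" using real_arch_simple by blast
      show "\<forall>\<^sub>F n in sequentially. indicator {- real n..real n} y *\<^sub>R g y = g y"
        by (rule eventually_mono[OF eventually_ge_at_top[of N]]) (use N in \<open>auto simp: indicator_def\<close>)
    qed
    show "integrable lborel (\<lambda>y. norm (g y))" using assms by (rule integrable_norm)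
    show "AE y in lborel. norm (indicator {- real n..real n} y *\<^sub>R g y) \<le> norm (g y)" for n
      by (intro AE_I2) (auto simp: indicator_def)
  qed auto
  moreover have "(LINT y|lborel. indicator {- real n..real n} y *\<^sub>R g y) = integral {- real n..real n} g" for n
  proof -
    have "set_integrable lborel {- real n..real n} g"
      unfolding set_integrable_def using assms by (intro integrable_mult_indicator) auto
    from set_borel_integral_eq_integral(2)[OF this] show ?thesis by (simp add: set_lebesgue_integral_def)
  qed
  ultimately show ?thesis by simp
qed

text \<open>
  Instead of a contour integral over rectangles a primitive \<open>g\<close> on the starlike domain is used: the difference of
  the integrals over two vertical segments is the difference of the increments of \<open>g\<close> along the two
  horizontal edges, which tends to 0 by the decay assumption.
\<close>
lemma vertical_line_shift:
  fixes f :: "complex \<Rightarrow> complex"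
  assumes f: "f holomorphic_on S" and S: "open S" "starlike S" and half: "\<And>z. Re z \<ge> 0 \<Longrightarrow> z \<in> S" and c: "c > 0"
    and int: "integrable lborel (\<lambda>y. f (Complex 0 y))" "integrable lborel (\<lambda>y. f (Complex c y))"
    and decay: "\<And>e. e > 0 \<Longrightarrow> \<exists>Y. \<forall>a y. 0 \<le> a \<longrightarrow> a \<le> c \<longrightarrow> \<bar>y\<bar> \<ge> Y \<longrightarrow> norm (f (Complex a y)) \<le> e"
  shows "(LINT y|lborel. f (Complex 0 y)) = (LINT y|lborel. f (Complex c y))"
proof -
  obtain F where F: "\<And>z. z \<in> S \<Longrightarrow> (F has_field_derivative f z) (at z)"
    using holomorphic_starlike_primitive[of S f "{}"] f S
      holomorphic_on_imp_continuous_on holomorphic_on_imp_differentiable_at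
    by (metis Diff_empty finite.emptyI)
  have line: "integral {-Y..Y} (\<lambda>y. f (Complex a y)) = (F (Complex a Y) - F (Complex a (-Y))) / \<i>" if a: "a \<ge> 0" "Y \<ge> 0" for a Y
  proof -
    have "((\<lambda>y. f (Complex a y)) has_integral ((\<lambda>y. F (Complex a y) / \<i>) Y - (\<lambda>y. F (Complex a y) / \<i>) (-Y))) {-Y..Y}"
    proof (rule fundamental_theorem_of_calculus)
      fix y assume "y \<in> {-Y..Y}"
      have "((\<lambda>y. Complex a y) has_vector_derivative \<i>) (at y within {-Y..Y})"
        unfolding Complex_eq by (auto intro!: derivative_eq_intros)
      moreover have "(F has_field_derivative f (Complex a y)) (at (Complex a y) within (\<lambda>y. Complex a y) ` {-Y..Y})"
        using F[OF half, of "Complex a y"] a by (auto intro: has_field_derivative_at_within)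
      ultimately have "(F \<circ> (\<lambda>y. Complex a y) has_vector_derivative \<i> * f (Complex a y)) (at y within {-Y..Y})"
        by (rule field_vector_diff_chain_within)
      hence "((\<lambda>y. F (Complex a y)) has_vector_derivative \<i> * f (Complex a y)) (at y within {-Y..Y})"
        by (simp add: o_def)
      from has_vector_derivative_divide[OF this, of \<i>]
      show "((\<lambda>y. F (Complex a y) / \<i>) has_vector_derivative f (Complex a y)) (at y within {-Y..Y})" by simp
    qed (use a in auto)
    from integral_unique[OF this] show ?thesis by (simp only: diff_divide_distrib)
  qed
  have hor: "norm (F (Complex c y) - F (Complex 0 y)) \<le> e * c" if e: "\<And>a. 0 \<le> a \<Longrightarrow> a \<le> c \<Longrightarrow> norm (f (Complex a y)) \<le> e" for e y
  proof -
    have "norm (F (Complex c y) - F (Complex 0 y)) \<le> e * norm (Complex c y - Complex 0 y)"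
    proof (rule field_differentiable_bound[of "closed_segment (Complex 0 y) (Complex c y)"])
      have seg: "\<exists>a. 0 \<le> a \<and> a \<le> c \<and> z = Complex a y" if zc: "z \<in> closed_segment (Complex 0 y) (Complex c y)" for z
      proof -
        obtain u where u: "0 \<le> u" "u \<le> 1" "z = (1 - u) *\<^sub>R Complex 0 y + u *\<^sub>R Complex c y"
          using zc unfolding in_segment by blast
        have "z = Complex (u * c) y" unfolding u(3) by (simp add: complex_eq_iff algebra_simps)
        moreover have "u * c \<le> 1 * c" using u c by (intro mult_right_mono) auto
        ultimately show ?thesis using u c by (intro exI[of _ "u * c"]) auto
      qed
      show "(F has_field_derivative f z) (at z within closed_segment (Complex 0 y) (Complex c y))"
        if "z \<in> closed_segment (Complex 0 y) (Complex c y)" for z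
        using seg[OF that] F[OF half, of z] by (auto intro: has_field_derivative_at_within)
      show "norm (f z) \<le> e" if "z \<in> closed_segment (Complex 0 y) (Complex c y)" for z
        using seg[OF that] e by auto
    qed auto
    also have "Complex c y - Complex 0 y = of_real c" by (simp add: complex_eq_iff)
    finally show ?thesis using c by simp
  qed
  have "(\<lambda>n. integral {- real n..real n} (\<lambda>y. f (Complex c y)) - integral {- real n..real n} (\<lambda>y. f (Complex 0 y))) \<longlonglongrightarrow> 0"
  proof (rule LIMSEQ_I)
    fix \<epsilon> :: real assume \<epsilon>: "\<epsilon> > 0"
    have "\<epsilon> / (4 * c) > 0" using \<epsilon> c by simp
    then obtain Y where Y: "\<And>a y. 0 \<le> a \<Longrightarrow> a \<le> c \<Longrightarrow> \<bar>y\<bar> \<ge> Y \<Longrightarrow> norm (f (Complex a y)) \<le> \<epsilon> / (4 * c)"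
      using decay by meson
    obtain N :: nat where N: "Y \<le> real N" using real_arch_simple by blast
    show "\<exists>N. \<forall>n\<ge>N. norm (integral {- real n..real n} (\<lambda>y. f (Complex c y)) - integral {- real n..real n} (\<lambda>y. f (Complex 0 y)) - 0) < \<epsilon>"
    proof (intro exI[of _ N] allI impI)
      fix n assume n: "n \<ge> N"
      have h1: "norm (F (Complex c (real n)) - F (Complex 0 (real n))) \<le> \<epsilon> / (4 * c) * c"
        by (rule hor, rule Y) (use n N in auto)
      have h2: "norm (F (Complex c (- real n)) - F (Complex 0 (- real n))) \<le> \<epsilon> / (4 * c) * c"
        by (rule hor, rule Y) (use n N in auto)
      have "integral {- real n..real n} (\<lambda>y. f (Complex c y)) - integral {- real n..real n} (\<lambda>y. f (Complex 0 y))
         = ((F (Complex c (real n)) - F (Complex 0 (real n))) - (F (Complex c (- real n)) - F (Complex 0 (- real n)))) / \<i>"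
      proof -
        have gen: "(a - b) / k - (a' - b') / k = ((a - a') - (b - b')) / k" for a b a' b' k :: complex
          by (simp add: diff_divide_distrib)
        show ?thesis using c by (subst (1 2) line) (auto simp only: gen)
      qed
      also have "norm \<dots> = norm ((F (Complex c (real n)) - F (Complex 0 (real n))) - (F (Complex c (- real n)) - F (Complex 0 (- real n))))"
        by (simp only: norm_divide norm_ii div_by_1)
      also have "\<dots> \<le> \<epsilon> / (4 * c) * c + \<epsilon> / (4 * c) * c"
        by (rule order_trans[OF norm_triangle_ineq4 add_mono[OF h1 h2]])
      also have "\<dots> < \<epsilon>" using \<epsilon> c by simp
      finally show "norm (integral {- real n..real n} (\<lambda>y. f (Complex c y)) - integral {- real n..real n} (\<lambda>y. f (Complex 0 y)) - 0) < \<epsilon>" by simp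
    qed
  qed
  moreover have "(\<lambda>n. integral {- real n..real n} (\<lambda>y. f (Complex c y)) - integral {- real n..real n} (\<lambda>y. f (Complex 0 y))) \<longlonglongrightarrow>
      (LINT y|lborel. f (Complex c y)) - (LINT y|lborel. f (Complex 0 y))"
    by (intro tendsto_diff symmetric_integral_limit int)
  ultimately have "(LINT y|lborel. f (Complex c y)) - (LINT y|lborel. f (Complex 0 y)) = 0" using LIMSEQ_unique by blast
  thus ?thesis by simp
qed

text \<open>
  Term-by-term integration of a series over the natural numbers, transported along a bijection.
\<close>
lemma integral_has_sum_int:
  fixes g :: "int \<Rightarrow> real \<Rightarrow> complex"
  assumes int: "\<And>m. integrable lborel (g m)" and hs: "\<And>y. ((\<lambda>m. g m y) has_sum S y) UNIV"
    and sm: "(\<lambda>m. LINT y|lborel. norm (g m y)) summable_on UNIV"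
  shows "((\<lambda>m. LINT y|lborel. g m y) has_sum (LINT y|lborel. S y)) UNIV"
proof -
  have bij: "bij_betw int_decode UNIV UNIV" by (rule bij_int_decode)
  define f where "f = (\<lambda>k. g (int_decode k))"
  have "((\<lambda>k. f k y) has_sum S y) UNIV" for y
    unfolding f_def using hs[of y] has_sum_reindex_bij_betw[OF bij, of "\<lambda>m. g m y"] by simp
  hence fs: "(\<lambda>k. f k y) sums S y" for y by (rule has_sum_imp_sums)
  have fn: "summable (\<lambda>k. norm (f k y))" for y
  proof -
    have "(\<lambda>k. f k y) summable_on UNIV" using \<open>\<And>y. ((\<lambda>k. f k y) has_sum S y) UNIV\<close> by (auto simp: summable_on_def)
    hence "(\<lambda>k. norm (f k y)) summable_on UNIV" by (simp add: summable_on_iff_abs_summable_on_complex)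
    thus ?thesis by (simp add: summable_on_UNIV_nonneg_real_iff)
  qed
  have fi: "summable (\<lambda>k. LINT y|lborel. norm (f k y))"
  proof -
    have "(\<lambda>k. LINT y|lborel. norm (f k y)) summable_on UNIV"
      unfolding f_def using sm summable_on_reindex_bij_betw[OF bij, of "\<lambda>m. LINT y|lborel. norm (g m y)"] by simp
    thus ?thesis by (simp add: summable_on_UNIV_nonneg_real_iff)
  qed
  have "(\<lambda>k. LINT y|lborel. f k y) sums (LINT y|lborel. (\<Sum>k. f k y))"
    by (rule sums_integral) (use int fn fi in \<open>auto simp: f_def\<close>)
  hence s: "(\<lambda>k. LINT y|lborel. f k y) sums (LINT y|lborel. S y)" using fs by (simp add: sums_iff)
  have "summable (\<lambda>k. norm (LINT y|lborel. f k y))"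
    by (rule summable_comparison_test[OF _ fi]) auto
  from norm_summable_imp_has_sum[OF this s] have "((\<lambda>k. LINT y|lborel. g (int_decode k) y) has_sum (LINT y|lborel. S y)) UNIV"
    by (simp add: f_def)
  thus ?thesis using has_sum_reindex_bij_betw[OF bij, of "\<lambda>m. LINT y|lborel. g m y"] by simp
qed

context gw_sector
begin

lemma halfplane_Om: "Re z \<ge> 0 \<Longrightarrow> z \<in> Om"
  using halfplane_sector[OF kappa, of z] rho by (cases "z = 0") auto

text \<open>
  The centre is 1.  On the segment from 1 to a point of the sector the ratio of the real part to the modulus of the
  imaginary part is never below that of the end point; on the segment to a point of the disc, the part with negative real part stays in the disc.
\<close>
lemma starlike_Om: "starlike Om"
  unfolding starlike_def
proof (intro bexI[of _ "1::complex"] ballI subsetI)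
  show "1 \<in> Om" by (rule halfplane_Om) simp
  fix z x assume z: "z \<in> Om" and x: "x \<in> closed_segment 1 z"
  obtain u where u: "0 \<le> u" "u \<le> 1" "x = (1 - u) *\<^sub>R 1 + u *\<^sub>R z"
    using x by (auto simp: closed_segment_def)
  have re: "Re x = (1 - u) + u * Re z" and im: "Im x = u * Im z" unfolding u(3) by simp_all
  show "x \<in> Om"
  proof (cases "Re x \<ge> 0")
    case True
    thus ?thesis by (rule halfplane_Om)
  next
    case False
    show ?thesis
    proof (cases "z \<in> sector \<kappa>")
      case True
      have "u \<noteq> 0" using False re by auto
      hence u0: "u > 0" using u by simp
      have "u * Re z > u * (- \<kappa> * \<bar>Im z\<bar>)" using True u0 unfolding sector_def by (intro mult_strict_left_mono) auto
      hence "Re x > - \<kappa> * \<bar>Im x\<bar>" unfolding re im using u u0 by (simp add: abs_mult algebra_simps)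
      thus ?thesis by (simp add: sector_def)
    next
      case F: False
      hence nz: "norm z < \<rho>" using z by simp
      have "u * Re z \<le> Re x" unfolding re using u by simp
      hence "\<bar>Re x\<bar> \<le> \<bar>u * Re z\<bar>" using False by simp
      also have "\<dots> \<le> 1 * \<bar>Re z\<bar>" unfolding abs_mult using u by (intro mult_right_mono) auto
      finally have 1: "(Re x)\<^sup>2 \<le> (Re z)\<^sup>2" by (simp add: abs_le_square_iff)
      have "\<bar>Im x\<bar> \<le> 1 * \<bar>Im z\<bar>" unfolding im abs_mult using u by (intro mult_right_mono) auto
      hence 2: "(Im x)\<^sup>2 \<le> (Im z)\<^sup>2" by (simp add: abs_le_square_iff)
      have "norm x \<le> norm z" unfolding cmod_def using 1 2 by (intro real_sqrt_le_mono add_mono)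
      thus ?thesis using nz by simp
    qed
  qed
qed

lemma Pi_imm_hol: "gw_Pi_imm p q holomorphic_on Om"
  unfolding gw_Pi_imm_def[abs_def] by (intro holomorphic_intros Pf_hol R_product)

lemma log_p1_neg: "log E p1 < 0" and log_q0_le: "log E q0 \<le> 0"
  using p1_pos p1_less q0_pos q0_le_1 lnE_pos by (auto simp: log_def divide_neg_pos divide_nonpos_pos)

lemma log_p1q0: "log E (p1 * q0) = log E p1 + log E q0"
  using p1_pos q0_pos lnE_pos by (simp add: log_def ln_mult add_divide_distrib)

lemma continuous_line:
  assumes "f holomorphic_on Om" "a \<ge> 0"
  shows "continuous_on UNIV (\<lambda>y. f (Complex a y))"
proof (rule continuous_on_compose2[OF holomorphic_on_imp_continuous_on[OF assms(1)]])
  show "continuous_on UNIV (\<lambda>y. Complex a y)" unfolding Complex_eq by (intro continuous_intros)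
  show "range (\<lambda>y. Complex a y) \<subseteq> Om" by (rule image_subsetI, rule halfplane_Om) (use assms(2) in simp)
qed

lemma continuous_line_sector:
  assumes "f holomorphic_on sector \<kappa>" "a > 0"
  shows "continuous_on UNIV (\<lambda>y. f (Complex a y))"
proof (rule continuous_on_compose2[OF holomorphic_on_imp_continuous_on[OF assms(1)]])
  show "continuous_on UNIV (\<lambda>y. Complex a y)" unfolding Complex_eq by (intro continuous_intros)
  show "range (\<lambda>y. Complex a y) \<subseteq> sector \<kappa>"
    by (rule image_subsetI, rule halfplane_sector[OF kappa]) (use assms(2) in \<open>auto simp: complex_eq_iff\<close>)
qed

end

section \<open>Term-by-term inversion and coefficient bounds\<close>

text \<open>
  Absorbs the geometric factors \<open>C\<^sup>n\<close> that come from \<open>A\<^sub>n\<close> and from the bound of \<open>K\<close> into half of the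
  super-exponential decay.
\<close>
lemma n_ln_n_dominates:
  fixes a K :: real assumes a: "a > 0"
  shows "\<exists>B. \<forall>n::nat. K * real n - a * real n * ln (real n + 1) \<le> B"
proof -
  define K' where "K' = max K 0"
  show ?thesis
  proof (intro exI allI)
    fix n :: nat
    show "K * real n - a * real n * ln (real n + 1) \<le> K' * exp (K' / a)"
    proof (cases "ln (real n + 1) \<ge> K' / a")
      case True
      hence "K' \<le> a * ln (real n + 1)" using a by (simp add: field_simps)
      hence "real n * K' \<le> real n * (a * ln (real n + 1))" by (intro mult_left_mono) auto
      moreover have "real n * K \<le> real n * K'" by (intro mult_left_mono) (auto simp: K'_def)
      moreover have "0 \<le> K' * exp (K' / a)" by (simp add: K'_def)
      ultimately show ?thesis by (simp add: mult_ac)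
    next
      case False
      hence "real n + 1 < exp (K' / a)" by (metis exp_less_cancel_iff exp_ln linorder_not_le of_nat_0_le_iff add_nonneg_pos zero_less_one)
      hence "K' * real n \<le> K' * exp (K' / a)" by (intro mult_left_mono) (auto simp: K'_def)
      moreover have "K * real n \<le> K' * real n" by (intro mult_right_mono) (auto simp: K'_def)
      moreover have "a * real n * ln (real n + 1) \<ge> 0" using a by simp
      ultimately show ?thesis by linarith
    qed
  qed
qed

text \<open>
  The half-plane far from the origin, where \<open>w\<close> stays well inside a disc on which \<open>A\<close> is
  holomorphic and the expansion of \<open>\<Pi> R\<close> holds.  The bounds are those of \<open>K\<close> and \<open>L\<close> on the closed strip
  of half-width \<open>h1\<close>.
\<close>
locale gw_tail = gw_sector +
  fixes T rA CK CL :: real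
  assumes T_ge_1: "T \<ge> 1" and rA_pos: "rA > 0" and CK_pos: "CK > 0" and CL_pos: "CL > 0"
    and A_hol: "gw_A_fun p q holomorphic_on ball 0 rA"
    and Kt_le: "\<And>w. \<bar>Im w\<bar> \<le> h1 \<Longrightarrow> norm (Kt w) \<le> CK"
    and Lt_le: "\<And>w. \<bar>Im w\<bar> \<le> h1 \<Longrightarrow> norm (Lt w) \<le> CL"
    and Wf_le: "\<And>z. Re z \<ge> 0 \<Longrightarrow> norm z \<ge> T \<Longrightarrow> norm (Wf z) \<le> CK * norm z powr (log E p1)"
    and Wf_small: "\<And>z. Re z \<ge> 0 \<Longrightarrow> norm z \<ge> T \<Longrightarrow> norm (Wf z) \<le> rA / 2"
    and Lf_le: "\<And>z. Re z \<ge> 0 \<Longrightarrow> norm z \<ge> T \<Longrightarrow> norm (Lf z) \<le> CL * norm z powr (log E q0)"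
    and Pi_imm_tail: "\<And>z. Re z \<ge> 0 \<Longrightarrow> norm z \<ge> T \<Longrightarrow> gw_Pi_imm p q z = Wf z * gw_A_fun p q (Wf z) * Lf z"

context gw_sector
begin

theorem gw_tail_exists: "\<exists>T rA CK CL. gw_tail p q R \<rho> \<kappa> T rA CK CL"
proof -
  obtain CK CL where CK: "CK > 0" "CL > 0" "\<And>w. \<bar>Im w\<bar> \<le> h1 \<Longrightarrow> norm (Kt w) \<le> CK" "\<And>w. \<bar>Im w\<bar> \<le> h1 \<Longrightarrow> norm (Lt w) \<le> CL"
    by (rule Kt_Lt_bounded) (rule that, assumption+)
  obtain c r where cr: "c > 0" "r > 0" "gw_A_fun p q holomorphic_on ball 0 r"
    "\<And>z. Re z \<ge> 0 \<Longrightarrow> norm z \<ge> c \<Longrightarrow> norm (Wf z) < r"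
    "\<And>z. Re z \<ge> 0 \<Longrightarrow> norm z \<ge> c \<Longrightarrow> gw_Pi_imm p q z = Wf z * gw_A_fun p q (Wf z) * Lf z"
    by (rule Pi_imm_eq) (rule that, assumption+)
  have "((\<lambda>t. CK * t powr (log E p1)) \<longlongrightarrow> CK * 0) at_top"
    by (intro tendsto_intros tendsto_neg_powr log_p1_neg filterlim_ident)
  hence "\<forall>\<^sub>F t in at_top. CK * t powr (log E p1) < r / 2" using cr(2) by (intro order_tendstoD(2)) auto
  then obtain T0 where T0: "\<And>t. t \<ge> T0 \<Longrightarrow> CK * t powr (log E p1) < r / 2" by (auto simp: eventually_at_top_linorder)
  define T where "T = max (max c 1) T0"
  have T: "T \<ge> 1" "T \<ge> c" "T \<ge> T0" by (auto simp: T_def)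
  have W: "norm (Wf z) \<le> CK * norm z powr (log E p1)" "norm (Lf z) \<le> CL * norm z powr (log E q0)"
    if z: "Re z \<ge> 0" "norm z \<ge> T" for z
  proof -
    have "z \<noteq> 0" using z T by auto
    thus "norm (Wf z) \<le> CK * norm z powr (log E p1)" "norm (Lf z) \<le> CL * norm z powr (log E q0)"
      using norm_Wf_Lf[OF z(1)] CK(3,4)[OF strip_coord(2)[OF z(1)]]
      by (simp_all add: mult.commute mult_right_mono)
  qed
  have "gw_tail p q R \<rho> \<kappa> T r CK CL"
  proof unfold_locales
    fix z assume z: "Re z \<ge> 0" "norm z \<ge> T"
    show "norm (Wf z) \<le> r / 2" using W(1)[OF z] T0[of "norm z"] z T by linarith
    show "gw_Pi_imm p q z = Wf z * gw_A_fun p q (Wf z) * Lf z" using z T by (intro cr(5)) auto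
  qed (use T cr CK W in auto)
  thus ?thesis by blast
qed

end

context gw_tail
begin

lemma Pi_imm_decay:
  obtains C where "C \<ge> 0" "\<And>z. Re z \<ge> 0 \<Longrightarrow> norm z \<ge> T \<Longrightarrow> norm (gw_Pi_imm p q z) \<le> C * norm z powr (log E (p1 * q0))"
proof -
  have "cball 0 (rA/2) \<subseteq> ball (0::complex) rA" using rA_pos by auto
  hence "compact (gw_A_fun p q ` cball 0 (rA/2))"
    by (intro compact_continuous_image compact_cball holomorphic_on_imp_continuous_on[OF holomorphic_on_subset[OF A_hol]])
  then obtain B where B: "B > 0" "\<And>w. w \<in> cball 0 (rA/2) \<Longrightarrow> norm (gw_A_fun p q w) \<le> B"
    using compact_imp_bounded[of "gw_A_fun p q ` cball 0 (rA/2)"] unfolding bounded_pos by auto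
  show ?thesis
  proof (rule that[of "CK * B * CL"])
    fix z assume z: "Re z \<ge> 0" "norm z \<ge> T"
    have "norm (gw_Pi_imm p q z) = norm (Wf z) * norm (gw_A_fun p q (Wf z)) * norm (Lf z)"
      unfolding Pi_imm_tail[OF z] norm_mult ..
    also have "\<dots> \<le> (CK * norm z powr (log E p1)) * B * (CL * norm z powr (log E q0))"
      using Wf_le[OF z] Wf_small[OF z] Lf_le[OF z] B(2)[of "Wf z"] B(1) CK_pos CL_pos by (intro mult_mono) auto
    also have "\<dots> = CK * B * CL * norm z powr (log E (p1 * q0))"
      unfolding log_p1q0 powr_add by (simp add: mult_ac)
    finally show "norm (gw_Pi_imm p q z) \<le> CK * B * CL * norm z powr (log E (p1 * q0))" .
  qed (use T_ge_1 CK_pos CL_pos B in auto)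
qed

lemma line_decay:
  assumes x: "x > 0" and "c > 0"
  obtains Y C where "Y \<ge> 1" "C \<ge> 0" "\<And>a y. 0 \<le> a \<Longrightarrow> a \<le> c \<Longrightarrow> \<bar>y\<bar> \<ge> Y \<Longrightarrow>
      norm (gw_Pi_imm p q (Complex a y) * exp (Complex a y * of_real x)) \<le> C * \<bar>y\<bar> powr (log E (p1 * q0))"
proof -
  obtain C where Y: "C \<ge> 0" "\<And>z. Re z \<ge> 0 \<Longrightarrow> norm z \<ge> T \<Longrightarrow> norm (gw_Pi_imm p q z) \<le> C * norm z powr (log E (p1 * q0))"
    by (rule Pi_imm_decay) (rule that, assumption+)
  show ?thesis
  proof (rule that[of T "C * exp (c * x)"])
    fix a y :: real assume a: "0 \<le> a" "a \<le> c" and y: "\<bar>y\<bar> \<ge> T"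
    have ny: "\<bar>y\<bar> \<le> norm (Complex a y)" using abs_Im_le_cmod[of "Complex a y"] by simp
    have "log E (p1 * q0) \<le> 0" unfolding log_p1q0 using log_p1_neg log_q0_le by simp
    hence "norm (Complex a y) powr (log E (p1 * q0)) \<le> \<bar>y\<bar> powr (log E (p1 * q0))"
      using ny y T_ge_1 by (intro powr_mono2') auto
    hence "C * norm (Complex a y) powr (log E (p1 * q0)) \<le> C * \<bar>y\<bar> powr (log E (p1 * q0))" using Y(1) by (rule mult_left_mono)
    moreover have "norm (gw_Pi_imm p q (Complex a y)) \<le> C * norm (Complex a y) powr (log E (p1 * q0))"
      using ny y a by (intro Y(2)) auto
    ultimately have 1: "norm (gw_Pi_imm p q (Complex a y)) \<le> C * \<bar>y\<bar> powr (log E (p1 * q0))" by linarith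
    have 2: "norm (exp (Complex a y * of_real x)) \<le> exp (c * x)" using a x by (simp add: mult_right_mono)
    have "norm (gw_Pi_imm p q (Complex a y) * exp (Complex a y * of_real x)) \<le> (C * \<bar>y\<bar> powr (log E (p1 * q0))) * exp (c * x)"
      unfolding norm_mult using 1 2 Y(1) by (intro mult_mono) auto
    thus "norm (gw_Pi_imm p q (Complex a y) * exp (Complex a y * of_real x)) \<le> C * exp (c * x) * \<bar>y\<bar> powr (log E (p1 * q0))"
      by (simp add: mult_ac)
  qed (use Y T_ge_1 in auto)
qed

lemma integrand_hol: "(\<lambda>z. gw_Pi_imm p q z * exp (z * of_real x)) holomorphic_on Om"
  by (intro holomorphic_intros Pi_imm_hol)

lemma line_integrable:
  assumes d: "log E (p1 * q0) < -1" and x: "x > 0" and a: "a \<ge> 0"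
  shows "integrable lborel (\<lambda>y. gw_Pi_imm p q (Complex a y) * exp (Complex a y * of_real x))"
proof -
  have "a + 1 > 0" using a by simp
  obtain Y C where Y: "Y \<ge> 1" "C \<ge> 0" "\<And>b y. 0 \<le> b \<Longrightarrow> b \<le> a + 1 \<Longrightarrow> \<bar>y\<bar> \<ge> Y \<Longrightarrow>
      norm (gw_Pi_imm p q (Complex b y) * exp (Complex b y * of_real x)) \<le> C * \<bar>y\<bar> powr (log E (p1 * q0))"
    by (rule line_decay[OF x \<open>a + 1 > 0\<close>]) (rule that, assumption+)
  show ?thesis
  proof (rule integrable_powr_decay[of _ "- log E (p1 * q0)" Y C])
    show "continuous_on UNIV (\<lambda>y. gw_Pi_imm p q (Complex a y) * exp (Complex a y * of_real x))"
      by (rule continuous_line[OF integrand_hol a])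
    show "norm (gw_Pi_imm p q (Complex a y) * exp (Complex a y * of_real x)) \<le> C * \<bar>y\<bar> powr - (- log E (p1 * q0))" if "\<bar>y\<bar> \<ge> Y" for y
      using Y(3)[of a y] that a by simp
  qed (use d Y in auto)
qed

theorem p_imm_shifted_line:
  assumes d: "log E (p1 * q0) < -1" and x: "x > 0" and c: "c > 0"
  shows "gw_p_imm p q x = 1 / (2 * of_real pi) * (LINT y|lborel. gw_Pi_imm p q (Complex c y) * exp (Complex c y * of_real x))"
proof -
  obtain Y C where Y: "Y \<ge> 1" "C \<ge> 0" "\<And>a y. 0 \<le> a \<Longrightarrow> a \<le> c \<Longrightarrow> \<bar>y\<bar> \<ge> Y \<Longrightarrow>
      norm (gw_Pi_imm p q (Complex a y) * exp (Complex a y * of_real x)) \<le> C * \<bar>y\<bar> powr (log E (p1 * q0))"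
    by (rule line_decay[OF x c]) (rule that, assumption+)
  have "(LINT y|lborel. gw_Pi_imm p q (Complex 0 y) * exp (Complex 0 y * of_real x)) = (LINT y|lborel. gw_Pi_imm p q (Complex c y) * exp (Complex c y * of_real x))"
  proof (rule vertical_line_shift[OF integrand_hol open_Om starlike_Om halfplane_Om c])
    show "integrable lborel (\<lambda>y. gw_Pi_imm p q (Complex 0 y) * exp (Complex 0 y * of_real x))"
      by (rule line_integrable[OF d x]) simp
    show "integrable lborel (\<lambda>y. gw_Pi_imm p q (Complex c y) * exp (Complex c y * of_real x))"
      using c by (intro line_integrable[OF d x]) simp
    fix e :: real assume e: "e > 0"
    have "((\<lambda>t. C * t powr (log E (p1 * q0))) \<longlongrightarrow> C * 0) at_top"
      by (intro tendsto_intros tendsto_neg_powr filterlim_ident) (use d in simp)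
    hence "\<forall>\<^sub>F t in at_top. C * t powr (log E (p1 * q0)) < e" using e by (intro order_tendstoD(2)) auto
    then obtain T where T: "\<And>t. t \<ge> T \<Longrightarrow> C * t powr (log E (p1 * q0)) < e" by (auto simp: eventually_at_top_linorder)
    show "\<exists>Y. \<forall>a y. 0 \<le> a \<longrightarrow> a \<le> c \<longrightarrow> Y \<le> \<bar>y\<bar> \<longrightarrow> norm (gw_Pi_imm p q (Complex a y) * exp (Complex a y * of_real x)) \<le> e"
    proof (intro exI[of _ "max Y T"] allI impI)
      fix a y :: real assume a: "0 \<le> a" "a \<le> c" "max Y T \<le> \<bar>y\<bar>"
      show "norm (gw_Pi_imm p q (Complex a y) * exp (Complex a y * of_real x)) \<le> e"
        using Y(3)[of a y] T[of "\<bar>y\<bar>"] a by simp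
    qed
  qed
  moreover have "Complex 0 y = \<i> * of_real y" for y by (simp add: Complex_eq)
  ultimately show ?thesis unfolding gw_p_imm_def by simp
qed

text \<open>
  What remains of the decay rate \<open>2\<pi> h1\<close> of the Fourier coefficients after paying for the growth
  \<open>exp (\<pi>|Im s|/2) = exp (\<pi>\<^sup>2|m|/ln E)\<close> of \<open>1/\<Gamma>\<close>.
\<close>
definition decay_rate :: real where "decay_rate = 2 * pi * (h1 - pi / (2 * ln E))"

lemma decay_rate_pos: "decay_rate > 0" unfolding decay_rate_def using strip_widths(1) by simp

lemma summable_exp_abs_int: "\<beta> > 0 \<Longrightarrow> (\<lambda>m::int. exp (- (\<beta> * \<bar>real_of_int m\<bar>))) summable_on UNIV"
proof -
  assume b: "\<beta> > 0"
  have "(exp (-\<beta>)) ^ nat \<bar>m\<bar> = exp (- (\<beta> * \<bar>real_of_int m\<bar>))" for m :: int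
    by (simp add: exp_of_nat_mult[symmetric] mult.commute)
  thus ?thesis using summable_on_int_geometric[of "exp (-\<beta>)"] b by simp
qed

lemma theta_phase_bound:
  shows "norm (gw_theta p q n m) * exp (\<bar>Im (sexp n m)\<bar> * (pi / 2)) \<le> CK ^ (n + 1) * CL * exp (- (decay_rate * \<bar>real_of_int m\<bar>))"
proof -
  have im: "\<bar>Im (sexp n m)\<bar> = 2 * pi * \<bar>real_of_int m\<bar> / ln E"
    unfolding sexp_Im using lnE_pos by (simp add: abs_mult)
  have "norm (gw_theta p q n m) * exp (2 * pi * \<bar>real_of_int m\<bar> / ln E * (pi / 2)) \<le> 
     CK ^ (n + 1) * CL * exp (- (2 * pi * h1 * \<bar>real_of_int m\<bar>)) * exp (2 * pi * \<bar>real_of_int m\<bar> / ln E * (pi / 2))"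
    by (intro mult_right_mono theta_bound[OF Kt_le Lt_le CK_pos CL_pos]) auto
  also have "\<dots> = CK ^ (n + 1) * CL * exp (- (2 * pi * h1 * \<bar>real_of_int m\<bar>) + 2 * pi * \<bar>real_of_int m\<bar> / ln E * (pi / 2))"
    by (simp only: exp_add mult.assoc)
  also have "- (2 * pi * h1 * \<bar>real_of_int m\<bar>) + 2 * pi * \<bar>real_of_int m\<bar> / ln E * (pi / 2) = - (decay_rate * \<bar>real_of_int m\<bar>)"
    unfolding decay_rate_def by (simp add: algebra_simps)
  finally show ?thesis unfolding im .
qed

lemma sexp_Re_ge: 
  assumes "log E (p1 * q0) < -1" 
  shows "Re (sexp n m) > 1" "Re (sexp n m) = real n * (- log E p1) + (- log E (p1 * q0))"
proof -
  show 1: "Re (sexp n m) = real n * (- log E p1) + (- log E (p1 * q0))"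
    unfolding sexp_Re' log_p1q0 by (simp add: algebra_simps)
  have "real n * (- log E p1) \<ge> 0" using log_p1_neg by (intro mult_nonneg_nonneg) auto
  thus "Re (sexp n m) > 1" unfolding 1 using assms by linarith
qed

theorem W_line_integral:
  assumes d: "log E (p1 * q0) < -1" and x: "x > 0" and c: "c > 0"
  shows "((\<lambda>m. gw_theta p q n m * (2 * of_real pi * exp ((sexp n m - 1) * of_real (ln x)) / Gamma (sexp n m))) has_sum
     (LINT y|lborel. Wf (Complex c y) ^ (n + 1) * Lf (Complex c y) * exp (Complex c y * of_real x))) UNIV"
proof -
  define \<sigma> where "\<sigma> = Re (sexp n 0)"
  have \<sigma>: "Re (sexp n m) = \<sigma>" for m unfolding \<sigma>_def sexp_Re ..
  have \<sigma>1: "\<sigma> > 1" unfolding \<sigma>_def by (rule sexp_Re_ge[OF d])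
  define g where "g = (\<lambda>m y. gw_theta p q n m * (Complex c y powr (- sexp n m) * exp (Complex c y * of_real x)))"
  define I where "I = (LINT y|lborel. norm (Complex c y) powr (-\<sigma>))"
  have Iint: "integrable lborel (\<lambda>y. norm (Complex c y) powr (-\<sigma>))" by (rule integrable_vertical_line_powr[OF \<sigma>1 c])
  have I0: "I \<ge> 0" unfolding I_def by (intro Bochner_Integration.integral_nonneg) auto
  have inv: "integrable lborel (\<lambda>y. Complex c y powr (- sexp n m) * exp (Complex c y * of_real x))"
    "(LINT y|lborel. Complex c y powr (- sexp n m) * exp (Complex c y * of_real x)) = 2 * of_real pi * exp ((sexp n m - 1) * of_real (ln x)) / Gamma (sexp n m)" for m
    using inverse_laplace_powr[of "sexp n m" c x] \<sigma>1 \<sigma>[of m] c x by auto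
  have gi: "integrable lborel (g m)" for m unfolding g_def by (rule integrable_mult_right) (rule inv)
  have gI: "(LINT y|lborel. g m y) = gw_theta p q n m * (2 * of_real pi * exp ((sexp n m - 1) * of_real (ln x)) / Gamma (sexp n m))" for m
    unfolding g_def integral_mult_right_zero inv(2) ..
  have gn: "norm (g m y) \<le> CK ^ (n + 1) * CL * exp (- (decay_rate * \<bar>real_of_int m\<bar>)) * exp (c * x) * norm (Complex c y) powr (-\<sigma>)" for m y
  proof -
    have "norm (g m y) = norm (gw_theta p q n m) * norm (Complex c y powr (- sexp n m)) * exp (c * x)"
      by (simp add: g_def norm_mult)
    also have "\<dots> \<le> norm (gw_theta p q n m) * (norm (Complex c y) powr (-\<sigma>) * exp (\<bar>Im (sexp n m)\<bar> * (pi / 2))) * exp (c * x)"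
      using norm_powr_right_halfplane_le[of "Complex c y" "sexp n m"] c \<sigma>[of m]
      by (intro mult_right_mono mult_left_mono) auto
    also have "\<dots> = (norm (gw_theta p q n m) * exp (\<bar>Im (sexp n m)\<bar> * (pi / 2))) * (exp (c * x) * norm (Complex c y) powr (-\<sigma>))"
      by (simp add: mult_ac)
    also have "\<dots> \<le> (CK ^ (n + 1) * CL * exp (- (decay_rate * \<bar>real_of_int m\<bar>))) * (exp (c * x) * norm (Complex c y) powr (-\<sigma>))"
      by (intro mult_right_mono theta_phase_bound) auto
    finally show ?thesis by (simp add: mult_ac)
  qed
  have "((\<lambda>m. LINT y|lborel. g m y) has_sum (LINT y|lborel. Wf (Complex c y) ^ (n + 1) * Lf (Complex c y) * exp (Complex c y * of_real x))) UNIV"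
  proof (rule integral_has_sum_int[OF gi])
    show "((\<lambda>m. g m y) has_sum Wf (Complex c y) ^ (n + 1) * Lf (Complex c y) * exp (Complex c y * of_real x)) UNIV" for y
    proof -
      have "Complex c y \<noteq> 0" using c by (simp add: complex_eq_iff)
      hence "((\<lambda>m. gw_theta p q n m * Complex c y powr (- sexp n m)) has_sum (Wf (Complex c y) ^ (n + 1) * Lf (Complex c y))) UNIV"
        using c by (intro Wf_Lf_expansion) auto
      from has_sum_cmult_left[OF this, of "exp (Complex c y * of_real x)"] show ?thesis
        unfolding g_def by (simp only: mult.assoc)
    qed
    have "(\<lambda>m. (CK ^ (n + 1) * CL * exp (c * x) * I) * exp (- (decay_rate * \<bar>real_of_int m\<bar>))) summable_on (UNIV :: int set)"
      by (intro summable_on_cmult_right summable_exp_abs_int decay_rate_pos)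
    thus "(\<lambda>m. LINT y|lborel. norm (g m y)) summable_on UNIV"
    proof (rule summable_on_comparison_test)
      fix m
      have "(LINT y|lborel. norm (g m y)) \<le> (LINT y|lborel. CK ^ (n + 1) * CL * exp (- (decay_rate * \<bar>real_of_int m\<bar>)) * exp (c * x) * norm (Complex c y) powr (-\<sigma>))"
        by (intro integral_mono integrable_norm gi integrable_mult_right Iint gn)
      thus "(LINT y|lborel. norm (g m y)) \<le> (CK ^ (n + 1) * CL * exp (c * x) * I) * exp (- (decay_rate * \<bar>real_of_int m\<bar>))"
        unfolding integral_mult_right_zero I_def by (simp add: mult_ac)
    qed auto
  qed
  thus ?thesis unfolding gI .
qed

text \<open>
  Here \<open>x\<^bsup>s-1\<^esup>\<close> splits into the real power of \<open>x\<close> and \<open>exp (2\<pi>im (-log\<^sub>E x))\<close>, so that the integral of the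
  \<open>n\<close>-th term is a value of \<open>B\<^sub>n\<close>.
\<close>
lemma B_value:
  assumes d: "log E (p1 * q0) < -1" and x: "x > 0" and c: "c > 0"
  shows "(LINT y|lborel. Wf (Complex c y) ^ (n + 1) * Lf (Complex c y) * exp (Complex c y * of_real x))
    = 2 * of_real pi * (of_real (x powr (- log E (p1 ^ (n + 1) * q0) - 1)) * gw_B p q n (- log E x))"
proof -
  have e: "exp ((sexp n m - 1) * of_real (ln x)) = of_real (x powr (- log E (p1 ^ (n + 1) * q0) - 1)) * exp (2 * of_real pi * \<i> * of_int m * of_real (- log E x))" for m
  proof -
    have s: "sexp n m = of_real (- log E (p1 ^ (n + 1) * q0)) + \<i> * of_real (- (2 * pi * real_of_int m / ln E))"
      using sexp_Re[of n m] sexp_Im[of n m] by (simp add: complex_eq_iff)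
    have "(sexp n m - 1) * of_real (ln x) = of_real ((- log E (p1 ^ (n + 1) * q0) - 1) * ln x) + 2 * of_real pi * \<i> * of_int m * of_real (- log E x)"
      unfolding s log_def[of E x] by (simp add: algebra_simps)
    from this show ?thesis unfolding \<open>(sexp n m - 1) * of_real (ln x) = _\<close> exp_add exp_of_real powr_def using x by simp
  qed
  have "((\<lambda>m. (2 * of_real pi * of_real (x powr (- log E (p1 ^ (n + 1) * q0) - 1))) * (gw_theta p q n m * exp (2 * of_real pi * \<i> * of_int m * of_real (- log E x)) / gw_Gamma p q n m)) has_sum
     (LINT y|lborel. Wf (Complex c y) ^ (n + 1) * Lf (Complex c y) * exp (Complex c y * of_real x))) UNIV"
    using W_line_integral[OF d x c, of n] unfolding e gw_Gamma_eq by (simp add: mult_ac)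
  from infsumI[OF this] show ?thesis unfolding gw_B_def infsum_cmult_right' by (simp only: mult.assoc)
qed

text \<open>
  On the line \<open>Re z = T\<close> the \<open>n\<close>-th term is at most \<open>|A\<^sub>n| (rA/2)\<^sup>n\<close> times a fixed integrable function.
\<close>
theorem p_imm_series:
  assumes d: "log E (p1 * q0) < -1" and x: "x > 0"
  shows "(\<lambda>n. gw_A p q n * of_real (x powr (- log E (p1 ^ (n + 1) * q0) - 1)) * gw_B p q n (- log E x)) sums gw_p_imm p q x"
proof -
  have T: "T > 0" using T_ge_1 by simp
  have z: "Re (Complex T y) \<ge> 0" "norm (Complex T y) \<ge> T" for y
    using T complex_Re_le_cmod[of "Complex T y"] by auto
  define f where "f = (\<lambda>n y. gw_A p q n * (Wf (Complex T y) ^ (n + 1) * Lf (Complex T y) * exp (Complex T y * of_real x)))"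
  define \<sigma> where "\<sigma> = - log E (p1 * q0)"
  have \<sigma>1: "\<sigma> > 1" using d by (simp add: \<sigma>_def)
  define I where "I = (LINT y|lborel. norm (Complex T y) powr (-\<sigma>))"
  have Iint: "integrable lborel (\<lambda>y. norm (Complex T y) powr (-\<sigma>))" by (rule integrable_vertical_line_powr[OF \<sigma>1 T])
  define M where "M = CK * CL * exp (T * x)"
  have M: "M \<ge> 0" using CK_pos CL_pos by (simp add: M_def)
  have fn: "norm (f n y) \<le> norm (gw_A p q n) * (rA/2) ^ n * M * norm (Complex T y) powr (-\<sigma>)" for n y
  proof -
    have "norm (f n y) = norm (gw_A p q n) * (norm (Wf (Complex T y)) ^ n * norm (Wf (Complex T y)) * norm (Lf (Complex T y))) * exp (T * x)"
      by (simp add: f_def norm_mult norm_power)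
    also have "\<dots> \<le> norm (gw_A p q n) * ((rA/2) ^ n * (CK * norm (Complex T y) powr (log E p1)) * (CL * norm (Complex T y) powr (log E q0))) * exp (T * x)"
      using Wf_le[OF z, of y] Wf_small[OF z, of y] Lf_le[OF z, of y] rA_pos CK_pos CL_pos by (intro mult_right_mono mult_left_mono mult_mono power_mono) auto
    also have "\<dots> = norm (gw_A p q n) * (rA/2) ^ n * M * norm (Complex T y) powr (-\<sigma>)"
      unfolding \<sigma>_def log_p1q0 minus_minus powr_add M_def by (simp add: mult_ac)
    finally show ?thesis .
  qed
  have fi: "integrable lborel (f n)" for n
  proof (rule Bochner_Integration.integrable_bound)
    show "integrable lborel (\<lambda>y. norm (gw_A p q n) * (rA/2) ^ n * M * norm (Complex T y) powr (-\<sigma>))"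
      by (intro integrable_mult_right Iint)
    have "continuous_on UNIV (f n)" unfolding f_def
      by (intro continuous_line_sector[OF _ T]) (intro holomorphic_intros Wf_hol Lf_hol)
    thus "f n \<in> borel_measurable lborel" using borel_measurable_continuous_onI by simp
    show "AE y in lborel. norm (f n y) \<le> norm (norm (gw_A p q n) * (rA/2) ^ n * M * norm (Complex T y) powr (-\<sigma>))"
      using fn order_trans[OF _ abs_ge_self] by (intro AE_I2) (simp only: real_norm_def, blast)
  qed
  have sA: "summable (\<lambda>n. norm (gw_A p q n) * (rA/2) ^ n)"
    by (rule A_abs_summable[OF A_hol]) (use rA_pos in auto)
  have fsums: "(\<lambda>n. f n y) sums (gw_Pi_imm p q (Complex T y) * exp (Complex T y * of_real x))" for y
  proof -
    have "norm (Wf (Complex T y)) < rA" using Wf_small[OF z, of y] rA_pos by simp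
    from sums_mult[OF A_series[OF A_hol this], of "Wf (Complex T y) * Lf (Complex T y) * exp (Complex T y * of_real x)"]
    show ?thesis unfolding f_def Pi_imm_tail[OF z] by (simp add: mult_ac)
  qed
  have "(\<lambda>n. LINT y|lborel. f n y) sums (LINT y|lborel. (\<Sum>n. f n y))"
  proof (rule sums_integral[OF fi])
    show "AE y in lborel. summable (\<lambda>n. norm (f n y))"
    proof (rule AE_I2)
      fix y
      have "summable (\<lambda>n. norm (gw_A p q n) * (rA/2) ^ n * (M * norm (Complex T y) powr (-\<sigma>)))" by (rule summable_mult2[OF sA])
      thus "summable (\<lambda>n. norm (f n y))"
        by (rule summable_comparison_test[rotated]) (use fn[of _ y] in \<open>auto simp: mult.assoc\<close>)
    qed
    have "summable (\<lambda>n. norm (gw_A p q n) * (rA/2) ^ n * (M * I))" by (rule summable_mult2[OF sA])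
    thus "summable (\<lambda>n. LINT y|lborel. norm (f n y))"
    proof (rule summable_comparison_test[rotated], intro exI allI impI)
      fix n
      have "(LINT y|lborel. norm (f n y)) \<le> (LINT y|lborel. norm (gw_A p q n) * (rA/2) ^ n * M * norm (Complex T y) powr (-\<sigma>))"
        by (intro integral_mono integrable_norm fi integrable_mult_right Iint fn)
      moreover have "(LINT y|lborel. norm (f n y)) \<ge> 0" by (intro Bochner_Integration.integral_nonneg) auto
      ultimately show "norm (LINT y|lborel. norm (f n y)) \<le> norm (gw_A p q n) * (rA/2) ^ n * (M * I)"
        unfolding integral_mult_right_zero I_def by (simp add: mult.assoc)
    qed
  qed
  also have "(\<lambda>y. \<Sum>n. f n y) = (\<lambda>y. gw_Pi_imm p q (Complex T y) * exp (Complex T y * of_real x))"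
    using fsums by (simp add: sums_iff)
  finally have "(\<lambda>n. LINT y|lborel. f n y) sums (LINT y|lborel. gw_Pi_imm p q (Complex T y) * exp (Complex T y * of_real x))" .
  from sums_mult[OF this, of "1 / (2 * of_real pi)"]
  have "(\<lambda>n. 1 / (2 * of_real pi) * (LINT y|lborel. f n y)) sums gw_p_imm p q x"
    unfolding p_imm_shifted_line[OF d x T] .
  moreover have "1 / (2 * of_real pi) * (LINT y|lborel. f n y) = gw_A p q n * of_real (x powr (- log E (p1 ^ (n + 1) * q0) - 1)) * gw_B p q n (- log E x)" for n
    unfolding f_def integral_mult_right_zero B_value[OF d x T] by (simp add: mult_ac)
  ultimately show ?thesis by simp
qed

lemma theta_Gamma_bound:
  assumes d: "log E (p1 * q0) < -1"
  shows "norm (gw_theta p q n m / gw_Gamma p q n m) \<le> CK ^ (n + 1) * CL * exp (- (decay_rate * \<bar>real_of_int m\<bar>)) * rGamma (Re (sexp n m))"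
proof -
  define \<sigma> \<tau> where "\<sigma> = Re (sexp n m)" and "\<tau> = Im (sexp n m)"
  have s: "sexp n m = Complex \<sigma> \<tau>" by (simp add: \<sigma>_def \<tau>_def)
  have \<sigma>1: "\<sigma> > 1" unfolding \<sigma>_def by (rule sexp_Re_ge[OF d])
  have rG: "rGamma \<sigma> \<ge> 0" using \<sigma>1 Gamma_real_pos[of \<sigma>] by (simp add: rGamma_inverse_Gamma)
  have "norm (gw_theta p q n m / gw_Gamma p q n m) = norm (gw_theta p q n m) * norm (rGamma (Complex \<sigma> \<tau>))"
    unfolding gw_Gamma_eq s by (simp add: rGamma_inverse_Gamma norm_mult norm_inverse divide_inverse)
  also have "\<dots> \<le> norm (gw_theta p q n m) * (rGamma \<sigma> * exp (pi * \<bar>\<tau>\<bar> / 2))"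
    using \<sigma>1 by (intro mult_left_mono rGamma_le_rGamma_Re) auto
  also have "\<dots> = (norm (gw_theta p q n m) * exp (\<bar>Im (sexp n m)\<bar> * (pi / 2))) * rGamma \<sigma>"
    by (simp add: \<tau>_def mult_ac)
  also have "\<dots> \<le> (CK ^ (n + 1) * CL * exp (- (decay_rate * \<bar>real_of_int m\<bar>))) * rGamma \<sigma>"
    by (intro mult_right_mono theta_phase_bound rG)
  finally show ?thesis by (simp add: \<sigma>_def)
qed

theorem B_terms_summable:
  assumes d: "log E (p1 * q0) < -1"
  shows "(\<lambda>m::int. gw_theta p q n m * exp (2 * of_real pi * \<i> * of_int m * of_real z) / gw_Gamma p q n m) summable_on UNIV"
proof (rule abs_summable_summable)
  have "(\<lambda>m. (CK ^ (n + 1) * CL * rGamma (Re (sexp n 0))) * exp (- (decay_rate * \<bar>real_of_int m\<bar>))) summable_on (UNIV :: int set)"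
    by (intro summable_on_cmult_right summable_exp_abs_int decay_rate_pos)
  thus "(\<lambda>m::int. norm (gw_theta p q n m * exp (2 * of_real pi * \<i> * of_int m * of_real z) / gw_Gamma p q n m)) summable_on UNIV"
  proof (rule summable_on_comparison_test)
    fix m :: int
    have "norm (exp (2 * of_real pi * \<i> * of_int m * of_real z)) = 1" by simp
    hence "norm (gw_theta p q n m * exp (2 * of_real pi * \<i> * of_int m * of_real z) / gw_Gamma p q n m) = norm (gw_theta p q n m / gw_Gamma p q n m)"
      by (simp only: norm_mult norm_divide mult_1_right)
    also have "\<dots> \<le> CK ^ (n + 1) * CL * exp (- (decay_rate * \<bar>real_of_int m\<bar>)) * rGamma (Re (sexp n m))"
      by (rule theta_Gamma_bound[OF d])
    also have "Re (sexp n m) = Re (sexp n 0)" unfolding sexp_Re ..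
    finally show "norm (gw_theta p q n m * exp (2 * of_real pi * \<i> * of_int m * of_real z) / gw_Gamma p q n m) \<le> (CK ^ (n + 1) * CL * rGamma (Re (sexp n 0))) * exp (- (decay_rate * \<bar>real_of_int m\<bar>))"
      by (simp add: mult_ac)
  qed auto
qed

text \<open>
  The exponent of the bound is \<open>O(n) - \<sigma> ln \<sigma> - decay_rate |m|\<close> with \<open>\<sigma> = a n + \<delta>\<close>.  Half of the term \<open>a n ln (n + 1)\<close>
  contained in \<open>\<sigma> ln \<sigma>\<close> absorbs the linear part; the other half, together with half of the decay in \<open>m\<close>,
  dominates \<open>\<alpha> n ln (n + |m|)\<close>.
\<close>
theorem coefficient_bound:
  assumes d: "log E (p1 * q0) < -1"
  shows "\<exists>\<alpha> \<beta> C :: real. \<alpha> > 0 \<and> \<beta> > 0 \<and> C > 0 \<and>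
            (\<forall>(n::nat) (m::int). norm (gw_A p q n * gw_theta p q n m / gw_Gamma p q n m)
               \<le> C * exp (- \<alpha> * real n * ln (real n + \<bar>real_of_int m\<bar>) - \<beta> * \<bar>real_of_int m\<bar>))"
proof -
  define s where "s = rA / 2"
  have s: "s > 0" using rA_pos by (simp add: s_def)
  have sA: "summable (\<lambda>n. norm (gw_A p q n) * s ^ n)"
    unfolding s_def by (rule A_abs_summable[OF A_hol]) (use rA_pos in auto)
  define CA where "CA = 1 + (\<Sum>n. norm (gw_A p q n) * s ^ n)"
  have CA0: "(\<Sum>n. norm (gw_A p q n) * s ^ n) \<ge> 0" using sA s by (intro suminf_nonneg) auto
  have A: "norm (gw_A p q n) \<le> CA * (1 / s) ^ n" for n
  proof -
    have "norm (gw_A p q n) * s ^ n \<le> (\<Sum>n. norm (gw_A p q n) * s ^ n)"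
      using sum_le_suminf[OF sA, of "{n}"] s by simp
    hence "norm (gw_A p q n) * s ^ n \<le> CA" by (simp add: CA_def)
    thus ?thesis using s by (simp add: field_simps power_one_over)
  qed
  define a where "a = - log E p1"
  have a: "a > 0" using log_p1_neg by (simp add: a_def)
  define \<delta> where "\<delta> = - log E (p1 * q0)"
  have \<delta>: "\<delta> > 1" using d by (simp add: \<delta>_def)
  define b where "b = - log E q0"
  have b: "b \<ge> 0" using log_q0_le by (simp add: b_def)
  have \<delta>ab: "\<delta> = a + b" unfolding \<delta>_def a_def b_def log_p1q0 by simp
  have Re_s: "Re (sexp n m) = real n * a + \<delta>" for n m
    using sexp_Re_ge(2)[OF d, of n m] by (simp add: a_def \<delta>_def)
  define K1 where "K1 = ln (CK / s) + 2 * a - a * ln a"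
  obtain B where B: "\<And>n::nat. K1 * real n - (a / 2) * real n * ln (real n + 1) \<le> B"
    using n_ln_n_dominates[of "a / 2" K1] a by auto
  define C where "C = CA * CK * CL * exp (2 * \<delta>) * exp B"
  have CA: "CA > 0" using CA0 by (simp add: CA_def)
  have C: "C > 0" using CA CK_pos CL_pos by (simp add: C_def)
  define \<alpha> where "\<alpha> = min (a / 2) (decay_rate / 2)"
  have \<alpha>: "\<alpha> > 0" "\<alpha> \<le> a / 2" "\<alpha> \<le> decay_rate / 2" using a decay_rate_pos by (auto simp: \<alpha>_def)
  show ?thesis
  proof (intro exI conjI allI)
    show "\<alpha> > 0" by (rule \<alpha>)
    show "decay_rate / 2 > 0" using decay_rate_pos by simp
    show "C > 0" by (rule C)
    fix n :: nat and m :: int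
    define \<sigma> where "\<sigma> = real n * a + \<delta>"
    have na: "real n * a \<ge> 0" using a by simp
    have \<sigma>1: "\<sigma> > 1" using na \<delta> by (simp add: \<sigma>_def)
    have ln\<sigma>: "ln \<sigma> \<ge> 0" "ln \<sigma> \<ge> ln a + ln (real n + 1)"
    proof -
      show "ln \<sigma> \<ge> 0" using \<sigma>1 by simp
      have "a * (real n + 1) \<le> \<sigma>" using b by (simp add: \<sigma>_def \<delta>ab algebra_simps)
      hence "ln (a * (real n + 1)) \<le> ln \<sigma>" using a \<sigma>1 by (subst ln_le_cancel_iff) auto
      thus "ln \<sigma> \<ge> ln a + ln (real n + 1)" using a by (simp add: ln_mult)
    qed
    have "\<sigma> * ln \<sigma> \<ge> (real n * a) * ln \<sigma>" using ln\<sigma> \<delta> by (intro mult_right_mono) (auto simp: \<sigma>_def)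
    moreover have "(real n * a) * ln \<sigma> \<ge> (real n * a) * (ln a + ln (real n + 1))" using ln\<sigma>(2) na by (rule mult_left_mono)
    ultimately have sl: "\<sigma> * ln \<sigma> \<ge> (real n * a) * (ln a + ln (real n + 1))" by linarith
    have e1: "2 * \<sigma> - \<sigma> * ln \<sigma> + real n * ln (CK / s) \<le> 2 * \<delta> + B - (a / 2) * real n * ln (real n + 1)"
      using sl B[of n] by (simp add: \<sigma>_def K1_def algebra_simps)
    have "norm (gw_A p q n * gw_theta p q n m / gw_Gamma p q n m) = norm (gw_A p q n) * norm (gw_theta p q n m / gw_Gamma p q n m)"
      by (simp add: norm_mult norm_divide)
    also have "\<dots> \<le> (CA * (1 / s) ^ n) * (CK ^ (n + 1) * CL * exp (- (decay_rate * \<bar>real_of_int m\<bar>)) * rGamma (Re (sexp n m)))"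
      using CA s by (intro mult_mono A theta_Gamma_bound[OF d]) auto
    also have "rGamma (Re (sexp n m)) \<le> exp (2 * \<sigma> - \<sigma> * ln \<sigma>)"
      unfolding Re_s \<sigma>_def[symmetric] using \<sigma>1 by (intro rGamma_real_le) simp
    also have "(CA * (1 / s) ^ n) * (CK ^ (n + 1) * CL * exp (- (decay_rate * \<bar>real_of_int m\<bar>)) * exp (2 * \<sigma> - \<sigma> * ln \<sigma>))
       = CA * CK * CL * (CK / s) ^ n * exp (- (decay_rate * \<bar>real_of_int m\<bar>)) * exp (2 * \<sigma> - \<sigma> * ln \<sigma>)"
      by (simp add: power_divide)
    also have "(CK / s) ^ n = exp (real n * ln (CK / s))"
      using CK_pos s by (simp add: exp_of_nat_mult)
    also have "CA * CK * CL * exp (real n * ln (CK / s)) * exp (- (decay_rate * \<bar>real_of_int m\<bar>)) * exp (2 * \<sigma> - \<sigma> * ln \<sigma>)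
       = CA * CK * CL * exp (2 * \<sigma> - \<sigma> * ln \<sigma> + real n * ln (CK / s) - decay_rate * \<bar>real_of_int m\<bar>)"
      by (simp add: exp_add[symmetric] algebra_simps)
    also have "\<dots> \<le> CA * CK * CL * exp (2 * \<delta> + B + (- \<alpha> * real n * ln (real n + \<bar>real_of_int m\<bar>) - decay_rate / 2 * \<bar>real_of_int m\<bar>))"
    proof (rule mult_left_mono)
      have l: "real n * ln (real n + \<bar>real_of_int m\<bar>) \<le> real n * ln (real n + 1) + \<bar>real_of_int m\<bar>"
      proof (cases "n = 0")
        case False
        hence n: "real n > 0" by simp
        have dl: "real n * (L + M / real n) = real n * L + M" for L M using n by (simp add: distrib_left)
        have "ln (real n + \<bar>real_of_int m\<bar>) = ln (real n * (1 + \<bar>real_of_int m\<bar> / real n))" unfolding dl by simp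
        also have "\<dots> = ln (real n) + ln (1 + \<bar>real_of_int m\<bar> / real n)" using n by (intro ln_mult_pos) (auto intro: add_pos_nonneg)
        also have "\<dots> \<le> ln (real n + 1) + \<bar>real_of_int m\<bar> / real n"
          using n by (intro add_mono ln_add_one_self_le_self) auto
        finally have "real n * ln (real n + \<bar>real_of_int m\<bar>) \<le> real n * (ln (real n + 1) + \<bar>real_of_int m\<bar> / real n)"
          using n by (intro mult_left_mono) auto
        thus ?thesis unfolding dl .
      qed simp
      have "\<alpha> * (real n * ln (real n + \<bar>real_of_int m\<bar>)) \<le> \<alpha> * (real n * ln (real n + 1) + \<bar>real_of_int m\<bar>)"
        using l \<alpha>(1) by (intro mult_left_mono) auto
      also have "\<dots> = \<alpha> * (real n * ln (real n + 1)) + \<alpha> * \<bar>real_of_int m\<bar>" by (rule distrib_left)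
      also have "\<dots> \<le> (a / 2) * (real n * ln (real n + 1)) + (decay_rate / 2) * \<bar>real_of_int m\<bar>"
        using \<alpha> by (intro add_mono mult_right_mono) auto
      finally have l2: "\<alpha> * (real n * ln (real n + \<bar>real_of_int m\<bar>)) \<le> (a / 2) * real n * ln (real n + 1) + decay_rate / 2 * \<bar>real_of_int m\<bar>"
        by (simp only: mult.assoc)
      have "2 * \<sigma> - \<sigma> * ln \<sigma> + real n * ln (CK / s) - decay_rate * \<bar>real_of_int m\<bar> \<le> 2 * \<delta> + B - \<alpha> * (real n * ln (real n + \<bar>real_of_int m\<bar>)) - decay_rate / 2 * \<bar>real_of_int m\<bar>"
        using e1 l2 by (simp add: algebra_simps)
      thus "exp (2 * \<sigma> - \<sigma> * ln \<sigma> + real n * ln (CK / s) - decay_rate * \<bar>real_of_int m\<bar>) \<le> exp (2 * \<delta> + B + (- \<alpha> * real n * ln (real n + \<bar>real_of_int m\<bar>) - decay_rate / 2 * \<bar>real_of_int m\<bar>))"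
        by (simp add: algebra_simps)
    qed (use CA CK_pos CL_pos in auto)
    also have "\<dots> = C * exp (- \<alpha> * real n * ln (real n + \<bar>real_of_int m\<bar>) - decay_rate / 2 * \<bar>real_of_int m\<bar>)"
      unfolding C_def exp_add by (simp only: mult.assoc)
    finally show "norm (gw_A p q n * gw_theta p q n m / gw_Gamma p q n m) \<le> C * exp (- \<alpha> * real n * ln (real n + \<bar>real_of_int m\<bar>) - (decay_rate / 2) * \<bar>real_of_int m\<bar>)"
      using CA CK_pos CL_pos s by (simp add: mult_left_mono)
  qed
qed

end

lemma gw_B_periodic: "gw_B p q n (z + 1) = gw_B p q n z"
proof -
  have "exp (2 * of_real pi * \<i> * of_int m * of_real (z + 1)) = exp (2 * of_real pi * \<i> * of_int m * of_real z :: complex)" for m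
    using exp_2pi_i_int_add[of 1 m "of_real z"] by simp
  thus ?thesis unfolding gw_B_def by simp
qed

theorem theorem1p1:
  fixes p q :: "nat pmf" and D :: "complex set" and P :: "complex \<Rightarrow> complex"
  assumes "pmf p 0 = 0" and "0 < pmf p 1" and "pmf p 1 < 1" and "pmf q 0 \<noteq> 0"
    and "pgf p analytic_on {1}" and "pgf q analytic_on {1}"
    and "open D" and "connected D" and "insert 1 (ball 0 1) \<subseteq> D"
    and "P holomorphic_on D" and "\<And>z. z \<in> ball 0 1 \<Longrightarrow> P z = pgf p z"
    and "critical_angle D P > ereal pi"
    and "log (gw_E p) (pmf p 1 * pmf q 0) < -1"
  shows "(\<forall>n z. (\<lambda>m::int. gw_theta p q n m * exp (2 * of_real pi * \<i> * of_int m * of_real z)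
              / gw_Gamma p q n m) summable_on UNIV)
       \<and> (\<forall>n z. gw_B p q n (z + 1) = gw_B p q n z)
       \<and> (\<forall>x>0. (\<lambda>n. gw_A p q n
              * of_real (x powr (- log (gw_E p) (pmf p 1 ^ (n + 1) * pmf q 0) - 1))
              * gw_B p q n (- log (gw_E p) x)) sums gw_p_imm p q x)
       \<and> (\<exists>\<alpha> \<beta> C :: real. \<alpha> > 0 \<and> \<beta> > 0 \<and> C > 0 \<and>
            (\<forall>(n::nat) (m::int). norm (gw_A p q n * gw_theta p q n m / gw_Gamma p q n m)
               \<le> C * exp (- \<alpha> * real n * ln (real n + \<bar>real_of_int m\<bar>) - \<beta> * \<bar>real_of_int m\<bar>)))"
proof -
  interpret gw_immigration p q by unfold_locales (use assms in auto)
  obtain R \<rho> \<kappa> where "gw_sector p q R \<rho> \<kappa>" using gw_sector_exists by blast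
  then interpret gw_sector p q R \<rho> \<kappa> .
  obtain T rA CK CL where "gw_tail p q R \<rho> \<kappa> T rA CK CL" using gw_tail_exists by blast
  then interpret gw_tail p q R \<rho> \<kappa> T rA CK CL .
  show ?thesis
    using B_terms_summable[OF assms(13)] gw_B_periodic[of p q] p_imm_series[OF assms(13)] coefficient_bound[OF assms(13)]
    by blast
qed

end
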